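(* Let $M$ be a compact weighted Riemannian manifold with $Ric_f\ge -Kg$ where $K\ge0$. If $w$ is a positive solution of $(\mathcal{L}_f-q-\partial_t)w=G(w)$ with $0<w\le\frac{A}{e}$ ($A>0$ a constant), $|q|\le\theta_1$, $|G(w)|\le\theta_2|w|$, $|G'(w)|\le\theta_3$, $|\nabla q|\le\theta_4$ for some constants $\theta_1,\theta_2,\theta_3,\theta_4\ge0$, on $M\times(0,T]$, then $$\frac{|\nabla w|^2}{w}\ \le\ \frac{A}{e}\left(\left(\ln\frac{A}{w}-1\right)(\theta_1+\theta_2)+\ln\frac{A}{w}+\frac{\theta_4^2}{\xi}\right)\left(\frac1t+\xi\right),$$ where $\xi=2K+\theta_1+\theta_2+\theta_3+1$.
   Context: $(M^n,g,e^{-f}d\mu)$ is an $n$-dimensional weighted Riemannian manifold, with $g$ independent of time. $f=f(x,t)$ and $q=q(x,t)$ are smooth functions on $M\times(0,T]$, and $w=w(x,t)$ is smooth. $G:\mathbb{R}^+\to\mathbb{R}$ is a sufficiently smooth function, and $G'(w)$ is its derivative with respect to $w$. The weighted Laplacian is $\mathcal{L}_f v=\Delta v-\langle\nabla f,\nabla v\rangle$, and $Ric_f=Ric+\mathrm{Hess}\,f$. *)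

theory Defs
  imports "HOL-Analysis.Analysis"
begin

section \<open>Smooth maps between Euclidean spaces\<close>

text \<open>The set \<open>S\<close> is meant to be open in \<open>Ck_on k S h\<close>; all directional derivatives are required
  to be of class $C^k$, which for a Euclidean domain is the usual $C^{k+1}$.\<close>

primrec Ck_on :: "nat \<Rightarrow> 'a::euclidean_space set \<Rightarrow> ('a \<Rightarrow> 'b::real_normed_vector) \<Rightarrow> bool" where
  "Ck_on 0 S h \<longleftrightarrow> continuous_on S h"
| "Ck_on (Suc k) S h \<longleftrightarrow>
     h differentiable_on S \<and> (\<forall>v. Ck_on k S (\<lambda>x. frechet_derivative h (at x) v))"

text \<open>Smoothness on an arbitrary subset: locally the restriction of a smooth map defined on an open
  set. This is what is needed for the time interval \<open>{0<..T}\<close>, which is not open at \<open>T\<close>.\<close>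

definition smooth_on :: "'a::euclidean_space set \<Rightarrow> ('a \<Rightarrow> 'b::real_normed_vector) \<Rightarrow> bool" where
  "smooth_on S h \<longleftrightarrow>
     (\<forall>x\<in>S. \<exists>V h'. open V \<and> x \<in> V \<and> (\<forall>k. Ck_on k V h') \<and> (\<forall>y\<in>V \<inter> S. h' y = h y))"


section \<open>Smooth manifolds\<close>

text \<open>A chart is a pair of a domain and a coordinate map; the value of the coordinate map outside
  the domain is irrelevant.\<close>

type_synonym ('a, 'n) chart = "'a set \<times> ('a \<Rightarrow> real ^ 'n)"

abbreviation dom_c :: "('a, 'n) chart \<Rightarrow> 'a set" where
  "dom_c c \<equiv> fst c"

abbreviation coord :: "('a, 'n) chart \<Rightarrow> 'a \<Rightarrow> real ^ 'n" where
  "coord c \<equiv> snd c"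

definition param :: "('a, 'n) chart \<Rightarrow> real ^ 'n \<Rightarrow> 'a" where
  "param c = inv_into (dom_c c) (coord c)"

definition is_chart :: "'a topology \<Rightarrow> ('a, 'n::finite) chart \<Rightarrow> bool" where
  "is_chart X c \<longleftrightarrow>
     openin X (dom_c c) \<and> open (coord c ` dom_c c) \<and>
     homeomorphic_map (subtopology X (dom_c c)) (top_of_set (coord c ` dom_c c)) (coord c)"

definition transition :: "('a, 'n) chart \<Rightarrow> ('a, 'n) chart \<Rightarrow> real ^ 'n \<Rightarrow> real ^ 'n" where
  "transition c c' = coord c' \<circ> param c"

text \<open>A manifold without boundary, of dimension \<open>CARD('n)\<close>, with smooth atlas \<open>A\<close>
  (not necessarily maximal).\<close>

locale smooth_manifold =
  fixes X :: "'a topology" and A :: "('a, 'n::finite) chart set"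
  assumes hausdorff: "Hausdorff_space X"
    and second_countable: "second_countable X"
    and charts: "c \<in> A \<Longrightarrow> is_chart X c"
    and cover: "(\<Union>c\<in>A. dom_c c) = topspace X"
    and smooth_transition: "c \<in> A \<Longrightarrow> c' \<in> A \<Longrightarrow>
          smooth_on (coord c ` (dom_c c \<inter> dom_c c')) (transition c c')"

text \<open>\<open>u p t\<close> is the value of the time-dependent function \<open>u\<close> at the point \<open>p\<close> and time \<open>t\<close>.\<close>

definition smooth_spacetime ::
  "('a, 'n::finite) chart set \<Rightarrow> real set \<Rightarrow> ('a \<Rightarrow> real \<Rightarrow> real) \<Rightarrow> bool" where
  "smooth_spacetime A I u \<longleftrightarrow>
     (\<forall>c\<in>A. smooth_on ((coord c ` dom_c c) \<times> I) (\<lambda>(y, t). u (param c y) t))"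

text \<open>The coordinate vector field \<open>\<partial>\<^sub>i\<close> of the chart \<open>c\<close>, applied to the function \<open>u\<close>; it can be
  iterated.\<close>

definition pd :: "('a, 'n::finite) chart \<Rightarrow> 'n \<Rightarrow> ('a \<Rightarrow> real) \<Rightarrow> 'a \<Rightarrow> real" where
  "pd c i u p = frechet_derivative (u \<circ> param c) (at (coord c p)) (axis i 1)"


section \<open>Riemannian metrics\<close>

text \<open>Tensor fields are represented by their components in each chart of the atlas, subject to the
  tensorial transformation law: \<open>g c p $ i $ j\<close> is $g_p(\partial_i,\partial_j)$ in the chart \<open>c\<close>.\<close>

type_synonym ('a, 'n) metric = "('a, 'n) chart \<Rightarrow> 'a \<Rightarrow> real ^ 'n ^ 'n"

definition inner_g ::
  "('a, 'n::finite) metric \<Rightarrow> ('a, 'n) chart \<Rightarrow> 'a \<Rightarrow> real ^ 'n \<Rightarrow> real ^ 'n \<Rightarrow> real" where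
  "inner_g g c p v v' = (\<Sum>i\<in>UNIV. \<Sum>j\<in>UNIV. g c p $ i $ j * v $ i * v' $ j)"

locale riemannian_manifold = smooth_manifold X A
  for X :: "'a topology" and A :: "('a, 'n::finite) chart set" +
  fixes g :: "('a, 'n) metric"
  assumes metric_smooth: "c \<in> A \<Longrightarrow> smooth_on (coord c ` dom_c c) (\<lambda>y. g c (param c y))"
    and metric_sym: "c \<in> A \<Longrightarrow> p \<in> dom_c c \<Longrightarrow> inner_g g c p v v' = inner_g g c p v' v"
    and metric_pos: "c \<in> A \<Longrightarrow> p \<in> dom_c c \<Longrightarrow> v \<noteq> 0 \<Longrightarrow> inner_g g c p v v > 0"
    and metric_transform: "c \<in> A \<Longrightarrow> c' \<in> A \<Longrightarrow> p \<in> dom_c c \<inter> dom_c c' \<Longrightarrow>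
          inner_g g c p v v' =
            inner_g g c' p (frechet_derivative (transition c c') (at (coord c p)) v)
                           (frechet_derivative (transition c c') (at (coord c p)) v')"

text \<open>The operators below are given by their expressions in the chart \<open>c\<close>. For a Riemannian
  manifold the scalars among them do not depend on the chart, and the others transform as tensors
  (except the Christoffel symbols).\<close>

definition g_inv ::
  "('a, 'n::finite) metric \<Rightarrow> ('a, 'n) chart \<Rightarrow> 'n \<Rightarrow> 'n \<Rightarrow> 'a \<Rightarrow> real" where
  "g_inv g c i j p = matrix_inv (g c p) $ i $ j"

definition gradient ::
  "('a, 'n::finite) metric \<Rightarrow> ('a, 'n) chart \<Rightarrow> ('a \<Rightarrow> real) \<Rightarrow> 'a \<Rightarrow> real ^ 'n" where
  "gradient g c u p = (\<chi> i. \<Sum>j\<in>UNIV. g_inv g c i j p * pd c j u p)"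

definition norm_g ::
  "('a, 'n::finite) metric \<Rightarrow> ('a, 'n) chart \<Rightarrow> 'a \<Rightarrow> real ^ 'n \<Rightarrow> real" where
  "norm_g g c p v = sqrt (inner_g g c p v v)"

text \<open>\<open>christoffel g c k i j\<close> is $\Gamma^k_{ij}$, i.e.
  $\nabla_{\partial_i}\partial_j = \sum_k \Gamma^k_{ij}\,\partial_k$ for the Levi-Civita connection.\<close>

definition christoffel ::
  "('a, 'n::finite) metric \<Rightarrow> ('a, 'n) chart \<Rightarrow> 'n \<Rightarrow> 'n \<Rightarrow> 'n \<Rightarrow> 'a \<Rightarrow> real" where
  "christoffel g c k i j p = (1/2) * (\<Sum>l\<in>UNIV. g_inv g c k l p *
     (pd c i (\<lambda>x. g c x $ j $ l) p + pd c j (\<lambda>x. g c x $ i $ l) p - pd c l (\<lambda>x. g c x $ i $ j) p))"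

definition hess ::
  "('a, 'n::finite) metric \<Rightarrow> ('a, 'n) chart \<Rightarrow> ('a \<Rightarrow> real) \<Rightarrow> 'n \<Rightarrow> 'n \<Rightarrow> 'a \<Rightarrow> real" where
  "hess g c u i j p = pd c i (pd c j u) p - (\<Sum>k\<in>UNIV. christoffel g c k i j p * pd c k u p)"

definition laplacian ::
  "('a, 'n::finite) metric \<Rightarrow> ('a, 'n) chart \<Rightarrow> ('a \<Rightarrow> real) \<Rightarrow> 'a \<Rightarrow> real" where
  "laplacian g c u p = (\<Sum>i\<in>UNIV. \<Sum>j\<in>UNIV. g_inv g c i j p * hess g c u i j p)"

text \<open>\<open>riemann g c l i j k\<close> is $R^l{}_{ijk}$, where
  $R(\partial_i,\partial_j)\partial_k = \sum_l R^l{}_{ijk}\,\partial_l$ and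
  $R(Y,Z) = \nabla_Y\nabla_Z - \nabla_Z\nabla_Y - \nabla_{[Y,Z]}$. The Ricci tensor is
  $Ric(Y,Z) = \mathrm{tr}(V \mapsto R(V,Y)Z)$, which is positive on round spheres.\<close>

definition riemann ::
  "('a, 'n::finite) metric \<Rightarrow> ('a, 'n) chart \<Rightarrow> 'n \<Rightarrow> 'n \<Rightarrow> 'n \<Rightarrow> 'n \<Rightarrow> 'a \<Rightarrow> real" where
  "riemann g c l i j k p =
     pd c i (christoffel g c l j k) p - pd c j (christoffel g c l i k) p
     + (\<Sum>m\<in>UNIV. christoffel g c l i m p * christoffel g c m j k p
               - christoffel g c l j m p * christoffel g c m i k p)"

definition ricci ::
  "('a, 'n::finite) metric \<Rightarrow> ('a, 'n) chart \<Rightarrow> 'n \<Rightarrow> 'n \<Rightarrow> 'a \<Rightarrow> real" where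
  "ricci g c j k p = (\<Sum>i\<in>UNIV. riemann g c i i j k p)"


section \<open>Weighted manifolds\<close>

definition weighted_laplacian ::
  "('a, 'n::finite) metric \<Rightarrow> ('a, 'n) chart \<Rightarrow> ('a \<Rightarrow> real) \<Rightarrow> ('a \<Rightarrow> real) \<Rightarrow> 'a \<Rightarrow> real" where
  "weighted_laplacian g c f u p =
     laplacian g c u p - inner_g g c p (gradient g c f p) (gradient g c u p)"

definition ricci_f ::
  "('a, 'n::finite) metric \<Rightarrow> ('a, 'n) chart \<Rightarrow> ('a \<Rightarrow> real) \<Rightarrow> 'a \<Rightarrow> real ^ 'n \<Rightarrow> real ^ 'n \<Rightarrow> real" where
  "ricci_f g c f p v v' =
     (\<Sum>i\<in>UNIV. \<Sum>j\<in>UNIV. (ricci g c i j p + hess g c f i j p) * v $ i * v' $ j)"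

end

theory Submission
  imports Defs
begin

text \<open>Put $B = A/e$, $k = 2 + \theta_4^2/\xi$ and, for small $d > 0$, $\varphi(t) = (t-d)/(1+\xi(t-d))$.
  The maximum principle shows $\varphi\,|\nabla w|^2 < k\,w\,(B'-w)$ on $[d,T]$ for every $B' > B$. Indeed, at
  a first point where equality holds, $\nabla w \neq 0$, and the vanishing of the spatial derivative of
  $\varphi|\nabla w|^2 - k\,w\,(B'-w)$ makes $\nabla w$ an eigenvector of $\mathrm{Hess}\,w$ with
  eigenvalue $k(B'-2w)/(2\varphi)$. The resulting lower bound for $|\mathrm{Hess}\,w|^2$ in the weighted
  Bochner formula leaves the good term $-k^2B'^2/(2\varphi)$, which dominates all the others, also those with
  $2\theta_3$ in place of $\theta_3$. Letting $d \to 0$ and $B' \to B$ gives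
  $|\nabla w|^2/w \le k\,(B-w)\,(1/t+\xi)$, and $1 - w/B \le \ln(B/w)$ yields the claim.
  Starting at time $d$ avoids the lack of control as $t \to 0$, and $B' > B$ keeps the barrier positive.\<close>

section \<open>Calculus of smooth maps on open sets\<close>

definition Cinf_on :: "'a::euclidean_space set \<Rightarrow> ('a \<Rightarrow> 'b::real_normed_vector) \<Rightarrow> bool" where
  "Cinf_on S h \<longleftrightarrow> (\<forall>k. Ck_on k S h)"

abbreviation dird :: "'a::euclidean_space \<Rightarrow> ('a \<Rightarrow> 'b::real_normed_vector) \<Rightarrow> 'a \<Rightarrow> 'b" where
  "dird v h \<equiv> \<lambda>x. frechet_derivative h (at x) v"

text \<open>\<open>frechet_derivative\<close> is a choice among the derivatives, so it suffices that
  both maps have the same derivatives at \<open>x\<close>. The equality therefore also holds where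
  neither is differentiable.\<close>

lemma frechet_derivative_cong_open:
  assumes "open S" "x \<in> S" "\<And>y. y \<in> S \<Longrightarrow> h y = h' y"
  shows "frechet_derivative h (at x) = frechet_derivative h' (at x)"
proof -
  have "(h has_derivative F) (at x) \<longleftrightarrow> (h' has_derivative F) (at x)" for F
    using has_derivative_transform_within_open[OF _ assms(1,2)] assms(3) by metis
  then show ?thesis by (simp add: frechet_derivative_def)
qed

lemma Ck_on_cong:
  assumes "open S" "\<And>x. x \<in> S \<Longrightarrow> h x = h' x"
  shows "Ck_on k S h \<longleftrightarrow> Ck_on k S h'"
  using assms(2)
proof (induction k arbitrary: h h')
  case 0
  then show ?case by (simp cong: continuous_on_cong)
next
  case (Suc k)
  have "h differentiable_on S \<longleftrightarrow> h' differentiable_on S"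
    using Suc.prems unfolding differentiable_on_def differentiable_def
    by (metis (no_types, lifting) has_derivative_transform)
  moreover have "Ck_on k S (dird v h) \<longleftrightarrow> Ck_on k S (dird v h')" for v
    by (rule Suc.IH) (metis assms(1) frechet_derivative_cong_open Suc.prems)
  ultimately show ?case by simp
qed

lemma Ck_on_subset: "Ck_on k S h \<Longrightarrow> T \<subseteq> S \<Longrightarrow> Ck_on k T h"
proof (induction k arbitrary: h)
  case 0
  then show ?case using continuous_on_subset[of S h T] by simp
next
  case (Suc k)
  then show ?case using differentiable_on_subset[of h S T] by simp
qed

lemma Ck_on_Suc_imp: "Ck_on (Suc k) S h \<Longrightarrow> Ck_on k S h"
proof (induction k arbitrary: h)
  case 0
  then show ?case using differentiable_imp_continuous_on by simp blast
next
  case (Suc k)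
  then show ?case by (metis Ck_on.simps(2))
qed

lemma Ck_on_local:
  assumes "\<And>x. x \<in> S \<Longrightarrow> \<exists>V. open V \<and> x \<in> V \<and> Ck_on k V h"
  shows "Ck_on k S h"
  using assms
proof (induction k arbitrary: h)
  case 0
  then show ?case
    by (metis Ck_on.simps(1) continuous_at_imp_continuous_on continuous_on_eq_continuous_at)
next
  case (Suc k)
  have "h differentiable_on S"
    using Suc.prems
    by (metis Ck_on.simps(2) differentiable_at_imp_differentiable_on differentiable_on_eq_differentiable_at)
  moreover have "Ck_on k S (dird v h)" for v
    by (rule Suc.IH) (metis Ck_on.simps(2) Suc.prems)
  ultimately show ?case by simp
qed

lemma Ck_on_Suc_differentiable:
  "open S \<Longrightarrow> Ck_on (Suc k) S h \<Longrightarrow> x \<in> S \<Longrightarrow> h differentiable (at x)"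
  using differentiable_on_eq_differentiable_at[of S h] by simp

text \<open>Lets a closed formula \<open>H\<close> on \<open>S\<close> replace the chosen
  derivative. The closure properties below all follow one pattern: a rule for the derivative, this
  lemma, and induction on the order.\<close>

lemma Ck_on_SucI:
  assumes "open S" "\<And>x. x \<in> S \<Longrightarrow> (h has_derivative H x) (at x)"
    and "\<And>v. Ck_on k S (\<lambda>x. H x v)"
  shows "Ck_on (Suc k) S h"
proof -
  have "h differentiable_on S"
    using assms(2) by (meson differentiable_at_imp_differentiable_on differentiable_def)
  moreover have "Ck_on k S (dird v h)" for v
  proof -
    have "dird v h x = H x v" if "x \<in> S" for x
      by (simp add: frechet_derivative_at[OF assms(2)[OF that], symmetric])
    then show ?thesis using Ck_on_cong[OF assms(1), of "dird v h" "\<lambda>x. H x v"] assms(3) by simp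
  qed
  ultimately show ?thesis by simp
qed

lemma Ck_on_Suc_has_derivative:
  "open S \<Longrightarrow> Ck_on (Suc k) S h \<Longrightarrow> x \<in> S \<Longrightarrow> (h has_derivative frechet_derivative h (at x)) (at x)"
  using Ck_on_Suc_differentiable[of S k h x] frechet_derivative_works[of h "at x"] by simp

lemma Ck_on_const: "Ck_on k S (\<lambda>x. c)"
  by (induction k arbitrary: c) auto

lemma Ck_on_add:
  assumes "open S" "Ck_on k S h" "Ck_on k S h'"
  shows "Ck_on k S (\<lambda>x. h x + h' x)"
  using assms(2,3)
proof (induction k arbitrary: h h')
  case (Suc k)
  note D = Suc.prems[THEN Ck_on_Suc_has_derivative[OF assms(1)]]
  show ?case
    by (rule Ck_on_SucI[OF assms(1) has_derivative_add[OF D]]) (use Suc in auto)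
qed (simp add: continuous_on_add[of S])

lemma Ck_on_bounded_linear:
  assumes "open S" "bounded_linear l" "Ck_on k S h"
  shows "Ck_on k S (\<lambda>x. l (h x))"
  using assms(3)
proof (induction k arbitrary: h)
  case 0
  then show ?case using assms(2) by (simp add: bounded_linear.continuous_on)
next
  case (Suc k)
  note D = Ck_on_Suc_has_derivative[OF assms(1) Suc.prems]
  show ?case
    by (rule Ck_on_SucI[OF assms(1) bounded_linear.has_derivative[OF assms(2) D]]) (use Suc in auto)
qed

lemma Ck_on_mult:
  fixes h h' :: "'a::euclidean_space \<Rightarrow> real"
  assumes "open S" "Ck_on k S h" "Ck_on k S h'"
  shows "Ck_on k S (\<lambda>x. h x * h' x)"
  using assms(2,3)
proof (induction k arbitrary: h h')
  case (Suc k)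
  note D = Suc.prems[THEN Ck_on_Suc_has_derivative[OF assms(1)]]
  have D': "((\<lambda>x. h x * h' x) has_derivative (\<lambda>v. h x * dird v h' x + dird v h x * h' x)) (at x)"
    if "x \<in> S" for x
    by (rule has_derivative_mult[OF D(1)[OF that] D(2)[OF that]])
  show ?case
  proof (rule Ck_on_SucI[OF assms(1) D'])
    show "Ck_on k S (\<lambda>x. h x * dird v h' x + dird v h x * h' x)" for v
      using Suc.prems by (intro Ck_on_add[OF assms(1)] Suc.IH Suc.prems[THEN Ck_on_Suc_imp]) simp_all
  qed
qed (simp add: continuous_on_mult[of S])

lemma Ck_on_inverse:
  fixes h :: "'a::euclidean_space \<Rightarrow> real"
  assumes "open S" "Ck_on k S h" "\<And>x. x \<in> S \<Longrightarrow> h x \<noteq> 0"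
  shows "Ck_on k S (\<lambda>x. inverse (h x))"
  using assms(2)
proof (induction k)
  case 0
  then show ?case using assms(3) by (simp add: continuous_on_inverse)
next
  case (Suc k)
  note D = Ck_on_Suc_has_derivative[OF assms(1) Suc.prems]
  have D': "((\<lambda>x. inverse (h x)) has_derivative (\<lambda>v. (-1) * (inverse (h x) * dird v h x * inverse (h x)))) (at x)"
    if "x \<in> S" for x
    using Deriv.has_derivative_inverse[OF assms(3)[OF that] D[OF that]] by simp
  show ?case
  proof (rule Ck_on_SucI[OF assms(1) D'])
    note I = Suc.IH[OF Ck_on_Suc_imp[OF Suc.prems]]
    show "Ck_on k S (\<lambda>x. (-1) * (inverse (h x) * dird v h x * inverse (h x)))" for v
      by (rule Ck_on_mult[OF assms(1) Ck_on_const Ck_on_mult[OF assms(1) Ck_on_mult[OF assms(1) I] I]])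
        (use Suc.prems in simp)
  qed
qed

lemma Ck_on_affine:
  fixes h :: "'b::euclidean_space \<Rightarrow> 'c::real_normed_vector" and l :: "'a::euclidean_space \<Rightarrow> 'b"
  assumes "open S" "open V" "bounded_linear l" "\<And>x. x \<in> S \<Longrightarrow> l x + b \<in> V" "Ck_on k V h"
  shows "Ck_on k S (\<lambda>x. h (l x + b))"
  using assms(5)
proof (induction k arbitrary: h)
  case 0
  have "continuous_on S (\<lambda>x. l x + b)"
    using assms(3) by (intro continuous_intros linear_continuous_on)
  with 0 show ?case using assms(4)
    by (auto intro: continuous_on_compose2)
next
  case (Suc k)
  have "((\<lambda>x. l x + b) has_derivative l) (at x)" for x
    using assms(3) by (auto intro!: derivative_eq_intros bounded_linear_imp_has_derivative)
  then have D: "((\<lambda>x. h (l x + b)) has_derivative (\<lambda>v. dird (l v) h (l x + b))) (at x)" if "x \<in> S" for x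
    using has_derivative_compose[of "\<lambda>x. l x + b" l x UNIV h "frechet_derivative h (at (l x + b))"]
      Ck_on_Suc_has_derivative[OF assms(2) Suc.prems assms(4)[OF that]] by blast
  have C: "Ck_on k S (\<lambda>x. dird (l v) h (l x + b))" for v
    by (rule Suc.IH) (use Suc.prems in auto)
  show ?case by (rule Ck_on_SucI[OF assms(1) D C])
qed

lemma Cinf_on_dird: "Cinf_on S h \<Longrightarrow> Cinf_on S (dird v h)"
  unfolding Cinf_on_def by (metis Ck_on.simps(2))

lemma Cinf_on_differentiable: "Cinf_on S h \<Longrightarrow> open S \<Longrightarrow> x \<in> S \<Longrightarrow> h differentiable (at x)"
  unfolding Cinf_on_def using Ck_on_Suc_differentiable by blast

lemma Cinf_on_has_derivative:
  "Cinf_on S h \<Longrightarrow> open S \<Longrightarrow> x \<in> S \<Longrightarrow> (h has_derivative frechet_derivative h (at x)) (at x)"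
  using Cinf_on_differentiable frechet_derivative_works by blast

lemma Cinf_on_continuous: "Cinf_on S h \<Longrightarrow> continuous_on S h"
  unfolding Cinf_on_def using Ck_on.simps(1) by blast

lemma Cinf_on_const: "Cinf_on S (\<lambda>x. c)"
  by (simp add: Cinf_on_def Ck_on_const)

lemma Cinf_on_add: "open S \<Longrightarrow> Cinf_on S h \<Longrightarrow> Cinf_on S h' \<Longrightarrow> Cinf_on S (\<lambda>x. h x + h' x)"
  by (simp add: Cinf_on_def Ck_on_add)

lemma Cinf_on_mult:
  fixes h :: "'a::euclidean_space \<Rightarrow> real"
  shows "open S \<Longrightarrow> Cinf_on S h \<Longrightarrow> Cinf_on S h' \<Longrightarrow> Cinf_on S (\<lambda>x. h x * h' x)"
  by (simp add: Cinf_on_def Ck_on_mult)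

lemma Cinf_on_diff:
  fixes h :: "'a::euclidean_space \<Rightarrow> real"
  assumes "open S" "Cinf_on S h" "Cinf_on S h'" shows "Cinf_on S (\<lambda>x. h x - h' x)"
  using Cinf_on_add[OF assms(1,2) Cinf_on_mult[OF assms(1) Cinf_on_const assms(3), of "-1"]] by simp

lemma Cinf_on_sum:
  "open S \<Longrightarrow> (\<And>i. i \<in> I \<Longrightarrow> Cinf_on S (h i)) \<Longrightarrow> Cinf_on S (\<lambda>x. \<Sum>i\<in>I. h i x)"
  by (induction I rule: infinite_finite_induct) (auto intro: Cinf_on_const Cinf_on_add)

lemma Cinf_on_prod:
  fixes h :: "'i \<Rightarrow> 'a::euclidean_space \<Rightarrow> real"
  shows "open S \<Longrightarrow> (\<And>i. i \<in> I \<Longrightarrow> Cinf_on S (h i)) \<Longrightarrow> Cinf_on S (\<lambda>x. \<Prod>i\<in>I. h i x)"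
  by (induction I rule: infinite_finite_induct) (auto intro: Cinf_on_const Cinf_on_mult)

lemma Cinf_on_inverse:
  fixes h :: "'a::euclidean_space \<Rightarrow> real"
  shows "open S \<Longrightarrow> Cinf_on S h \<Longrightarrow> (\<And>x. x \<in> S \<Longrightarrow> h x \<noteq> 0) \<Longrightarrow> Cinf_on S (\<lambda>x. inverse (h x))"
  by (simp add: Cinf_on_def Ck_on_inverse)

lemma Cinf_on_bounded_linear:
  "open S \<Longrightarrow> bounded_linear l \<Longrightarrow> Cinf_on S h \<Longrightarrow> Cinf_on S (\<lambda>x. l (h x))"
  by (simp add: Cinf_on_def Ck_on_bounded_linear)

lemma Cinf_on_subset: "Cinf_on S h \<Longrightarrow> T \<subseteq> S \<Longrightarrow> Cinf_on T h"
  unfolding Cinf_on_def using Ck_on_subset by blast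

lemma Cinf_on_cong:
  "open S \<Longrightarrow> (\<And>x. x \<in> S \<Longrightarrow> h x = h' x) \<Longrightarrow> Cinf_on S h \<longleftrightarrow> Cinf_on S h'"
  unfolding Cinf_on_def using Ck_on_cong by blast

lemma Cinf_on_local:
  "(\<And>x. x \<in> S \<Longrightarrow> \<exists>V. open V \<and> x \<in> V \<and> Cinf_on V h) \<Longrightarrow> Cinf_on S h"
  unfolding Cinf_on_def by (meson Ck_on_local)

lemma smooth_on_open_imp_Cinf_on:
  assumes "smooth_on S h" "open S" shows "Cinf_on S h"
proof (rule Cinf_on_local)
  fix x assume "x \<in> S"
  then obtain V h' where V: "open V" "x \<in> V" "Cinf_on V h'" "\<forall>y\<in>V \<inter> S. h' y = h y"
    using assms(1) unfolding smooth_on_def Cinf_on_def by metis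
  have "Cinf_on (V \<inter> S) h'" using V(3) Cinf_on_subset by blast
  then have "Cinf_on (V \<inter> S) h" using Cinf_on_cong[of "V \<inter> S" h' h] V assms(2) by blast
  then show "\<exists>V. open V \<and> x \<in> V \<and> Cinf_on V h"
    using V(1,2) assms(2) \<open>x \<in> S\<close> by blast
qed

section \<open>Restriction of space-time maps to a fixed time\<close>

lemma Cinf_on_slice:
  fixes h :: "'a::euclidean_space \<times> real \<Rightarrow> 'c::real_normed_vector"
  assumes "open S" "open V" "\<And>x. x \<in> S \<Longrightarrow> (x, t) \<in> V" "Cinf_on V h"
  shows "Cinf_on S (\<lambda>x. h (x, t))"
proof -
  have l: "bounded_linear (\<lambda>x::'a. (x, 0::real))"
    by (intro bounded_linear_Pair bounded_linear_ident bounded_linear_zero)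
  show ?thesis
    using Ck_on_affine[OF assms(1,2) l, of "(0,t)" _ h] assms(3,4) unfolding Cinf_on_def by simp
qed

lemma dird_slice:
  fixes h :: "'a::euclidean_space \<times> real \<Rightarrow> 'c::real_normed_vector"
  assumes "h differentiable (at (x, t))"
  shows "dird v (\<lambda>x. h (x, t)) x = dird (v, 0) h (x, t)"
proof -
  have "(h has_derivative frechet_derivative h (at (x, t))) (at (x, t))"
    using assms frechet_derivative_works by blast
  moreover have "((\<lambda>x. (x, t)) has_derivative (\<lambda>v. (v, 0))) (at x)"
    by (auto intro!: derivative_eq_intros)
  ultimately have "((\<lambda>x. h (x, t)) has_derivative (\<lambda>v. dird (v, 0) h (x, t))) (at x)"
    using has_derivative_compose by fastforce
  then show ?thesis by (metis frechet_derivative_at)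
qed

text \<open>A local extension is smooth on an open subset of space-time and agrees with
  \<open>h\<close> on the whole slice near \<open>x\<close>. Hence smoothness in space holds at
  every time of \<open>I\<close>, including an endpoint.\<close>

lemma smooth_on_slice:
  fixes h :: "'a::euclidean_space \<times> real \<Rightarrow> 'c::real_normed_vector"
  assumes "smooth_on (S \<times> I) h" "open S" "t \<in> I"
  shows "Cinf_on S (\<lambda>x. h (x, t))"
proof (rule Cinf_on_local)
  fix x assume "x \<in> S"
  then obtain V h' where V: "open V" "(x, t) \<in> V" "Cinf_on V h'" "\<forall>y\<in>V \<inter> S \<times> I. h' y = h y"
    using assms(1,3) unfolding smooth_on_def Cinf_on_def by (metis mem_Times_iff fst_conv snd_conv)
  obtain N where N: "open N" "x \<in> N" "\<And>y. y \<in> N \<Longrightarrow> (y, t) \<in> V"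
    using V(1,2) by (metis mem_Times_iff fst_conv open_prod_elim snd_conv subsetD)
  have "Cinf_on (N \<inter> S) (\<lambda>x. h' (x, t))"
    using Cinf_on_slice[of "N \<inter> S" V t h'] V N assms(2) by blast
  then have "Cinf_on (N \<inter> S) (\<lambda>x. h (x, t))"
    using Cinf_on_cong[of "N \<inter> S" "\<lambda>x. h' (x, t)" "\<lambda>x. h (x, t)"] V(4) N assms(2,3) by blast
  then show "\<exists>V. open V \<and> x \<in> V \<and> Cinf_on V (\<lambda>x. h (x, t))"
    using N(1,2) assms(2) \<open>x \<in> S\<close> by (intro exI[of _ "N \<inter> S"]) auto
qed

section \<open>Second derivatives and positive definite matrices\<close>

lemma dird_add:
  assumes "h differentiable (at x)" "h' differentiable (at x)"
  shows "dird v (\<lambda>x. h x + h' x) x = dird v h x + dird v h' x"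
proof -
  have "((\<lambda>x. h x + h' x) has_derivative (\<lambda>v. dird v h x + dird v h' x)) (at x)"
    using assms by (intro has_derivative_add) (simp_all add: frechet_derivative_works)
  then show ?thesis by (simp add: frechet_derivative_at[symmetric])
qed

lemma dird_diff:
  assumes "h differentiable (at x)" "h' differentiable (at x)"
  shows "dird v (\<lambda>x. h x - h' x) x = dird v h x - dird v h' x"
proof -
  have "((\<lambda>x. h x - h' x) has_derivative (\<lambda>v. dird v h x - dird v h' x)) (at x)"
    using assms by (intro has_derivative_diff) (simp_all add: frechet_derivative_works)
  then show ?thesis by (simp add: frechet_derivative_at[symmetric])
qed

lemma dird_mult:
  fixes h h' :: "'a::euclidean_space \<Rightarrow> real"
  assumes "h differentiable (at x)" "h' differentiable (at x)"
  shows "dird v (\<lambda>x. h x * h' x) x = h x * dird v h' x + dird v h x * h' x"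
proof -
  have "((\<lambda>x. h x * h' x) has_derivative (\<lambda>v. h x * dird v h' x + dird v h x * h' x)) (at x)"
    using assms by (intro has_derivative_mult) (simp_all add: frechet_derivative_works)
  then show ?thesis by (simp add: frechet_derivative_at[symmetric])
qed

lemma dird_sum:
  assumes "\<And>i. i \<in> I \<Longrightarrow> h i differentiable (at x)"
  shows "dird v (\<lambda>x. \<Sum>i\<in>I. h i x) x = (\<Sum>i\<in>I. dird v (h i) x)"
proof -
  have "((\<lambda>x. \<Sum>i\<in>I. h i x) has_derivative (\<lambda>v. \<Sum>i\<in>I. frechet_derivative (h i) (at x) v)) (at x)"
    using assms by (intro has_derivative_sum) (simp add: frechet_derivative_works)
  then show ?thesis by (simp add: frechet_derivative_at[symmetric])
qed

lemma dird_cmult: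
  fixes h :: "'a::euclidean_space \<Rightarrow> real"
  shows "h differentiable (at x) \<Longrightarrow> dird v (\<lambda>x. c * h x) x = c * dird v h x"
  using dird_mult[of "\<lambda>x. c" x h v] by simp

lemma dird_cong:
  assumes "open S" "x \<in> S" "\<And>y. y \<in> S \<Longrightarrow> h y = h' y"
  shows "dird v h x = dird v h' x"
  using frechet_derivative_cong_open[OF assms] by simp

lemma dird_DERIV_comp:
  fixes h :: "'a::euclidean_space \<Rightarrow> real"
  assumes "h differentiable (at x)" "(\<phi> has_real_derivative d) (at (h x))"
  shows "dird v (\<lambda>x. \<phi> (h x)) x = d * dird v h x"
proof -
  have "((\<lambda>x. \<phi> (h x)) has_derivative (\<lambda>v. d * frechet_derivative h (at x) v)) (at x)"
    using has_derivative_compose[of h "frechet_derivative h (at x)" x UNIV \<phi> "(*) d"] assms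
    by (simp add: frechet_derivative_works has_field_derivative_def)
  then show ?thesis by (simp add: frechet_derivative_at[symmetric])
qed

lemma DERIV_along_line:
  fixes h :: "'a::euclidean_space \<Rightarrow> real"
  assumes "h differentiable (at (x + a *\<^sub>R v))"
  shows "((\<lambda>a. h (x + a *\<^sub>R v)) has_real_derivative dird v h (x + a *\<^sub>R v)) (at a)"
proof -
  let ?F = "frechet_derivative h (at (x + a *\<^sub>R v))"
  have F: "(h has_derivative ?F) (at (x + a *\<^sub>R v))"
    using assms frechet_derivative_works by blast
  have "((\<lambda>a. x + a *\<^sub>R v) has_derivative (\<lambda>s. s *\<^sub>R v)) (at a)"
    by (auto intro!: derivative_eq_intros)
  from has_derivative_compose[OF this F]
  have "((\<lambda>a. h (x + a *\<^sub>R v)) has_derivative (\<lambda>s. ?F (s *\<^sub>R v))) (at a)" .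
  moreover have "?F (s *\<^sub>R v) = ?F v * s" for s
    using linear_cmul[OF has_derivative_linear[OF F]] by simp
  ultimately show ?thesis by (simp add: has_field_derivative_def)
qed

text \<open>The mean value theorem, applied along \<open>u\<close> to a difference in direction
  \<open>v\<close> and then along \<open>v\<close>, turns the second difference into $s^2$ times the
  mixed derivative at a nearby point. Continuity of that derivative gives the limit.\<close>

lemma second_difference_tendsto:
  fixes h :: "'a::euclidean_space \<Rightarrow> real"
  assumes "open S" "Cinf_on S h" "x \<in> S"
  shows "((\<lambda>s. (h (x + s *\<^sub>R u + s *\<^sub>R v) - h (x + s *\<^sub>R u) - h (x + s *\<^sub>R v) + h x) / s\<^sup>2)
           \<longlongrightarrow> dird v (dird u h) x) (at_right 0)"
proof (rule tendstoI)
  fix e :: real assume "e > 0"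
  define k where "k = dird v (dird u h)"
  have "continuous_on S k"
    unfolding k_def by (intro Cinf_on_continuous Cinf_on_dird assms)
  then have "isCont k x" using assms(1,3) continuous_on_eq_continuous_at by blast
  then obtain r1 where r1: "r1 > 0" "\<And>z. dist z x < r1 \<Longrightarrow> dist (k z) (k x) < e"
    using \<open>e > 0\<close> unfolding continuous_at_eps_delta by blast
  obtain r2 where r2: "r2 > 0" "ball x r2 \<subseteq> S"
    using assms(1,3) open_contains_ball by blast
  define r where "r = min r1 r2"
  have r: "r > 0" using r1(1) r2(1) by (simp add: r_def)
  \<comment> \<open>For \<open>s < d\<close> the whole parallelogram spanned by \<open>s u\<close>
    and \<open>s v\<close> stays within distance \<open>r\<close> of \<open>x\<close>; the summand 1
    covers \<open>u = v = 0\<close>.\<close>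
  define d where "d = r / (norm u + norm v + 1)"
  have np: "norm u + norm v + 1 > 0"
    using norm_ge_zero[of u] norm_ge_zero[of v] by linarith
  have "d > 0" using r np by (simp add: d_def)
  have near: "dist (x + a *\<^sub>R u + b *\<^sub>R v) x < r" if "0 \<le> a" "a \<le> s" "0 \<le> b" "b \<le> s" "s < d" for a b s
  proof -
    have "dist (x + a *\<^sub>R u + b *\<^sub>R v) x = norm (a *\<^sub>R u + b *\<^sub>R v)"
      by (simp add: dist_norm)
    also have "\<dots> \<le> a * norm u + b * norm v"
      using norm_triangle_ineq[of "a *\<^sub>R u" "b *\<^sub>R v"] that by simp
    also have "\<dots> \<le> s * norm u + s * norm v"
      using that by (intro add_mono mult_right_mono) auto
    also have "\<dots> \<le> s * (norm u + norm v + 1)"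
      using that by (simp add: algebra_simps)
    also have "\<dots> < r"
      using \<open>s < d\<close> np by (simp add: d_def pos_less_divide_eq)
    finally show ?thesis .
  qed
  have inS: "x + a *\<^sub>R u + b *\<^sub>R v \<in> S" if "0 \<le> a" "a \<le> s" "0 \<le> b" "b \<le> s" "s < d" for a b s
    using near[OF that] r2(2) by (auto simp: r_def dist_commute)
  have dh: "Cinf_on S (dird u h)" using assms(2) by (rule Cinf_on_dird)
  show "eventually (\<lambda>s. dist ((h (x + s *\<^sub>R u + s *\<^sub>R v) - h (x + s *\<^sub>R u) - h (x + s *\<^sub>R v) + h x) / s\<^sup>2)
      (dird v (dird u h) x) < e) (at_right 0)"
  proof (rule eventually_at_rightI[of 0 d])
    fix s assume "s \<in> {0<..<d}"
    then have s: "0 < s" "s < d" by auto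
    define F where "F = (\<lambda>a. h (x + s *\<^sub>R v + a *\<^sub>R u) - h (x + a *\<^sub>R u))"
    have F': "(F has_real_derivative (dird u h (x + s *\<^sub>R v + a *\<^sub>R u) - dird u h (x + a *\<^sub>R u))) (at a)"
      if "0 \<le> a" "a \<le> s" for a
      unfolding F_def
    proof (intro DERIV_diff DERIV_along_line Cinf_on_differentiable[OF assms(2,1)])
      show "x + s *\<^sub>R v + a *\<^sub>R u \<in> S" using inS[of a s s] that s by (simp add: ac_simps)
      show "x + a *\<^sub>R u \<in> S" using inS[of a s 0] that s by simp
    qed
    obtain a where a: "0 < a" "a < s"
      "F s - F 0 = (s - 0) * (dird u h (x + s *\<^sub>R v + a *\<^sub>R u) - dird u h (x + a *\<^sub>R u))"
      using MVT2[of 0 s F "\<lambda>a. dird u h (x + s *\<^sub>R v + a *\<^sub>R u) - dird u h (x + a *\<^sub>R u)"] F' s by blast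
    define G where "G = (\<lambda>b. dird u h (x + a *\<^sub>R u + b *\<^sub>R v))"
    have G': "(G has_real_derivative k (x + a *\<^sub>R u + b *\<^sub>R v)) (at b)" if "0 \<le> b" "b \<le> s" for b
      unfolding G_def k_def
      using inS[of a s b] that s a by (intro DERIV_along_line Cinf_on_differentiable[OF dh assms(1)]) auto
    obtain b where b: "0 < b" "b < s" "G s - G 0 = (s - 0) * k (x + a *\<^sub>R u + b *\<^sub>R v)"
      using MVT2[of 0 s G "\<lambda>b. k (x + a *\<^sub>R u + b *\<^sub>R v)"] G' s by blast
    have "h (x + s *\<^sub>R u + s *\<^sub>R v) - h (x + s *\<^sub>R u) - h (x + s *\<^sub>R v) + h x = F s - F 0"
      by (simp add: F_def ac_simps)
    also have "\<dots> = s * (G s - G 0)"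
      using a(3) by (simp add: G_def ac_simps)
    also have "\<dots> = s\<^sup>2 * k (x + a *\<^sub>R u + b *\<^sub>R v)"
      using b(3) by (simp add: power2_eq_square)
    finally have "(h (x + s *\<^sub>R u + s *\<^sub>R v) - h (x + s *\<^sub>R u) - h (x + s *\<^sub>R v) + h x) / s\<^sup>2 = k (x + a *\<^sub>R u + b *\<^sub>R v)"
      using s by simp
    moreover have "dist (k (x + a *\<^sub>R u + b *\<^sub>R v)) (k x) < e"
      using r1(2) near[of a s b] a b s by (simp add: r_def)
    ultimately show "dist ((h (x + s *\<^sub>R u + s *\<^sub>R v) - h (x + s *\<^sub>R u) - h (x + s *\<^sub>R v) + h x) / s\<^sup>2)
        (dird v (dird u h) x) < e"
      by (simp add: k_def)
  qed (use \<open>d > 0\<close> in simp)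
qed

text \<open>The second difference is symmetric in \<open>u\<close> and \<open>v\<close>, and each
  order of differentiation is a limit of it.\<close>

lemma dird_commute:
  fixes h :: "'a::euclidean_space \<Rightarrow> real"
  assumes "open S" "Cinf_on S h" "x \<in> S"
  shows "dird v (dird u h) x = dird u (dird v h) x"
proof (rule tendsto_unique[OF _ second_difference_tendsto[OF assms]])
  show "((\<lambda>s. (h (x + s *\<^sub>R u + s *\<^sub>R v) - h (x + s *\<^sub>R u) - h (x + s *\<^sub>R v) + h x) / s\<^sup>2)
           \<longlongrightarrow> dird u (dird v h) x) (at_right 0)"
  proof -
    have "h (x + s *\<^sub>R v + s *\<^sub>R u) = h (x + s *\<^sub>R u + s *\<^sub>R v)" for s
      by (rule arg_cong[of _ _ h]) (simp add: ac_simps)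
    then have "h (x + s *\<^sub>R v + s *\<^sub>R u) - h (x + s *\<^sub>R v) - h (x + s *\<^sub>R u) + h x
        = h (x + s *\<^sub>R u + s *\<^sub>R v) - h (x + s *\<^sub>R u) - h (x + s *\<^sub>R v) + h x" for s
      by simp
    then show ?thesis using second_difference_tendsto[OF assms, of v u] by (simp only:)
  qed
qed simp

text \<open>Everything happens on the line through \<open>x\<close> in direction \<open>v\<close>.
  If the second derivative were positive, the first derivative, being 0 at \<open>x\<close>, would
  be positive just beyond, and the mean value theorem would give values above the maximum.\<close>

lemma dird_at_max:
  fixes h :: "'a::euclidean_space \<Rightarrow> real"
  assumes "open S" "Cinf_on S h" "x \<in> S" "\<And>y. y \<in> S \<Longrightarrow> h y \<le> h x"
  shows "dird v h x = 0" and "dird v (dird v h) x \<le> 0"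
proof -
  have "open ((\<lambda>a. x + a *\<^sub>R v) -` S)"
    by (intro open_vimage assms(1) continuous_intros)
  moreover have "0 \<in> (\<lambda>a. x + a *\<^sub>R v) -` S" using assms(3) by simp
  ultimately obtain d where "d > 0" "ball 0 d \<subseteq> (\<lambda>a. x + a *\<^sub>R v) -` S"
    using openE[of "(\<lambda>a. x + a *\<^sub>R v) -` S" 0] by metis
  then have d: "d > 0" "\<And>a. \<bar>a\<bar> < d \<Longrightarrow> x + a *\<^sub>R v \<in> S"
    by (auto simp: subset_iff)
  have D: "((\<lambda>a. h (x + a *\<^sub>R v)) has_real_derivative dird v h (x + a *\<^sub>R v)) (at a)" if "\<bar>a\<bar> < d" for a
    using d(2)[OF that] by (intro DERIV_along_line Cinf_on_differentiable[OF assms(2,1)])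
  show 1: "dird v h x = 0"
    using DERIV_local_max[OF D[of 0] d(1)] d assms(4) by simp
  show "dird v (dird v h) x \<le> 0"
  proof (rule ccontr)
    assume pos: "\<not> dird v (dird v h) x \<le> 0"
    have "((\<lambda>a. dird v h (x + a *\<^sub>R v)) has_real_derivative dird v (dird v h) (x + 0 *\<^sub>R v)) (at 0)"
      using assms(3) by (intro DERIV_along_line Cinf_on_differentiable[OF Cinf_on_dird[OF assms(2)] assms(1)]) simp
    from DERIV_pos_inc_right[OF this] pos
    obtain r where r: "r > 0" "\<And>a. 0 < a \<Longrightarrow> a < r \<Longrightarrow> dird v h (x + a *\<^sub>R v) > 0"
      using 1 by auto
    define s where "s = min r d / 2"
    have s: "0 < s" "s < r" "s < d" using r(1) d(1) by (auto simp: s_def)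
    obtain a where a: "0 < a" "a < s" "h (x + s *\<^sub>R v) - h (x + 0 *\<^sub>R v) = (s - 0) * dird v h (x + a *\<^sub>R v)"
      using MVT2[of 0 s "\<lambda>a. h (x + a *\<^sub>R v)" "\<lambda>a. dird v h (x + a *\<^sub>R v)"] D s by force
    moreover have "dird v h (x + a *\<^sub>R v) > 0" using r(2) a s by simp
    ultimately have "h (x + s *\<^sub>R v) - h x > 0" using s by simp
    then show False using assms(4)[of "x + s *\<^sub>R v"] d(2)[of s] s by simp
  qed
qed

lemma dird_eq_sum_axis:
  fixes h :: "real ^ 'n::finite \<Rightarrow> real"
  assumes "h differentiable (at x)"
  shows "dird v h x = (\<Sum>i\<in>UNIV. v $ i * dird (axis i 1) h x)"
proof -
  have lin: "linear (frechet_derivative h (at x))"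
    using assms frechet_derivative_works has_derivative_linear by blast
  have "v = (\<Sum>i\<in>UNIV. v $ i *\<^sub>R axis i 1)"
    using basis_expansion[of v] by (simp add: scalar_mult_eq_scaleR)
  then have "dird v h x = frechet_derivative h (at x) (\<Sum>i\<in>UNIV. v $ i *\<^sub>R axis i 1)"
    by (rule arg_cong)
  then show ?thesis
    by (simp add: linear_sum[OF lin] linear_cmul[OF lin])
qed

lemma hessian_at_max:
  fixes h :: "real ^ 'n::finite \<Rightarrow> real"
  assumes "open S" "Cinf_on S h" "x \<in> S" "\<And>y. y \<in> S \<Longrightarrow> h y \<le> h x"
  shows "(\<Sum>i\<in>UNIV. \<Sum>j\<in>UNIV. v i * v j * dird (axis i 1) (dird (axis j 1) h) x) \<le> 0"
proof -
  define V where "V = (\<chi> i. v i)"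
  have d: "dird (axis j 1) h differentiable (at x)" for j
    by (rule Cinf_on_differentiable[OF Cinf_on_dird[OF assms(2)] assms(1,3)])
  have "dird V (dird V h) x = dird V (\<lambda>y. \<Sum>j\<in>UNIV. V $ j * dird (axis j 1) h y) x"
    by (rule dird_cong[OF assms(1,3)]) (intro dird_eq_sum_axis Cinf_on_differentiable[OF assms(2,1)])
  also have "\<dots> = (\<Sum>j\<in>UNIV. V $ j * dird V (dird (axis j 1) h) x)"
    using d by (simp add: dird_sum dird_cmult)
  also have "\<dots> = (\<Sum>j\<in>UNIV. \<Sum>i\<in>UNIV. v i * v j * dird (axis i 1) (dird (axis j 1) h) x)"
    by (simp only: dird_eq_sum_axis[where v=V, OF d]) (simp add: V_def sum_distrib_left mult_ac)
  also have "\<dots> = (\<Sum>i\<in>UNIV. \<Sum>j\<in>UNIV. v i * v j * dird (axis i 1) (dird (axis j 1) h) x)"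
    by (rule sum.swap)
  finally show ?thesis using dird_at_max(2)[OF assms, of V] by simp
qed

text \<open>A Cholesky factorisation by induction on the index set: splitting off the index
  \<open>a\<close> leaves the Schur complement \<open>M'\<close>, which is again positive
  definite.\<close>

lemma posdef_gram:
  fixes M :: "'i \<Rightarrow> 'i \<Rightarrow> real"
  assumes "finite I" "\<And>i j. i \<in> I \<Longrightarrow> j \<in> I \<Longrightarrow> M i j = M j i"
    and "\<And>x. \<exists>i\<in>I. x i \<noteq> 0 \<Longrightarrow> (\<Sum>i\<in>I. \<Sum>j\<in>I. M i j * x i * x j) > 0"
  shows "\<exists>V. \<forall>i\<in>I. \<forall>j\<in>I. M i j = (\<Sum>k\<in>I. V k i * V k j)"
  using assms
proof (induction I arbitrary: M)
  case empty
  then show ?case by simp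
next
  case (insert a I)
  note sym = insert.prems(1) and pos = insert.prems(2)
  have quad: "(\<Sum>i\<in>insert a I. \<Sum>j\<in>insert a I. M i j * x i * x j)
      = M a a * (x a)\<^sup>2 + 2 * x a * (\<Sum>j\<in>I. M a j * x j) + (\<Sum>i\<in>I. \<Sum>j\<in>I. M i j * x i * x j)" for x
  proof -
    have "(\<Sum>i\<in>I. M i a * x i * x a) = x a * (\<Sum>j\<in>I. M a j * x j)"
      unfolding sum_distrib_left by (rule sum.cong) (use sym in auto)
    moreover have "(\<Sum>j\<in>I. M a j * x a * x j) = x a * (\<Sum>j\<in>I. M a j * x j)"
      by (simp add: sum_distrib_left mult_ac)
    ultimately show ?thesis
      using insert.hyps by (simp add: sum.distrib power2_eq_square algebra_simps)
  qed
  have Maa: "M a a > 0"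
  proof -
    have "(\<Sum>i\<in>I. \<Sum>j\<in>I. M i j * (if i = a then 1 else 0) * (if j = a then 1 else 0)) = 0"
      using insert.hyps by (intro sum.neutral ballI) auto
    moreover have "(\<Sum>j\<in>I. M a j * (if j = a then 1 else 0)) = 0"
      using insert.hyps by (intro sum.neutral ballI) auto
    ultimately show ?thesis
      using pos[of "\<lambda>i. if i = a then 1 else 0"] quad[of "\<lambda>i. if i = a then 1 else 0"] by simp
  qed
  define M' where "M' = (\<lambda>i j. M i j - M a i * M a j / M a a)"
  have "\<exists>V. \<forall>i\<in>I. \<forall>j\<in>I. M' i j = (\<Sum>k\<in>I. V k i * V k j)"
  proof (rule insert.IH)
    show "M' i j = M' j i" if "i \<in> I" "j \<in> I" for i j
      using sym that by (simp add: M'_def mult.commute)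
    show "(\<Sum>i\<in>I. \<Sum>j\<in>I. M' i j * x i * x j) > 0" if x: "\<exists>i\<in>I. x i \<noteq> 0" for x
    proof -
      define m where "m = (\<Sum>j\<in>I. M a j * x j)"
      \<comment> \<open>This value of the \<open>a\<close>-coordinate minimises the form of
        \<open>M\<close> for the given \<open>x\<close>; the minimum is the form of
        \<open>M'\<close> at \<open>x\<close>.\<close>
      define y where "y = x(a := - m / M a a)"
      have yx: "y i = x i" if "i \<in> I" for i
        using that insert.hyps by (auto simp: y_def)
      have "0 < (\<Sum>i\<in>insert a I. \<Sum>j\<in>insert a I. M i j * y i * y j)"
        by (rule pos) (use x yx in auto)
      also have "\<dots> = M a a * (m / M a a)\<^sup>2 - 2 * (m / M a a) * m + (\<Sum>i\<in>I. \<Sum>j\<in>I. M i j * x i * x j)"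
        unfolding quad using yx by (simp add: m_def y_def cong: sum.cong)
      also have "\<dots> = (\<Sum>i\<in>I. \<Sum>j\<in>I. M i j * x i * x j) - m * m / M a a"
        using Maa by (simp add: power2_eq_square field_simps)
      also have "m * m / M a a = (\<Sum>i\<in>I. \<Sum>j\<in>I. M a i * M a j / M a a * x i * x j)"
        by (simp add: m_def sum_product sum_divide_distrib mult_ac)
      also have "(\<Sum>i\<in>I. \<Sum>j\<in>I. M i j * x i * x j) - \<dots> = (\<Sum>i\<in>I. \<Sum>j\<in>I. M' i j * x i * x j)"
        by (simp add: M'_def sum_subtractf[symmetric] algebra_simps)
      finally show ?thesis .
    qed
  qed
  then obtain V where V: "\<And>i j. i \<in> I \<Longrightarrow> j \<in> I \<Longrightarrow> M' i j = (\<Sum>k\<in>I. V k i * V k j)" by blast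
  define W where "W = (\<lambda>k i. if k = a then M a i / sqrt (M a a) else if i = a then 0 else V k i)"
  have "M i j = (\<Sum>k\<in>insert a I. W k i * W k j)" if ij: "i \<in> insert a I" "j \<in> insert a I" for i j
  proof -
    have "(\<Sum>k\<in>insert a I. W k i * W k j) = M a i * M a j / M a a + (\<Sum>k\<in>I. W k i * W k j)"
      using insert.hyps Maa by (simp add: W_def)
    also have "(\<Sum>k\<in>I. W k i * W k j) = (if i = a \<or> j = a then 0 else \<Sum>k\<in>I. V k i * V k j)"
      using insert.hyps by (auto simp: W_def intro!: sum.neutral sum.cong)
    finally have "(\<Sum>k\<in>insert a I. W k i * W k j)
        = M a i * M a j / M a a + (if i = a \<or> j = a then 0 else M' i j)"
      using V ij by auto
    then show ?thesis
      using Maa sym ij by (auto simp: M'_def)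
  qed
  then show ?case by blast
qed

text \<open>With $M = V^TV$ the trace of $MN$ is the sum of the quadratic form of \<open>N\<close>
  over the rows of \<open>V\<close>. This takes the place of diagonalising the metric at a
  maximum.\<close>

lemma posdef_trace_nonpos:
  fixes M N :: "'n::finite \<Rightarrow> 'n \<Rightarrow> real"
  assumes "\<And>i j. M i j = M j i"
    and "\<And>x. \<exists>i. x i \<noteq> 0 \<Longrightarrow> (\<Sum>i\<in>UNIV. \<Sum>j\<in>UNIV. M i j * x i * x j) > 0"
    and "\<And>v. (\<Sum>i\<in>UNIV. \<Sum>j\<in>UNIV. v i * v j * N i j) \<le> 0"
  shows "(\<Sum>i\<in>UNIV. \<Sum>j\<in>UNIV. M i j * N i j) \<le> 0"
proof -
  have "\<exists>V. \<forall>i\<in>UNIV. \<forall>j\<in>UNIV. M i j = (\<Sum>k\<in>(UNIV::'n set). V k i * V k j)"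
    by (rule posdef_gram) (use assms(1,2) in simp_all)
  then obtain V where V: "\<And>i j. M i j = (\<Sum>k\<in>(UNIV::'n set). V k i * V k j)" by blast
  have "(\<Sum>i\<in>UNIV. \<Sum>j\<in>UNIV. M i j * N i j) = (\<Sum>i\<in>UNIV. \<Sum>j\<in>UNIV. \<Sum>k\<in>UNIV. V k i * V k j * N i j)"
    by (simp add: V sum_distrib_right)
  also have "\<dots> = (\<Sum>i\<in>UNIV. \<Sum>k\<in>UNIV. \<Sum>j\<in>UNIV. V k i * V k j * N i j)"
    by (intro sum.cong sum.swap refl)
  also have "\<dots> = (\<Sum>k\<in>UNIV. \<Sum>i\<in>UNIV. \<Sum>j\<in>UNIV. V k i * V k j * N i j)"
    by (rule sum.swap)
  also have "\<dots> \<le> 0"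
    by (rule sum_nonpos) (rule assms(3))
  finally show ?thesis .
qed

lemma sum_swap_pairs:
  "(\<Sum>i\<in>A. \<Sum>j\<in>B. \<Sum>k\<in>C. \<Sum>l\<in>D. F i j k l) = (\<Sum>k\<in>C. \<Sum>l\<in>D. \<Sum>i\<in>A. \<Sum>j\<in>B. F i j k l)"
proof -
  have "(\<Sum>i\<in>A. \<Sum>j\<in>B. \<Sum>k\<in>C. \<Sum>l\<in>D. F i j k l) = (\<Sum>i\<in>A. \<Sum>k\<in>C. \<Sum>j\<in>B. \<Sum>l\<in>D. F i j k l)"
    by (intro sum.cong[OF refl] sum.swap)
  also have "\<dots> = (\<Sum>k\<in>C. \<Sum>i\<in>A. \<Sum>j\<in>B. \<Sum>l\<in>D. F i j k l)"
    by (rule sum.swap)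
  also have "\<dots> = (\<Sum>k\<in>C. \<Sum>i\<in>A. \<Sum>l\<in>D. \<Sum>j\<in>B. F i j k l)"
    by (intro sum.cong[OF refl] sum.swap)
  also have "\<dots> = (\<Sum>k\<in>C. \<Sum>l\<in>D. \<Sum>i\<in>A. \<Sum>j\<in>B. F i j k l)"
    by (intro sum.cong[OF refl] sum.swap)
  finally show ?thesis .
qed

text \<open>The expression is the squared norm of the tensor \<open>N\<close> with respect to
  \<open>M\<close>: for $M = V^TV$ it equals the sum of the squared entries of $P = VNV^T$.\<close>

lemma posdef_tensor_norm_nonneg:
  fixes M N :: "'n::finite \<Rightarrow> 'n \<Rightarrow> real"
  assumes "\<And>i j. M i j = M j i"
    and "\<And>x. \<exists>i. x i \<noteq> 0 \<Longrightarrow> (\<Sum>i\<in>UNIV. \<Sum>j\<in>UNIV. M i j * x i * x j) > 0"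
  shows "(\<Sum>i\<in>UNIV. \<Sum>l\<in>UNIV. (\<Sum>k\<in>UNIV. M l k * N i k) * (\<Sum>k\<in>UNIV. M i k * N k l)) \<ge> 0"
proof -
  have "\<exists>V. \<forall>i\<in>UNIV. \<forall>j\<in>UNIV. M i j = (\<Sum>k\<in>(UNIV::'n set). V k i * V k j)"
    by (rule posdef_gram) (use assms(1,2) in simp_all)
  then obtain V where V: "\<And>i j. M i j = (\<Sum>k\<in>(UNIV::'n set). V k i * V k j)" by blast
  define X where "X = (\<lambda>b i. \<Sum>k\<in>UNIV. V b k * N i k)"
  define Y where "Y = (\<lambda>a l. \<Sum>k\<in>UNIV. V a k * N k l)"
  define P where "P = (\<lambda>a b. \<Sum>i\<in>UNIV. V a i * X b i)"
  have MX: "(\<Sum>k\<in>UNIV. M l k * N i k) = (\<Sum>b\<in>UNIV. V b l * X b i)" for l i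
  proof -
    have "(\<Sum>k\<in>UNIV. M l k * N i k) = (\<Sum>k\<in>UNIV. \<Sum>b\<in>UNIV. V b l * (V b k * N i k))"
      by (simp add: V sum_distrib_right sum_distrib_left mult.assoc)
    also have "\<dots> = (\<Sum>b\<in>UNIV. \<Sum>k\<in>UNIV. V b l * (V b k * N i k))"
      by (rule sum.swap)
    also have "\<dots> = (\<Sum>b\<in>UNIV. V b l * X b i)"
      by (simp add: X_def sum_distrib_left mult_ac)
    finally show ?thesis .
  qed
  have MY: "(\<Sum>k\<in>UNIV. M i k * N k l) = (\<Sum>a\<in>UNIV. V a i * Y a l)" for l i
  proof -
    have "(\<Sum>k\<in>UNIV. M i k * N k l) = (\<Sum>k\<in>UNIV. \<Sum>a\<in>UNIV. V a i * (V a k * N k l))"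
      by (simp add: V sum_distrib_right sum_distrib_left mult.assoc)
    also have "\<dots> = (\<Sum>a\<in>UNIV. \<Sum>k\<in>UNIV. V a i * (V a k * N k l))"
      by (rule sum.swap)
    also have "\<dots> = (\<Sum>a\<in>UNIV. V a i * Y a l)"
      by (simp add: Y_def sum_distrib_left mult_ac)
    finally show ?thesis .
  qed
  have PY: "(\<Sum>l\<in>UNIV. V b l * Y a l) = P a b" for a b
  proof -
    have "(\<Sum>l\<in>UNIV. V b l * Y a l) = (\<Sum>l\<in>UNIV. \<Sum>k\<in>UNIV. V b l * (V a k * N k l))"
      by (simp add: V Y_def sum_distrib_right sum_distrib_left mult.assoc)
    also have "\<dots> = (\<Sum>k\<in>UNIV. \<Sum>l\<in>UNIV. V b l * (V a k * N k l))"
      by (rule sum.swap)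
    also have "\<dots> = P a b"
      by (simp add: P_def X_def sum_distrib_left mult_ac)
    finally show ?thesis .
  qed
  have "(\<Sum>i\<in>UNIV. \<Sum>l\<in>UNIV. (\<Sum>k\<in>UNIV. M l k * N i k) * (\<Sum>k\<in>UNIV. M i k * N k l))
    = (\<Sum>i\<in>UNIV. \<Sum>l\<in>UNIV. \<Sum>b\<in>UNIV. \<Sum>a\<in>UNIV. (V a i * X b i) * (V b l * Y a l))"
    unfolding MX MY sum_product by (simp add: mult_ac)
  also have "\<dots> = (\<Sum>b\<in>UNIV. \<Sum>a\<in>UNIV. \<Sum>i\<in>UNIV. \<Sum>l\<in>UNIV. (V a i * X b i) * (V b l * Y a l))"
    by (rule sum_swap_pairs)
  also have "\<dots> = (\<Sum>b\<in>UNIV. \<Sum>a\<in>UNIV. P a b * P a b)"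
    by (simp add: sum_product[symmetric] PY) (simp add: P_def)
  also have "\<dots> \<ge> 0"
    by (intro sum_nonneg) simp
  finally show ?thesis .
qed

section \<open>The Bochner formula in coordinates\<close>

abbreviation pdv :: "'n::finite \<Rightarrow> (real ^ 'n \<Rightarrow> real) \<Rightarrow> real ^ 'n \<Rightarrow> real" where
  "pdv i u \<equiv> dird (axis i 1) u"

text \<open>A coordinate patch detached from the manifold, so that all tensor calculus concerns real
  functions on an open subset of Euclidean space. The inverse metric is a parameter of its own;
  positivity is stated for it because it is the form that contracts differentials and
  Hessians.\<close>

locale local_metric =
  fixes U :: "(real ^ 'n::finite) set" and gm gi :: "'n \<Rightarrow> 'n \<Rightarrow> real ^ 'n \<Rightarrow> real"
  assumes open_U: "open U"
    and gm_smooth: "Cinf_on U (gm i j)"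
    and gi_smooth: "Cinf_on U (gi i j)"
    and gm_sym: "y \<in> U \<Longrightarrow> gm i j y = gm j i y"
    and gi_sym: "y \<in> U \<Longrightarrow> gi i j y = gi j i y"
    and gi_gm: "y \<in> U \<Longrightarrow> (\<Sum>k\<in>UNIV. gi i k y * gm k j y) = (if i = j then 1 else 0)"
    and gi_pos: "y \<in> U \<Longrightarrow> \<exists>i. x i \<noteq> 0 \<Longrightarrow> (\<Sum>i\<in>UNIV. \<Sum>j\<in>UNIV. gi i j y * x i * x j) > 0"
begin

definition chr :: "'n \<Rightarrow> 'n \<Rightarrow> 'n \<Rightarrow> real ^ 'n \<Rightarrow> real" where
  "chr k i j y = (1/2) * (\<Sum>l\<in>UNIV. gi k l y *
     (pdv i (gm j l) y + pdv j (gm i l) y - pdv l (gm i j) y))"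

definition grad :: "(real ^ 'n \<Rightarrow> real) \<Rightarrow> 'n \<Rightarrow> real ^ 'n \<Rightarrow> real" where
  "grad u i y = (\<Sum>j\<in>UNIV. gi i j y * pdv j u y)"

definition hs :: "(real ^ 'n \<Rightarrow> real) \<Rightarrow> 'n \<Rightarrow> 'n \<Rightarrow> real ^ 'n \<Rightarrow> real" where
  "hs u i j y = pdv i (pdv j u) y - (\<Sum>k\<in>UNIV. chr k i j y * pdv k u y)"

definition lap :: "(real ^ 'n \<Rightarrow> real) \<Rightarrow> real ^ 'n \<Rightarrow> real" where
  "lap u y = (\<Sum>i\<in>UNIV. \<Sum>j\<in>UNIV. gi i j y * hs u i j y)"

definition wlap :: "(real ^ 'n \<Rightarrow> real) \<Rightarrow> (real ^ 'n \<Rightarrow> real) \<Rightarrow> real ^ 'n \<Rightarrow> real" where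
  "wlap f u y = lap u y - (\<Sum>j\<in>UNIV. pdv j f y * grad u j y)"

definition ric :: "'n \<Rightarrow> 'n \<Rightarrow> real ^ 'n \<Rightarrow> real" where
  "ric j k y = (\<Sum>i\<in>UNIV. pdv i (chr i j k) y - pdv j (chr i i k) y
     + (\<Sum>m\<in>UNIV. chr i i m y * chr m j k y - chr i j m y * chr m i k y))"

definition sqnorm :: "(real ^ 'n \<Rightarrow> real) \<Rightarrow> real ^ 'n \<Rightarrow> real" where
  "sqnorm u y = (\<Sum>i\<in>UNIV. grad u i y * pdv i u y)"

text \<open>\<open>cdg u l i\<close> is $(\nabla_i\nabla u)^l$, the covariant derivative of the gradient.\<close>

definition cdg :: "(real ^ 'n \<Rightarrow> real) \<Rightarrow> 'n \<Rightarrow> 'n \<Rightarrow> real ^ 'n \<Rightarrow> real" where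
  "cdg u l i y = pdv i (grad u l) y + (\<Sum>m\<in>UNIV. chr l i m y * grad u m y)"

lemma Cinf_diffble: "Cinf_on U h \<Longrightarrow> y \<in> U \<Longrightarrow> h differentiable (at y)"
  by (rule Cinf_on_differentiable[OF _ open_U])

lemma pdv_cong: "y \<in> U \<Longrightarrow> (\<And>z. z \<in> U \<Longrightarrow> h z = h' z) \<Longrightarrow> pdv i h y = pdv i h' y"
  by (rule dird_cong[OF open_U])

lemma Cinf_chr: "Cinf_on U (chr k i j)"
  unfolding chr_def
  by (intro Cinf_on_mult Cinf_on_sum Cinf_on_add Cinf_on_diff Cinf_on_const Cinf_on_dird
      gm_smooth gi_smooth open_U)

lemma Cinf_grad: "Cinf_on U u \<Longrightarrow> Cinf_on U (grad u i)"
  unfolding grad_def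
  by (intro Cinf_on_mult Cinf_on_sum Cinf_on_dird gi_smooth open_U)

lemma Cinf_hs: "Cinf_on U u \<Longrightarrow> Cinf_on U (hs u i j)"
  unfolding hs_def
  by (intro Cinf_on_mult Cinf_on_sum Cinf_on_diff Cinf_on_dird Cinf_chr open_U)

lemma Cinf_lap: "Cinf_on U u \<Longrightarrow> Cinf_on U (lap u)"
  unfolding lap_def
  by (intro Cinf_on_mult Cinf_on_sum Cinf_hs gi_smooth open_U)

lemma Cinf_wlap: "Cinf_on U f \<Longrightarrow> Cinf_on U u \<Longrightarrow> Cinf_on U (wlap f u)"
  unfolding wlap_def
  by (intro Cinf_on_mult Cinf_on_sum Cinf_on_diff Cinf_on_dird Cinf_lap Cinf_grad open_U)

lemma Cinf_sqnorm: "Cinf_on U u \<Longrightarrow> Cinf_on U (sqnorm u)"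
  unfolding sqnorm_def
  by (intro Cinf_on_mult Cinf_on_sum Cinf_on_dird Cinf_grad open_U)

lemma Cinf_cdg: "Cinf_on U u \<Longrightarrow> Cinf_on U (cdg u l i)"
  unfolding cdg_def
  by (intro Cinf_on_mult Cinf_on_sum Cinf_on_add Cinf_on_dird Cinf_chr Cinf_grad open_U)

section \<open>Metric compatibility and the covariant derivative of the gradient\<close>

lemma gm_gi: "y \<in> U \<Longrightarrow> (\<Sum>k\<in>UNIV. gm i k y * gi k j y) = (if i = j then 1 else 0)"
  using gi_gm[of y j i] gm_sym[of y] gi_sym[of y] by (simp add: mult.commute eq_commute)

lemma gi_gm_contract: "y \<in> U \<Longrightarrow> (\<Sum>k\<in>UNIV. gi i k y * (\<Sum>j\<in>UNIV. gm k j y * x j)) = x i"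
proof -
  assume y: "y \<in> U"
  have "(\<Sum>k\<in>UNIV. gi i k y * (\<Sum>j\<in>UNIV. gm k j y * x j)) = (\<Sum>k\<in>UNIV. \<Sum>j\<in>UNIV. gi i k y * gm k j y * x j)"
    by (simp add: sum_distrib_left mult.assoc)
  also have "\<dots> = (\<Sum>j\<in>UNIV. \<Sum>k\<in>UNIV. gi i k y * gm k j y * x j)"
    by (rule sum.swap)
  also have "\<dots> = (\<Sum>j\<in>UNIV. (if i = j then 1 else 0) * x j)"
    by (simp add: sum_distrib_right[symmetric] gi_gm[OF y])
  also have "\<dots> = x i" by (simp add: if_distrib[of "\<lambda>c. c * _"] cong: if_cong)
  finally show ?thesis .
qed

lemma gm_gi_contract: "y \<in> U \<Longrightarrow> (\<Sum>k\<in>UNIV. gm i k y * (\<Sum>j\<in>UNIV. gi k j y * x j)) = x i"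
proof -
  assume y: "y \<in> U"
  have "(\<Sum>k\<in>UNIV. gm i k y * (\<Sum>j\<in>UNIV. gi k j y * x j)) = (\<Sum>k\<in>UNIV. \<Sum>j\<in>UNIV. gm i k y * gi k j y * x j)"
    by (simp add: sum_distrib_left mult.assoc)
  also have "\<dots> = (\<Sum>j\<in>UNIV. \<Sum>k\<in>UNIV. gm i k y * gi k j y * x j)"
    by (rule sum.swap)
  also have "\<dots> = (\<Sum>j\<in>UNIV. (if i = j then 1 else 0) * x j)"
    by (simp add: sum_distrib_right[symmetric] gm_gi[OF y])
  also have "\<dots> = x i" by (simp add: if_distrib[of "\<lambda>c. c * _"] cong: if_cong)
  finally show ?thesis .
qed

lemma lower_grad: "y \<in> U \<Longrightarrow> (\<Sum>k\<in>UNIV. gm i k y * grad u k y) = pdv i u y"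
  unfolding grad_def by (rule gm_gi_contract)

lemma pdv_gm_sym: "y \<in> U \<Longrightarrow> pdv k (gm i j) y = pdv k (gm j i) y"
  by (rule pdv_cong) (simp_all add: gm_sym)

lemma chr_sym: "y \<in> U \<Longrightarrow> chr k i j y = chr k j i y"
  unfolding chr_def by (simp add: pdv_gm_sym[where i=i and j=j] add.commute)

lemma lower_chr: "y \<in> U \<Longrightarrow> (\<Sum>r\<in>UNIV. gm s r y * chr r i j y)
    = (1/2) * (pdv i (gm j s) y + pdv j (gm i s) y - pdv s (gm i j) y)"
  using gm_gi_contract[of y s "\<lambda>l. pdv i (gm j l) y + pdv j (gm i l) y - pdv l (gm i j) y"]
  unfolding chr_def by (simp add: sum_distrib_left[symmetric] mult.left_commute sum_divide_distrib[symmetric])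

lemma pdv_gm: "y \<in> U \<Longrightarrow> pdv k (gm i j) y
    = (\<Sum>r\<in>UNIV. gm j r y * chr r k i y) + (\<Sum>r\<in>UNIV. gm i r y * chr r k j y)"
  by (simp add: lower_chr pdv_gm_sym[where i=j and j=i] pdv_gm_sym[where i=i and j=k] pdv_gm_sym[where i=j and j=k] field_simps)

lemma hs_eq_lower_cdg:
  assumes u: "Cinf_on U u" and y: "y \<in> U"
  shows "hs u i l y = (\<Sum>r\<in>UNIV. gm l r y * cdg u r i y)"
proof -
  have dg: "grad u k differentiable (at y)" "gm l k differentiable (at y)" for k
    by (intro Cinf_diffble Cinf_grad gm_smooth u y)+
  have "pdv i (gm l k) y * grad u k y = (\<Sum>r\<in>UNIV. chr r i l y * (gm r k y * grad u k y))
        + (\<Sum>r\<in>UNIV. gm l r y * (chr r i k y * grad u k y))" for k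
    by (simp add: pdv_gm[OF y] distrib_left distrib_right sum_distrib_left sum_distrib_right gm_sym[OF y, of k] mult_ac)
  then have split: "(\<Sum>k\<in>UNIV. pdv i (gm l k) y * grad u k y)
      = (\<Sum>k\<in>UNIV. \<Sum>r\<in>UNIV. chr r i l y * (gm r k y * grad u k y))
        + (\<Sum>k\<in>UNIV. \<Sum>r\<in>UNIV. gm l r y * (chr r i k y * grad u k y))"
    by (simp only: sum.distrib)
  have "pdv i (pdv l u) y = pdv i (\<lambda>z. \<Sum>k\<in>UNIV. gm l k z * grad u k z) y"
    using lower_grad by (intro pdv_cong y) simp
  also have "\<dots> = (\<Sum>k\<in>UNIV. gm l k y * pdv i (grad u k) y) + (\<Sum>k\<in>UNIV. pdv i (gm l k) y * grad u k y)"
    using dg by (simp add: dird_sum dird_mult differentiable_mult sum.distrib)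
  also note split
  also have "(\<Sum>k\<in>UNIV. \<Sum>r\<in>UNIV. chr r i l y * (gm r k y * grad u k y)) = (\<Sum>k\<in>UNIV. chr k i l y * pdv k u y)"
    by (subst sum.swap) (simp add: sum_distrib_left[symmetric] lower_grad[OF y])
  also have "(\<Sum>k\<in>UNIV. \<Sum>r\<in>UNIV. gm l r y * (chr r i k y * grad u k y))
      = (\<Sum>r\<in>UNIV. gm l r y * (\<Sum>m\<in>UNIV. chr r i m y * grad u m y))"
    by (subst sum.swap) (simp add: sum_distrib_left)
  finally show ?thesis
    by (simp add: hs_def cdg_def distrib_left sum.distrib)
qed

lemma cdg_eq_raise_hs:
  assumes "Cinf_on U u" "y \<in> U"
  shows "cdg u r i y = (\<Sum>l\<in>UNIV. gi r l y * hs u i l y)"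
  by (simp add: hs_eq_lower_cdg[OF assms] gi_gm_contract[OF assms(2)])

lemma hs_sym: "Cinf_on U u \<Longrightarrow> y \<in> U \<Longrightarrow> hs u i j y = hs u j i y"
  unfolding hs_def using dird_commute[OF open_U, of u y "axis i 1" "axis j 1"]
  by (simp add: chr_sym)

text \<open>The Laplacian as divergence of the gradient. In this form no metric coefficient occurs
  outside \<open>cdg\<close>, which makes it easy to differentiate once more.\<close>

lemma lap_eq_div_grad:
  assumes "Cinf_on U u" "y \<in> U"
  shows "lap u y = (\<Sum>i\<in>UNIV. cdg u i i y)"
  unfolding lap_def by (simp add: cdg_eq_raise_hs[OF assms])

lemma pdv_sqnorm:
  assumes u: "Cinf_on U u" and y: "y \<in> U"
  shows "pdv k (sqnorm u) y = 2 * (\<Sum>i\<in>UNIV. hs u k i y * grad u i y)"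
proof -
  have d: "grad u i differentiable (at y)" "pdv i u differentiable (at y)" for i
    by (intro Cinf_diffble Cinf_grad Cinf_on_dird u y)+
  have "pdv k (sqnorm u) y = (\<Sum>i\<in>UNIV. grad u i y * pdv k (pdv i u) y) + (\<Sum>i\<in>UNIV. pdv k (grad u i) y * pdv i u y)"
    unfolding sqnorm_def using d by (simp add: dird_sum dird_mult differentiable_mult sum.distrib)
  \<comment> \<open>The Christoffel remainder of this half of the product rule is what the other
    half, with plain second derivatives, lacks to be a Hessian; hence the factor 2.\<close>
  also have "(\<Sum>i\<in>UNIV. pdv k (grad u i) y * pdv i u y)
     = (\<Sum>i\<in>UNIV. cdg u i k y * pdv i u y) - (\<Sum>i\<in>UNIV. \<Sum>m\<in>UNIV. chr i k m y * grad u m y * pdv i u y)"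
    by (simp add: cdg_def distrib_right sum.distrib sum_distrib_right)
  also have "(\<Sum>i\<in>UNIV. cdg u i k y * pdv i u y) = (\<Sum>i\<in>UNIV. \<Sum>l\<in>UNIV. (gm l i y * cdg u i k y) * grad u l y)"
    by (simp add: lower_grad[OF y, symmetric] sum_distrib_left gm_sym[OF y, of i for i] mult_ac)
  also have "\<dots> = (\<Sum>l\<in>UNIV. hs u k l y * grad u l y)"
    by (subst sum.swap) (simp add: hs_eq_lower_cdg[OF u y] sum_distrib_right)
  also have "(\<Sum>i\<in>UNIV. \<Sum>m\<in>UNIV. chr i k m y * grad u m y * pdv i u y)
      = (\<Sum>m\<in>UNIV. grad u m y * (\<Sum>i\<in>UNIV. chr i k m y * pdv i u y))"
    by (subst sum.swap) (simp add: sum_distrib_left mult_ac)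
  finally show ?thesis
    by (simp add: hs_def algebra_simps sum_subtractf)
qed

lemma grad_sqnorm:
  assumes u: "Cinf_on U u" and y: "y \<in> U"
  shows "grad (sqnorm u) l y = 2 * (\<Sum>i\<in>UNIV. cdg u l i y * grad u i y)"
proof -
  have "grad (sqnorm u) l y = 2 * (\<Sum>k\<in>UNIV. \<Sum>i\<in>UNIV. gi l k y * hs u i k y * grad u i y)"
    by (simp add: grad_def pdv_sqnorm[OF u y] sum_distrib_left hs_sym[OF u y, of _ i for i] mult_ac)
  also have "\<dots> = 2 * (\<Sum>i\<in>UNIV. \<Sum>k\<in>UNIV. gi l k y * hs u i k y * grad u i y)"
    by (subst sum.swap) (rule refl)
  finally show ?thesis by (simp add: cdg_eq_raise_hs[OF u y] sum_distrib_right)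
qed

lemma pdv_lap:
  assumes u: "Cinf_on U u" and y: "y \<in> U"
  shows "pdv i (lap u) y = (\<Sum>l\<in>UNIV. pdv i (cdg u l l) y)"
proof -
  have "pdv i (lap u) y = pdv i (\<lambda>z. \<Sum>l\<in>UNIV. cdg u l l z) y"
    by (rule pdv_cong[OF y]) (rule lap_eq_div_grad[OF u])
  then show ?thesis
    by (simp add: dird_sum Cinf_diffble[OF Cinf_cdg[OF u] y])
qed

lemma pdv_cdg:
  assumes u: "Cinf_on U u" and y: "y \<in> U"
  shows "pdv k (cdg u l i) y = pdv k (pdv i (grad u l)) y
    + (\<Sum>m\<in>UNIV. chr l i m y * pdv k (grad u m) y + pdv k (chr l i m) y * grad u m y)"
proof -
  have "pdv i (grad u l) differentiable (at y)" "chr l i m differentiable (at y)"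
    "grad u m differentiable (at y)" for m
    by (intro Cinf_diffble Cinf_on_dird Cinf_chr Cinf_grad u y)+
  then show ?thesis
    unfolding cdg_def by (simp add: dird_add dird_sum dird_mult differentiable_mult differentiable_sum)
qed

text \<open>The contracted commutation of covariant derivatives. Contracting with the gradient vector rather
  than with the differential avoids the symmetries of the curvature tensor.\<close>

lemma div_cdg_eq:
  assumes u: "Cinf_on U u" and y: "y \<in> U"
  shows "(\<Sum>l\<in>UNIV. pdv l (cdg u l i) y)
      + (\<Sum>l\<in>UNIV. \<Sum>m\<in>UNIV. chr l l m y * cdg u m i y)
      - (\<Sum>l\<in>UNIV. \<Sum>m\<in>UNIV. chr m l i y * cdg u l m y)
    = pdv i (lap u) y + (\<Sum>m\<in>UNIV. ric i m y * grad u m y)"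
proof -
  define W where "W = (\<lambda>m. grad u m y)"
  define G where "G = (\<lambda>k i j. chr k i j y)"
  define D where "D = (\<lambda>m i. pdv i (grad u m) y)"
  define dG where "dG = (\<lambda>h k i j. pdv h (chr k i j) y)"
  have Gs: "G k i j = G k j i" for k i j
    using chr_sym[OF y] by (simp add: G_def)
  have Gc: "chr k i j y = G k i j" for k i j by (simp add: G_def)
  have comm: "pdv l (pdv i (grad u l)) y = pdv i (pdv l (grad u l)) y" for l
    by (rule dird_commute[OF open_U Cinf_grad[OF u] y])
  have S: "cdg u l i y = D l i + (\<Sum>r\<in>UNIV. G l i r * W r)" for l i
    by (simp add: cdg_def D_def G_def W_def)
  have dS: "pdv k (cdg u l i) y = pdv k (pdv i (grad u l)) y
    + ((\<Sum>m\<in>UNIV. G l i m * D m k) + (\<Sum>m\<in>UNIV. dG k l i m * W m))" for k l i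
    by (simp add: pdv_cdg[OF u y] G_def D_def W_def dG_def sum.distrib)
  have D1: "(\<Sum>l\<in>UNIV. \<Sum>m\<in>UNIV. G m l i * D l m) = (\<Sum>l\<in>UNIV. \<Sum>m\<in>UNIV. G l i m * D m l)"
    by (subst sum.swap) (simp add: Gs[of _ i])
  have G1: "(\<Sum>l\<in>UNIV. \<Sum>m\<in>UNIV. \<Sum>r\<in>UNIV. G m l i * G l m r * W r)
      = (\<Sum>m\<in>UNIV. \<Sum>l\<in>UNIV. \<Sum>r\<in>UNIV. G l i r * G r l m * W m)"
  proof -
    have "(\<Sum>l\<in>UNIV. \<Sum>m\<in>UNIV. \<Sum>r\<in>UNIV. G m l i * G l m r * W r)
        = (\<Sum>m\<in>UNIV. \<Sum>l\<in>UNIV. \<Sum>r\<in>UNIV. G m l i * G l m r * W r)"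
      by (rule sum.swap)
    also have "\<dots> = (\<Sum>m\<in>UNIV. \<Sum>r\<in>UNIV. \<Sum>l\<in>UNIV. G m l i * G l m r * W r)"
      by (intro sum.cong[OF refl] sum.swap)
    also have "\<dots> = (\<Sum>r\<in>UNIV. \<Sum>m\<in>UNIV. \<Sum>l\<in>UNIV. G m l i * G l m r * W r)"
      by (rule sum.swap)
    finally show ?thesis by (simp add: Gs[of _ i])
  qed
  have G2: "(\<Sum>l\<in>UNIV. \<Sum>m\<in>UNIV. \<Sum>r\<in>UNIV. G l l m * G m i r * W r)
      = (\<Sum>m\<in>UNIV. \<Sum>l\<in>UNIV. \<Sum>r\<in>UNIV. G l l r * G r i m * W m)"
  proof -
    have "(\<Sum>l\<in>UNIV. \<Sum>m\<in>UNIV. \<Sum>r\<in>UNIV. G l l m * G m i r * W r)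
        = (\<Sum>l\<in>UNIV. \<Sum>r\<in>UNIV. \<Sum>m\<in>UNIV. G l l m * G m i r * W r)"
      by (intro sum.cong[OF refl] sum.swap)
    also have "\<dots> = (\<Sum>r\<in>UNIV. \<Sum>l\<in>UNIV. \<Sum>m\<in>UNIV. G l l m * G m i r * W r)"
      by (rule sum.swap)
    finally show ?thesis .
  qed
  have R: "(\<Sum>m\<in>UNIV. ric i m y * grad u m y)
      = (\<Sum>m\<in>UNIV. \<Sum>l\<in>UNIV. dG l l i m * W m) - (\<Sum>m\<in>UNIV. \<Sum>l\<in>UNIV. dG i l l m * W m)
        + ((\<Sum>m\<in>UNIV. \<Sum>l\<in>UNIV. \<Sum>r\<in>UNIV. G l l r * G r i m * W m)
        - (\<Sum>m\<in>UNIV. \<Sum>l\<in>UNIV. \<Sum>r\<in>UNIV. G l i r * G r l m * W m))"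
    by (simp add: ric_def G_def dG_def W_def ring_distribs sum_distrib_right sum_subtractf sum.distrib)
  have sw: "(\<Sum>m\<in>UNIV. \<Sum>l\<in>UNIV. dG l l i m * W m) = (\<Sum>l\<in>UNIV. \<Sum>m\<in>UNIV. dG l l i m * W m)"
    "(\<Sum>m\<in>UNIV. \<Sum>l\<in>UNIV. dG i l l m * W m) = (\<Sum>l\<in>UNIV. \<Sum>m\<in>UNIV. dG i l l m * W m)"
    by (rule sum.swap)+
  have T1: "(\<Sum>l\<in>UNIV. pdv l (cdg u l i) y) = (\<Sum>l\<in>UNIV. pdv i (pdv l (grad u l)) y)
     + ((\<Sum>l\<in>UNIV. \<Sum>m\<in>UNIV. G l i m * D m l) + (\<Sum>l\<in>UNIV. \<Sum>m\<in>UNIV. dG l l i m * W m))"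
    by (simp add: dS comm sum.distrib)
  have T2: "(\<Sum>l\<in>UNIV. \<Sum>m\<in>UNIV. chr l l m y * cdg u m i y)
     = (\<Sum>l\<in>UNIV. \<Sum>m\<in>UNIV. G l l m * D m i) + (\<Sum>l\<in>UNIV. \<Sum>m\<in>UNIV. \<Sum>r\<in>UNIV. G l l m * G m i r * W r)"
    by (simp add: Gc S distrib_left sum.distrib sum_distrib_left mult.assoc)
  have T3: "(\<Sum>l\<in>UNIV. \<Sum>m\<in>UNIV. chr m l i y * cdg u l m y)
     = (\<Sum>l\<in>UNIV. \<Sum>m\<in>UNIV. G m l i * D l m) + (\<Sum>l\<in>UNIV. \<Sum>m\<in>UNIV. \<Sum>r\<in>UNIV. G m l i * G l m r * W r)"
    by (simp add: Gc S distrib_left sum.distrib sum_distrib_left mult.assoc)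
  have T4: "pdv i (lap u) y = (\<Sum>l\<in>UNIV. pdv i (pdv l (grad u l)) y)
     + ((\<Sum>l\<in>UNIV. \<Sum>m\<in>UNIV. G l l m * D m i) + (\<Sum>l\<in>UNIV. \<Sum>m\<in>UNIV. dG i l l m * W m))"
    by (simp add: pdv_lap[OF u y] dS sum.distrib)
  show ?thesis
    unfolding T1 T2 T3 T4 R G1 G2 D1 sw by simp
qed

lemma bochner:
  assumes u: "Cinf_on U u" and y: "y \<in> U"
  shows "lap (sqnorm u) y = 2 * ((\<Sum>i\<in>UNIV. grad u i y * pdv i (lap u) y)
    + (\<Sum>i\<in>UNIV. \<Sum>j\<in>UNIV. ric i j y * grad u i y * grad u j y)
    + (\<Sum>l\<in>UNIV. \<Sum>i\<in>UNIV. cdg u l i y * cdg u i l y))"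
proof -
  define W where "W = (\<lambda>m. grad u m y)"
  define G where "G = (\<lambda>k i j. chr k i j y)"
  define D where "D = (\<lambda>m i. pdv i (grad u m) y)"
  define S where "S = (\<lambda>l i. cdg u l i y)"
  define dS where "dS = (\<lambda>l i. pdv l (cdg u l i) y)"
  have D: "D i l = S i l - (\<Sum>m\<in>UNIV. G i l m * W m)" for i l
    by (simp add: S_def cdg_def D_def G_def W_def)
  have V: "pdv l (grad (sqnorm u) l) y = 2 * ((\<Sum>i\<in>UNIV. S l i * D i l) + (\<Sum>i\<in>UNIV. dS l i * W i))" for l
  proof -
    have "pdv l (grad (sqnorm u) l) y = pdv l (\<lambda>z. 2 * (\<Sum>i\<in>UNIV. cdg u l i z * grad u i z)) y"
      by (rule pdv_cong[OF y]) (rule grad_sqnorm[OF u])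
    also have "\<dots> = 2 * (\<Sum>i\<in>UNIV. cdg u l i y * pdv l (grad u i) y + pdv l (cdg u l i) y * grad u i y)"
    proof -
      have "cdg u l i differentiable (at y)" "grad u i differentiable (at y)" for i
        by (intro Cinf_diffble Cinf_cdg Cinf_grad u y)+
      then show ?thesis
        by (simp add: dird_cmult dird_sum dird_mult differentiable_mult differentiable_sum)
    qed
    finally show ?thesis by (simp add: S_def D_def W_def dS_def sum.distrib)
  qed
  have A: "(\<Sum>l\<in>UNIV. \<Sum>i\<in>UNIV. S l i * D i l)
      = (\<Sum>l\<in>UNIV. \<Sum>i\<in>UNIV. S l i * S i l) - (\<Sum>i\<in>UNIV. W i * (\<Sum>l\<in>UNIV. \<Sum>m\<in>UNIV. G m l i * S l m))"
  proof -
    have "(\<Sum>l\<in>UNIV. \<Sum>i\<in>UNIV. S l i * D i l)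
      = (\<Sum>l\<in>UNIV. \<Sum>i\<in>UNIV. S l i * S i l) - (\<Sum>l\<in>UNIV. \<Sum>i\<in>UNIV. \<Sum>m\<in>UNIV. W m * (G i l m * S l i))"
      by (simp add: D right_diff_distrib sum_subtractf sum_distrib_left mult_ac)
    also have "(\<Sum>l\<in>UNIV. \<Sum>i\<in>UNIV. \<Sum>m\<in>UNIV. W m * (G i l m * S l i))
        = (\<Sum>l\<in>UNIV. \<Sum>m\<in>UNIV. \<Sum>i\<in>UNIV. W m * (G i l m * S l i))"
      by (intro sum.cong[OF refl] sum.swap)
    also have "\<dots> = (\<Sum>m\<in>UNIV. \<Sum>l\<in>UNIV. \<Sum>i\<in>UNIV. W m * (G i l m * S l i))"
      by (rule sum.swap)
    finally show ?thesis by (simp add: sum_distrib_left)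
  qed
  have B: "(\<Sum>l\<in>UNIV. \<Sum>i\<in>UNIV. dS l i * W i) = (\<Sum>i\<in>UNIV. W i * (\<Sum>l\<in>UNIV. dS l i))"
    by (subst sum.swap) (simp add: sum_distrib_left mult.commute)
  have C: "(\<Sum>l\<in>UNIV. \<Sum>m\<in>UNIV. G l l m * grad (sqnorm u) m y)
      = 2 * (\<Sum>i\<in>UNIV. W i * (\<Sum>l\<in>UNIV. \<Sum>m\<in>UNIV. G l l m * S m i))"
  proof -
    have "(\<Sum>l\<in>UNIV. \<Sum>m\<in>UNIV. G l l m * grad (sqnorm u) m y)
       = 2 * (\<Sum>l\<in>UNIV. \<Sum>m\<in>UNIV. \<Sum>i\<in>UNIV. W i * (G l l m * S m i))"
      by (simp add: grad_sqnorm[OF u y] S_def W_def sum_distrib_left mult_ac)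
    also have "(\<Sum>l\<in>UNIV. \<Sum>m\<in>UNIV. \<Sum>i\<in>UNIV. W i * (G l l m * S m i))
        = (\<Sum>l\<in>UNIV. \<Sum>i\<in>UNIV. \<Sum>m\<in>UNIV. W i * (G l l m * S m i))"
      by (intro sum.cong[OF refl] sum.swap)
    also have "\<dots> = (\<Sum>i\<in>UNIV. \<Sum>l\<in>UNIV. \<Sum>m\<in>UNIV. W i * (G l l m * S m i))"
      by (rule sum.swap)
    finally show ?thesis by (simp add: sum_distrib_left)
  qed
  \<comment> \<open>The identities \<open>A\<close>, \<open>B\<close> and \<open>C\<close> have
    brought every term other than the squared one into the form $W^i$ times one of the three sums on
    the right.\<close>
  have key: "pdv i (lap u) y + (\<Sum>m\<in>UNIV. ric i m y * W m) = (\<Sum>l\<in>UNIV. dS l i)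
      + (\<Sum>l\<in>UNIV. \<Sum>m\<in>UNIV. G l l m * S m i) - (\<Sum>l\<in>UNIV. \<Sum>m\<in>UNIV. G m l i * S l m)" for i
    using div_cdg_eq[OF u y, of i] by (simp add: dS_def G_def S_def W_def)
  have "lap (sqnorm u) y = (\<Sum>l\<in>UNIV. pdv l (grad (sqnorm u) l) y)
      + (\<Sum>l\<in>UNIV. \<Sum>m\<in>UNIV. G l l m * grad (sqnorm u) m y)"
    by (simp add: lap_eq_div_grad[OF Cinf_sqnorm[OF u] y] cdg_def G_def sum.distrib)
  also have "(\<Sum>l\<in>UNIV. pdv l (grad (sqnorm u) l) y)
      = 2 * ((\<Sum>l\<in>UNIV. \<Sum>i\<in>UNIV. S l i * D i l) + (\<Sum>l\<in>UNIV. \<Sum>i\<in>UNIV. dS l i * W i))"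
    by (simp only: V sum.distrib sum_distrib_left[symmetric])
  finally have "lap (sqnorm u) y = 2 * ((\<Sum>l\<in>UNIV. \<Sum>i\<in>UNIV. S l i * S i l)
      + ((\<Sum>i\<in>UNIV. W i * (\<Sum>l\<in>UNIV. dS l i))
      + (\<Sum>i\<in>UNIV. W i * (\<Sum>l\<in>UNIV. \<Sum>m\<in>UNIV. G l l m * S m i))
      - (\<Sum>i\<in>UNIV. W i * (\<Sum>l\<in>UNIV. \<Sum>m\<in>UNIV. G m l i * S l m))))"
    unfolding A B C by simp
  also have "(\<Sum>i\<in>UNIV. W i * (\<Sum>l\<in>UNIV. dS l i))
      + (\<Sum>i\<in>UNIV. W i * (\<Sum>l\<in>UNIV. \<Sum>m\<in>UNIV. G l l m * S m i))
      - (\<Sum>i\<in>UNIV. W i * (\<Sum>l\<in>UNIV. \<Sum>m\<in>UNIV. G m l i * S l m))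
    = (\<Sum>i\<in>UNIV. W i * (pdv i (lap u) y + (\<Sum>m\<in>UNIV. ric i m y * W m)))"
    by (simp only: key distrib_left right_diff_distrib sum.distrib sum_subtractf)
  also have "\<dots> = (\<Sum>i\<in>UNIV. W i * pdv i (lap u) y) + (\<Sum>i\<in>UNIV. \<Sum>j\<in>UNIV. ric i j y * W i * W j)"
    by (simp add: distrib_left sum.distrib sum_distrib_left mult_ac)
  finally show ?thesis by (simp add: W_def S_def)
qed

lemma weighted_bochner:
  assumes f: "Cinf_on U f" and u: "Cinf_on U u" and y: "y \<in> U"
  shows "wlap f (sqnorm u) y = 2 * ((\<Sum>i\<in>UNIV. grad u i y * pdv i (wlap f u) y)
    + (\<Sum>i\<in>UNIV. \<Sum>j\<in>UNIV. (ric i j y + hs f i j y) * grad u i y * grad u j y)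
    + (\<Sum>l\<in>UNIV. \<Sum>i\<in>UNIV. cdg u l i y * cdg u i l y))"
proof -
  define W where "W = (\<lambda>m. grad u m y)"
  define G where "G = (\<lambda>k i j. chr k i j y)"
  define D where "D = (\<lambda>m i. pdv i (grad u m) y)"
  define F where "F = (\<lambda>j. pdv j f y)"
  have pw: "pdv i (wlap f u) y = pdv i (lap u) y - ((\<Sum>j\<in>UNIV. F j * D j i) + (\<Sum>j\<in>UNIV. pdv i (pdv j f) y * W j))" for i
  proof -
    have "lap u differentiable (at y)" "pdv j f differentiable (at y)" "grad u j differentiable (at y)" for j
      by (intro Cinf_diffble Cinf_lap Cinf_on_dird Cinf_grad f u y)+
    then show ?thesis
      unfolding wlap_def W_def D_def F_def
      by (simp add: dird_diff dird_sum dird_mult differentiable_mult differentiable_sum sum.distrib)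
  qed
  have E1: "(\<Sum>j\<in>UNIV. pdv j f y * grad (sqnorm u) j y)
     = 2 * ((\<Sum>j\<in>UNIV. \<Sum>i\<in>UNIV. F j * D j i * W i) + (\<Sum>j\<in>UNIV. \<Sum>i\<in>UNIV. \<Sum>m\<in>UNIV. F j * G j i m * W m * W i))"
    by (simp add: grad_sqnorm[OF u y] cdg_def F_def D_def G_def W_def
        distrib_left distrib_right sum.distrib sum_distrib_left sum_distrib_right mult_ac)
  have E2: "(\<Sum>i\<in>UNIV. \<Sum>j\<in>UNIV. hs f i j y * W i * W j)
     = (\<Sum>i\<in>UNIV. \<Sum>j\<in>UNIV. pdv i (pdv j f) y * W i * W j) - (\<Sum>i\<in>UNIV. \<Sum>j\<in>UNIV. \<Sum>k\<in>UNIV. G k i j * F k * W i * W j)"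
    by (simp add: hs_def G_def F_def left_diff_distrib sum_subtractf sum_distrib_right)
  \<comment> \<open>The Christoffel part of the Hessian of \<open>f\<close> cancels that of the
    covariant derivative of the gradient paired with the differential of \<open>f\<close>.\<close>
  have E3: "(\<Sum>i\<in>UNIV. \<Sum>j\<in>UNIV. \<Sum>k\<in>UNIV. G k i j * F k * W i * W j)
     = (\<Sum>j\<in>UNIV. \<Sum>i\<in>UNIV. \<Sum>m\<in>UNIV. F j * G j i m * W m * W i)"
  proof -
    have "(\<Sum>i\<in>UNIV. \<Sum>j\<in>UNIV. \<Sum>k\<in>UNIV. G k i j * F k * W i * W j)
       = (\<Sum>i\<in>UNIV. \<Sum>k\<in>UNIV. \<Sum>j\<in>UNIV. G k i j * F k * W i * W j)"
      by (intro sum.cong[OF refl] sum.swap)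
    also have "\<dots> = (\<Sum>k\<in>UNIV. \<Sum>i\<in>UNIV. \<Sum>j\<in>UNIV. G k i j * F k * W i * W j)"
      by (rule sum.swap)
    finally show ?thesis by (simp add: mult_ac)
  qed
  have E4: "(\<Sum>i\<in>UNIV. W i * pdv i (wlap f u) y) = (\<Sum>i\<in>UNIV. W i * pdv i (lap u) y)
     - ((\<Sum>j\<in>UNIV. \<Sum>i\<in>UNIV. F j * D j i * W i) + (\<Sum>i\<in>UNIV. \<Sum>j\<in>UNIV. pdv i (pdv j f) y * W i * W j))"
  proof -
    have sw: "(\<Sum>j\<in>UNIV. \<Sum>i\<in>UNIV. F j * D j i * W i) = (\<Sum>i\<in>UNIV. \<Sum>j\<in>UNIV. F j * D j i * W i)"
      by (rule sum.swap)
    show ?thesis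
      unfolding sw
      by (simp add: pw right_diff_distrib distrib_left sum_subtractf sum.distrib sum_distrib_left mult_ac)
  qed
  have E5: "(\<Sum>i\<in>UNIV. \<Sum>j\<in>UNIV. (ric i j y + hs f i j y) * W i * W j)
     = (\<Sum>i\<in>UNIV. \<Sum>j\<in>UNIV. ric i j y * W i * W j) + (\<Sum>i\<in>UNIV. \<Sum>j\<in>UNIV. hs f i j y * W i * W j)"
    by (simp add: distrib_right sum.distrib)
  have "wlap f (sqnorm u) y = 2 * ((\<Sum>i\<in>UNIV. W i * pdv i (lap u) y)
    + (\<Sum>i\<in>UNIV. \<Sum>j\<in>UNIV. ric i j y * W i * W j)
    + (\<Sum>l\<in>UNIV. \<Sum>i\<in>UNIV. cdg u l i y * cdg u i l y))
    - 2 * ((\<Sum>j\<in>UNIV. \<Sum>i\<in>UNIV. F j * D j i * W i) + (\<Sum>j\<in>UNIV. \<Sum>i\<in>UNIV. \<Sum>m\<in>UNIV. F j * G j i m * W m * W i))"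
    unfolding wlap_def E1 bochner[OF u y] by (simp add: W_def)
  moreover have "grad u i y = W i" for i by (simp add: W_def)
  ultimately show ?thesis
    by (simp add: E4 E5 E2 E3)
qed

end

section \<open>The barrier at a first touching point\<close>

lemma touching_real:
  fixes B w Q q Gw G' R SS X Y L \<phi> \<phi>' c K \<theta>1 \<theta>2 \<theta>3 \<theta>4 \<xi> \<tau> :: real
  assumes \<xi>: "\<xi> = 2 * K + \<theta>1 + \<theta>2 + \<theta>3 + 1" and nn: "K \<ge> 0" "\<theta>1 \<ge> 0" "\<theta>2 \<ge> 0" "\<theta>3 \<ge> 0"
    and c: "c = 2 + \<theta>4\<^sup>2 / \<xi>" and \<tau>: "\<tau> > 0"
    and \<phi>: "\<phi> = \<tau> / (1 + \<xi> * \<tau>)" and \<phi>': "\<phi>' = 1 / (1 + \<xi> * \<tau>)\<^sup>2"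
    and w: "0 < w" "w < B" and Q: "\<phi> * Q = c * (w * (B - w))"
    and q: "\<bar>q\<bar> \<le> \<theta>1" and Gw: "\<bar>Gw\<bar> \<le> \<theta>2 * w" and G': "\<bar>G'\<bar> \<le> \<theta>3"
    and R: "R \<ge> - K * Q" and SS: "SS \<ge> (c * (B - 2 * w) / (2 * \<phi>))\<^sup>2"
    and X: "- (2 * w * X) \<le> Q + w\<^sup>2 * \<theta>4\<^sup>2"
    and time: "\<phi>' * Q + \<phi> * (2 * (Y - q * Q - w * X - G' * Q)) - c * (B - 2 * w) * (L - q * w - Gw) \<ge> 0"
    and space: "\<phi> * (2 * (Y + R + SS)) - c * (B - 2 * w) * L + 2 * c * Q \<le> 0"
  shows False
proof -
  have \<xi>1: "\<xi> \<ge> 1" using \<xi> nn by simp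
  define x where "x = \<xi> * \<tau>"
  have x: "x > 0" using \<xi>1 \<tau> by (simp add: x_def)
  have \<phi>0: "\<phi> > 0" using \<tau> x by (simp add: \<phi> x_def)
  have \<phi>\<xi>: "\<phi> * \<xi> = x / (1 + x)" by (simp add: \<phi> x_def)
  have \<phi>1: "\<phi> * \<xi> \<le> 1" using x by (simp add: \<phi>\<xi>)
  have c2: "c \<ge> 2" using \<xi>1 by (simp add: c)
  have B0: "B > 0" using w by simp
  have Q0: "Q \<ge> 0"
  proof -
    have "\<phi> * Q \<ge> 0" unfolding Q using c2 w by simp
    then show ?thesis using \<phi>0 by (simp add: zero_le_mult_iff)
  qed
  define u where "u = w * (B - w)"
  have u0: "0 \<le> u" using w by (simp add: u_def)
  have u4: "4 * u \<le> B\<^sup>2"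
    using zero_le_power2[of "B - 2 * w"] by (simp add: u_def power2_eq_square algebra_simps)
  have wB: "w * B \<le> B\<^sup>2" using w by (simp add: power2_eq_square)
  \<comment> \<open>Subtracting \<open>space\<close> from \<open>time\<close> eliminates
    \<open>Y\<close> and \<open>L\<close>, the terms without a bound.\<close>
  have "0 \<le> \<phi>' * Q - 2 * \<phi> * q * Q - 2 * \<phi> * (w * X) - 2 * \<phi> * G' * Q + c * (B - 2 * w) * (q * w + Gw)
      - 2 * \<phi> * R - 2 * \<phi> * SS - 2 * c * Q"
    using time space by (simp add: algebra_simps)
  moreover have "- 2 * \<phi> * (w * X) \<le> \<phi> * (Q + w\<^sup>2 * \<theta>4\<^sup>2)"
    using mult_left_mono[OF X, of \<phi>] \<phi>0 by (simp add: mult_ac)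
  moreover have "- (2 * \<phi> * R) \<le> 2 * \<phi> * K * Q"
    using mult_left_mono[OF R, of \<phi>] \<phi>0 by (simp add: mult_ac)
  moreover have "2 * \<phi> * SS \<ge> c\<^sup>2 * (B - 2 * w)\<^sup>2 / (2 * \<phi>)"
  proof -
    have "2 * \<phi> * (d / (2 * \<phi>))\<^sup>2 = d\<^sup>2 / (2 * \<phi>)" for d
      using \<phi>0 by (simp add: power2_eq_square field_simps)
    then show ?thesis
      using mult_left_mono[OF SS, of "2 * \<phi>"] \<phi>0 by (simp add: power_mult_distrib)
  qed
  ultimately have main: "0 \<le> \<phi>' * Q - 2 * \<phi> * q * Q + \<phi> * (Q + w\<^sup>2 * \<theta>4\<^sup>2) - 2 * \<phi> * G' * Q
      + c * (B - 2 * w) * (q * w + Gw) + 2 * \<phi> * K * Q - c\<^sup>2 * (B - 2 * w)\<^sup>2 / (2 * \<phi>) - 2 * c * Q"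
    by linarith
  have Qu: "\<phi> * Q = c * u" by (simp add: Q u_def)
  \<comment> \<open>The factor \<phi> makes \<open>Q\<close> appear only as
    \<open>\<phi> * Q\<close>, which the touching equation turns into \<open>c * u\<close>.\<close>
  have "0 \<le> \<phi> * (\<phi>' * Q - 2 * \<phi> * q * Q + \<phi> * (Q + w\<^sup>2 * \<theta>4\<^sup>2) - 2 * \<phi> * G' * Q
      + c * (B - 2 * w) * (q * w + Gw) + 2 * \<phi> * K * Q - c\<^sup>2 * (B - 2 * w)\<^sup>2 / (2 * \<phi>) - 2 * c * Q)"
    using main \<phi>0 by simp
  also have "\<dots> = \<phi>' * (\<phi> * Q) - 2 * \<phi> * q * (\<phi> * Q) + \<phi> * (\<phi> * Q) + \<phi>\<^sup>2 * w\<^sup>2 * \<theta>4\<^sup>2 - 2 * \<phi> * G' * (\<phi> * Q)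
      + c * \<phi> * (B - 2 * w) * (q * w + Gw) + 2 * \<phi> * K * (\<phi> * Q) - c\<^sup>2 * (B - 2 * w)\<^sup>2 / 2 - 2 * c * (\<phi> * Q)"
    using \<phi>0 by (simp add: power2_eq_square field_simps)
  also have "\<dots> = c * (\<phi>' * u + \<phi> * u + 2 * \<phi> * K * u - 2 * \<phi> * G' * u - \<phi> * q * (w * B)
      + \<phi> * (B - 2 * w) * Gw - c * B\<^sup>2 / 2) + \<phi>\<^sup>2 * w\<^sup>2 * \<theta>4\<^sup>2"
    unfolding Qu by (simp add: u_def power2_eq_square field_simps)
  finally have main2: "0 \<le> c * (\<phi>' * u + \<phi> * u + 2 * \<phi> * K * u - 2 * \<phi> * G' * u - \<phi> * q * (w * B)
      + \<phi> * (B - 2 * w) * Gw - c * B\<^sup>2 / 2) + \<phi>\<^sup>2 * w\<^sup>2 * \<theta>4\<^sup>2" .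
  have \<phi>'0: "\<phi>' \<ge> 0" by (simp add: \<phi>')
  have t1: "\<phi>' * u \<le> \<phi>' * B\<^sup>2 / 4"
    using mult_left_mono[OF u4 \<phi>'0] by simp
  have t2: "\<phi> * u \<le> \<phi> * B\<^sup>2"
    using u4 u0 \<phi>0 by (intro mult_left_mono) auto
  have t3: "2 * \<phi> * K * u \<le> \<phi> * (2 * K) * B\<^sup>2"
  proof -
    have "(2 * \<phi> * K) * u \<le> (2 * \<phi> * K) * B\<^sup>2"
      using u4 u0 \<phi>0 nn by (intro mult_left_mono) auto
    then show ?thesis by (simp add: mult_ac)
  qed
  have t4: "- 2 * \<phi> * G' * u \<le> \<phi> * \<theta>3 * B\<^sup>2"
  proof -
    have "(2 * \<phi> * u) * (- G') \<le> (2 * \<phi> * u) * \<theta>3"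
      using G' \<phi>0 u0 by (intro mult_left_mono) auto
    also have "\<dots> = (\<phi> * \<theta>3) * (2 * u)" by simp
    also have "\<dots> \<le> (\<phi> * \<theta>3) * B\<^sup>2"
      using u4 u0 \<phi>0 nn by (intro mult_left_mono) auto
    finally show ?thesis by (simp add: mult_ac)
  qed
  have t5: "- \<phi> * q * (w * B) \<le> \<phi> * \<theta>1 * B\<^sup>2"
  proof -
    have "(\<phi> * (w * B)) * (- q) \<le> (\<phi> * (w * B)) * \<theta>1"
      using q \<phi>0 w B0 by (intro mult_left_mono) auto
    also have "\<dots> = (\<phi> * \<theta>1) * (w * B)" by simp
    also have "\<dots> \<le> (\<phi> * \<theta>1) * B\<^sup>2"
      using wB \<phi>0 nn by (intro mult_left_mono) auto
    finally show ?thesis by (simp add: mult_ac)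
  qed
  have t6: "\<phi> * (B - 2 * w) * Gw \<le> \<phi> * \<theta>2 * B\<^sup>2"
  proof -
    have "(B - 2 * w) * Gw \<le> \<bar>B - 2 * w\<bar> * \<bar>Gw\<bar>"
      by (metis abs_ge_self abs_mult)
    also have "\<dots> \<le> B * (\<theta>2 * w)"
      using w Gw B0 by (intro mult_mono) auto
    also have "\<dots> = \<theta>2 * (w * B)" by simp
    also have "\<dots> \<le> \<theta>2 * B\<^sup>2"
      using wB nn by (intro mult_left_mono) auto
    finally show ?thesis using \<phi>0 by (simp add: mult.assoc)
  qed
  have t7: "\<phi>\<^sup>2 * w\<^sup>2 * \<theta>4\<^sup>2 \<le> c * ((c - 2) / 2 * B\<^sup>2)"
  proof -
    have "\<phi>\<^sup>2 * \<theta>4\<^sup>2 \<le> \<theta>4\<^sup>2 / \<xi>"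
    proof -
      have "\<phi> \<le> 1"
        using mult_left_mono[OF \<xi>1, of \<phi>] \<phi>1 \<phi>0 by linarith
      then have "\<phi> * \<xi> * \<phi> \<le> 1 * 1"
        using \<phi>1 \<phi>0 \<xi>1 by (intro mult_mono) auto
      then have "\<phi>\<^sup>2 * \<xi> * \<theta>4\<^sup>2 \<le> 1 * \<theta>4\<^sup>2"
        by (intro mult_right_mono) (simp_all add: power2_eq_square mult_ac)
      then show ?thesis using \<xi>1 by (simp add: field_simps)
    qed
    also have "\<dots> = c - 2" by (simp add: c)
    finally have "\<phi>\<^sup>2 * \<theta>4\<^sup>2 \<le> c - 2" .
    then have "(\<phi>\<^sup>2 * \<theta>4\<^sup>2) * w\<^sup>2 \<le> (c - 2) * B\<^sup>2"
      using w c2 by (intro mult_mono power_mono) auto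
    also have "\<dots> \<le> c / 2 * ((c - 2) * B\<^sup>2)"
      using mult_right_mono[of 1 "c / 2" "(c - 2) * B\<^sup>2"] c2 by simp
    finally show ?thesis by (simp add: mult_ac)
  qed
  have "0 \<le> c * (\<phi>' * B\<^sup>2 / 4 + \<phi> * B\<^sup>2 + \<phi> * (2 * K) * B\<^sup>2 + \<phi> * \<theta>3 * B\<^sup>2 + \<phi> * \<theta>1 * B\<^sup>2
      + \<phi> * \<theta>2 * B\<^sup>2 - c * B\<^sup>2 / 2) + c * ((c - 2) / 2 * B\<^sup>2)"
  proof -
    have "c * (\<phi>' * u + \<phi> * u + 2 * \<phi> * K * u - 2 * \<phi> * G' * u - \<phi> * q * (w * B)
      + \<phi> * (B - 2 * w) * Gw - c * B\<^sup>2 / 2) \<le> c * (\<phi>' * B\<^sup>2 / 4 + \<phi> * B\<^sup>2 + \<phi> * (2 * K) * B\<^sup>2 + \<phi> * \<theta>3 * B\<^sup>2 + \<phi> * \<theta>1 * B\<^sup>2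
      + \<phi> * \<theta>2 * B\<^sup>2 - c * B\<^sup>2 / 2)"
      using t1 t2 t3 t4 t5 t6 c2 by (intro mult_left_mono) auto
    then show ?thesis using main2 t7 by linarith
  qed
  \<comment> \<open>The coefficients of \<phi> add up to \<xi>, and $-c/2 + (c-2)/2 = -1$.\<close>
  also have "\<dots> = c * B\<^sup>2 * (\<phi>' / 4 + \<phi> * \<xi> - 1)"
    unfolding \<xi> by (simp add: field_simps)
  finally have nonneg: "0 \<le> c * B\<^sup>2 * (\<phi>' / 4 + \<phi> * \<xi> - 1)" .
  have "c * B\<^sup>2 > 0" using c2 B0 by simp
  then have "\<phi>' / 4 + \<phi> * \<xi> \<ge> 1"
    using nonneg mult_pos_neg[of "c * B\<^sup>2" "\<phi>' / 4 + \<phi> * \<xi> - 1"] by linarith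
  moreover have "\<phi>' / 4 + \<phi> * \<xi> < 1"
  proof -
    have "\<phi>' \<le> 1 / (1 + x)"
      using x by (simp add: \<phi>' x_def[symmetric] power2_eq_square divide_simps)
    then have "\<phi>' / 4 < 1 / (1 + x)"
      using x by (simp add: field_simps)
    moreover have "1 / (1 + x) + \<phi> * \<xi> = 1" using x by (simp add: \<phi>\<xi> field_simps)
    ultimately show ?thesis by linarith
  qed
  ultimately show False by simp
qed

context local_metric
begin

lemma gi_quad_nonneg: "y \<in> U \<Longrightarrow> (\<Sum>i\<in>UNIV. \<Sum>j\<in>UNIV. gi i j y * x i * x j) \<ge> 0"
  using gi_pos[of y x] by (cases "\<exists>i. x i \<noteq> 0") auto

lemma sqnorm_eq: "sqnorm u y = (\<Sum>i\<in>UNIV. \<Sum>j\<in>UNIV. gi i j y * pdv i u y * pdv j u y)"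
  by (simp add: sqnorm_def grad_def sum_distrib_left mult_ac)

text \<open>At a critical point the Christoffel and drift terms vanish, leaving the trace of the
  inverse metric against a negative semidefinite matrix of second derivatives.\<close>

lemma wlap_at_max:
  assumes "Cinf_on U P" "y \<in> U" "\<And>z. z \<in> U \<Longrightarrow> P z \<le> P y"
  shows "wlap f P y \<le> 0" and "grad P l y = 0"
proof -
  have 0: "pdv i P y = 0" for i
    by (rule dird_at_max(1)[OF open_U assms])
  then show g: "grad P l y = 0" for l by (simp add: grad_def)
  have "(\<Sum>i\<in>UNIV. \<Sum>j\<in>UNIV. gi i j y * pdv i (pdv j P) y) \<le> 0"
    by (rule posdef_trace_nonpos[OF gi_sym[OF assms(2)] gi_pos[OF assms(2)] hessian_at_max[OF open_U assms]])
  then show "wlap f P y \<le> 0"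
    by (simp add: wlap_def lap_def hs_def 0 g)
qed

lemma cdg_tensor_norm_ge:
  assumes u: "Cinf_on U u" and y: "y \<in> U" and Q: "sqnorm u y > 0"
    and eig: "\<And>l. (\<Sum>i\<in>UNIV. cdg u l i y * grad u i y) = \<mu> * grad u l y"
  shows "(\<Sum>l\<in>UNIV. \<Sum>i\<in>UNIV. cdg u l i y * cdg u i l y) \<ge> \<mu>\<^sup>2"
proof -
  define Q where "Q = sqnorm u y"
  \<comment> \<open>Normalised so that \<open>N\<close> annihilates the gradient.\<close>
  define a where "a = \<mu> / Q"
  define w where "w = (\<lambda>i. pdv i u y)"
  define W where "W = (\<lambda>i. grad u i y)"
  define S where "S = (\<lambda>l i. cdg u l i y)"
  define N where "N = (\<lambda>i k. hs u i k y - a * w i * w k)"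
  have Ww: "(\<Sum>k\<in>UNIV. gi l k y * w k) = W l" for l by (simp add: W_def w_def grad_def)
  have wQ: "(\<Sum>i\<in>UNIV. W i * w i) = Q" by (simp add: W_def w_def Q_def sqnorm_def)
  have N1: "(\<Sum>k\<in>UNIV. gi l k y * N i k) = S l i - a * w i * W l" for l i
    by (simp add: N_def S_def cdg_eq_raise_hs[OF u y] Ww[symmetric] right_diff_distrib sum_subtractf
        sum_distrib_left mult_ac)
  have N2: "(\<Sum>k\<in>UNIV. gi i k y * N k l) = S i l - a * w l * W i" for l i
    using N1[of i l] by (simp add: N_def hs_sym[OF u y, of _ l] mult_ac)
  have e1: "(\<Sum>i\<in>UNIV. \<Sum>l\<in>UNIV. S l i * (w l * W i)) = \<mu> * Q"
  proof -
    have "(\<Sum>i\<in>UNIV. \<Sum>l\<in>UNIV. S l i * (w l * W i)) = (\<Sum>l\<in>UNIV. w l * (\<Sum>i\<in>UNIV. S l i * W i))"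
      by (subst sum.swap) (simp add: sum_distrib_left mult_ac)
    also have "\<dots> = \<mu> * (\<Sum>l\<in>UNIV. W l * w l)"
      using eig by (simp add: S_def W_def sum_distrib_left mult_ac)
    finally show ?thesis by (simp add: wQ)
  qed
  have e2: "(\<Sum>i\<in>UNIV. \<Sum>l\<in>UNIV. S i l * (w i * W l)) = \<mu> * Q"
    by (subst sum.swap) (rule e1)
  have e3: "(\<Sum>i\<in>UNIV. W i * w i * (\<Sum>l\<in>UNIV. W l * w l)) = Q * Q"
    by (simp add: wQ sum_distrib_right[symmetric])
  have "0 \<le> (\<Sum>i\<in>UNIV. \<Sum>l\<in>UNIV. (\<Sum>k\<in>UNIV. gi l k y * N i k) * (\<Sum>k\<in>UNIV. gi i k y * N k l))"
    by (rule posdef_tensor_norm_nonneg[OF gi_sym[OF y] gi_pos[OF y]])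
  also have "\<dots> = (\<Sum>i\<in>UNIV. \<Sum>l\<in>UNIV. S l i * S i l - a * (S l i * (w l * W i)) - a * (S i l * (w i * W l))
      + a * a * ((W i * w i) * (W l * w l)))"
    unfolding N1 N2 by (simp add: algebra_simps)
  also have "\<dots> = (\<Sum>i\<in>UNIV. \<Sum>l\<in>UNIV. S l i * S i l) - a * (\<mu> * Q) - a * (\<mu> * Q) + a * a * (Q * Q)"
    by (simp only: sum.distrib sum_subtractf sum_distrib_left[symmetric] e1 e2 e3)
  also have "\<dots> = (\<Sum>i\<in>UNIV. \<Sum>l\<in>UNIV. S l i * S i l) - \<mu>\<^sup>2"
    using Q by (simp add: a_def Q_def power2_eq_square field_simps)
  finally show ?thesis
    by (subst sum.swap) (simp add: S_def)
qed

section \<open>Derivatives of the barrier function at a fixed time\<close>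

lemma barrier_pdv:
  assumes u: "Cinf_on U u" and h: "Cinf_on U h" and y: "y \<in> U"
  shows "pdv i (\<lambda>z. \<phi> * h z - c * (B * u z - u z * u z)) y = \<phi> * pdv i h y - c * (B - 2 * u y) * pdv i u y"
proof -
  have d: "u differentiable (at y)" "h differentiable (at y)"
    by (intro Cinf_diffble u h y)+
  then show ?thesis
    by (simp add: dird_diff dird_cmult dird_mult differentiable_mult differentiable_diff)
      (simp add: algebra_simps)
qed

lemma barrier_pdv_pdv:
  assumes u: "Cinf_on U u" and h: "Cinf_on U h" and y: "y \<in> U"
  shows "pdv i (pdv j (\<lambda>z. \<phi> * h z - c * (B * u z - u z * u z))) y
    = \<phi> * pdv i (pdv j h) y - c * (B - 2 * u y) * pdv i (pdv j u) y + 2 * c * (pdv i u y * pdv j u y)"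
proof -
  have d: "u differentiable (at y)" "h differentiable (at y)" "pdv j u differentiable (at y)" "pdv j h differentiable (at y)"
    by (intro Cinf_diffble Cinf_on_dird u h y)+
  have "pdv i (pdv j (\<lambda>z. \<phi> * h z - c * (B * u z - u z * u z))) y
     = pdv i (\<lambda>z. \<phi> * pdv j h z - c * ((B - 2 * u z) * pdv j u z)) y"
    by (rule pdv_cong[OF y]) (simp add: barrier_pdv[OF u h])
  also have "\<dots> = \<phi> * pdv i (pdv j h) y - c * (B - 2 * u y) * pdv i (pdv j u) y + 2 * c * (pdv i u y * pdv j u y)"
    using d by (simp add: dird_diff dird_cmult dird_mult differentiable_mult differentiable_diff)
      (simp add: algebra_simps)
  finally show ?thesis .
qed

lemma barrier_grad:
  assumes u: "Cinf_on U u" and h: "Cinf_on U h" and y: "y \<in> U"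
  shows "grad (\<lambda>z. \<phi> * h z - c * (B * u z - u z * u z)) i y = \<phi> * grad h i y - c * (B - 2 * u y) * grad u i y"
  unfolding grad_def barrier_pdv[OF assms]
  by (simp add: right_diff_distrib sum_subtractf sum_distrib_left mult_ac)

lemma barrier_hs:
  assumes u: "Cinf_on U u" and h: "Cinf_on U h" and y: "y \<in> U"
  shows "hs (\<lambda>z. \<phi> * h z - c * (B * u z - u z * u z)) i j y
    = \<phi> * hs h i j y - c * (B - 2 * u y) * hs u i j y + 2 * c * (pdv i u y * pdv j u y)"
  unfolding hs_def barrier_pdv[OF assms] barrier_pdv_pdv[OF assms]
  by (simp add: right_diff_distrib sum_subtractf sum_distrib_left mult_ac)

lemma barrier_wlap:
  assumes u: "Cinf_on U u" and h: "Cinf_on U h" and y: "y \<in> U"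
  shows "wlap f (\<lambda>z. \<phi> * h z - c * (B * u z - u z * u z)) y
    = \<phi> * wlap f h y - c * (B - 2 * u y) * wlap f u y + 2 * c * sqnorm u y"
  unfolding wlap_def lap_def barrier_grad[OF assms] barrier_hs[OF assms] sqnorm_eq
  by (simp add: right_diff_distrib distrib_left sum_subtractf sum.distrib sum_distrib_left mult_ac)

text \<open>Translates the situation at the touching point into the numbers of
  \<open>touching_real\<close>. The equation is assumed on all of \<open>U\<close>, since it is
  differentiated in space; \<open>ut\<close> stands for the time derivative of the solution at the
  fixed time.\<close>

lemma no_touching:
  fixes f u q ut :: "real ^ 'n \<Rightarrow> real" and G :: "real \<Rightarrow> real"
  assumes \<xi>: "\<xi> = 2 * K + \<theta>1 + \<theta>2 + \<theta>3 + 1" and nn: "K \<ge> 0" "\<theta>1 \<ge> 0" "\<theta>2 \<ge> 0" "\<theta>3 \<ge> 0"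
    and c: "c = 2 + \<theta>4\<^sup>2 / \<xi>" and \<tau>: "\<tau> > 0"
    and \<phi>: "\<phi> = \<tau> / (1 + \<xi> * \<tau>)" and \<phi>': "\<phi>' = 1 / (1 + \<xi> * \<tau>)\<^sup>2"
    and f: "Cinf_on U f" and u: "Cinf_on U u" and q: "Cinf_on U q" and y: "y \<in> U"
    and eq: "\<And>z. z \<in> U \<Longrightarrow> ut z = wlap f u z - q z * u z - G (u z)"
    and G: "(G has_real_derivative G') (at (u y))"
    and uB: "0 < u y" "u y < B" and qb: "\<bar>q y\<bar> \<le> \<theta>1" and Gb: "\<bar>G (u y)\<bar> \<le> \<theta>2 * u y" "\<bar>G'\<bar> \<le> \<theta>3"
    and dq: "sqnorm q y \<le> \<theta>4\<^sup>2"
    and R: "(\<Sum>i\<in>UNIV. \<Sum>j\<in>UNIV. (ric i j y + hs f i j y) * grad u i y * grad u j y) \<ge> - K * sqnorm u y"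
    and touch: "\<phi> * sqnorm u y - c * (B * u y - u y * u y) = 0"
    and below: "\<And>z. z \<in> U \<Longrightarrow> \<phi> * sqnorm u z - c * (B * u z - u z * u z) \<le> 0"
    and time: "\<phi>' * sqnorm u y + \<phi> * (2 * (\<Sum>i\<in>UNIV. grad u i y * pdv i ut y)) - c * (B - 2 * u y) * ut y \<ge> 0"
  shows False
proof -
  define P where "P = (\<lambda>z. \<phi> * sqnorm u z - c * (B * u z - u z * u z))"
  note sq = Cinf_sqnorm[OF u]
  have P: "Cinf_on U P"
    unfolding P_def by (intro Cinf_on_diff Cinf_on_mult Cinf_on_const sq u open_U)
  have Pmax: "P z \<le> P y" if "z \<in> U" for z
    using below[OF that] touch by (simp add: P_def)
  have \<phi>0: "\<phi> > 0"
    unfolding \<phi> using \<tau> \<xi> nn by (intro divide_pos_pos add_pos_nonneg mult_nonneg_nonneg) auto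
  have "\<xi> \<ge> 1" using \<xi> nn by simp
  then have c0: "c > 0" by (simp add: c add_pos_nonneg)
  have Q: "\<phi> * sqnorm u y = c * (u y * (B - u y))"
    using touch by (simp add: algebra_simps)
  have "\<phi> * sqnorm u y > 0"
    unfolding Q using c0 uB by simp
  \<comment> \<open>The barrier is strictly positive because \<open>0 < u y < B\<close>, so the
    gradient cannot vanish at a touching point.\<close>
  then have Q0: "sqnorm u y > 0"
    using \<phi>0 by (simp add: zero_less_mult_iff)
  define Y where "Y = (\<Sum>i\<in>UNIV. grad u i y * pdv i (wlap f u) y)"
  define X where "X = (\<Sum>i\<in>UNIV. grad u i y * pdv i q y)"
  define SS where "SS = (\<Sum>l\<in>UNIV. \<Sum>i\<in>UNIV. cdg u l i y * cdg u i l y)"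
  define R' where "R' = (\<Sum>i\<in>UNIV. \<Sum>j\<in>UNIV. (ric i j y + hs f i j y) * grad u i y * grad u j y)"
  have eig: "(\<Sum>i\<in>UNIV. cdg u l i y * grad u i y) = c * (B - 2 * u y) / (2 * \<phi>) * grad u l y" for l
  proof -
    have "\<phi> * grad (sqnorm u) l y - c * (B - 2 * u y) * grad u l y = 0"
      using wlap_at_max(2)[OF P y Pmax, of l] barrier_grad[OF u sq y] by (simp add: P_def)
    then show ?thesis
      using \<phi>0 by (simp add: grad_sqnorm[OF u y] field_simps)
  qed
  have SS: "SS \<ge> (c * (B - 2 * u y) / (2 * \<phi>))\<^sup>2"
    unfolding SS_def by (rule cdg_tensor_norm_ge[OF u y Q0 eig])
  have space: "\<phi> * (2 * (Y + R' + SS)) - c * (B - 2 * u y) * wlap f u y + 2 * c * sqnorm u y \<le> 0"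
    using wlap_at_max(1)[OF P y Pmax, of f]
    unfolding P_def barrier_wlap[OF u sq y] weighted_bochner[OF f u y] Y_def R'_def SS_def .
  \<comment> \<open>The differentiated equation; it brings in the derivatives of \<open>q\<close>
    and \<open>G\<close> and replaces the gradient of the time derivative by that of the weighted
    Laplacian.\<close>
  have pdv_ut: "pdv i ut y = pdv i (wlap f u) y - (q y * pdv i u y + pdv i q y * u y) - G' * pdv i u y" for i
  proof -
    have d: "u differentiable (at y)" "q differentiable (at y)" "wlap f u differentiable (at y)"
      by (intro Cinf_diffble Cinf_wlap f u q y)+
    have dG: "(\<lambda>z. G (u z)) differentiable (at y)"
      using differentiable_compose[of G u y UNIV] G d(1) by (meson differentiableI field_differentiable_imp_differentiable DERIV_isCont has_field_derivative_imp_has_derivative)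
    have "pdv i ut y = pdv i (\<lambda>z. wlap f u z - q z * u z - G (u z)) y"
      by (rule pdv_cong[OF y]) (rule eq)
    also have "\<dots> = pdv i (wlap f u) y - (q y * pdv i u y + pdv i q y * u y) - G' * pdv i u y"
      using d dG by (simp add: dird_diff dird_mult differentiable_mult differentiable_diff dird_DERIV_comp[OF d(1) G])
    finally show ?thesis .
  qed
  have "(\<Sum>i\<in>UNIV. grad u i y * pdv i ut y) = Y - q y * sqnorm u y - u y * X - G' * sqnorm u y"
    unfolding pdv_ut Y_def X_def sqnorm_def
    by (simp add: right_diff_distrib distrib_left sum_subtractf sum.distrib sum_distrib_left mult_ac)
  then have time': "\<phi>' * sqnorm u y + \<phi> * (2 * (Y - q y * sqnorm u y - u y * X - G' * sqnorm u y))
      - c * (B - 2 * u y) * (wlap f u y - q y * u y - G (u y)) \<ge> 0"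
    using time eq[OF y] by simp
  have X: "- (2 * u y * X) \<le> sqnorm u y + (u y)\<^sup>2 * \<theta>4\<^sup>2"
  proof -
    have Xs: "X = (\<Sum>i\<in>UNIV. \<Sum>j\<in>UNIV. gi i j y * pdv i q y * pdv j u y)"
      unfolding X_def grad_def by (simp add: sum_distrib_left sum_distrib_right mult_ac)
    have Xs': "X = (\<Sum>i\<in>UNIV. \<Sum>j\<in>UNIV. gi i j y * pdv i u y * pdv j q y)"
      unfolding Xs by (subst sum.swap) (simp add: gi_sym[OF y, of i for i] mult_ac)
    have "0 \<le> (\<Sum>i\<in>UNIV. \<Sum>j\<in>UNIV. gi i j y * (pdv i u y + u y * pdv i q y) * (pdv j u y + u y * pdv j q y))"
      by (rule gi_quad_nonneg[OF y])
    also have "\<dots> = sqnorm u y + u y * X + u y * X + (u y * u y) * sqnorm q y"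
      unfolding sqnorm_eq
      apply (subst (1) Xs) apply (subst Xs')
      by (simp add: distrib_left distrib_right sum.distrib sum_distrib_left mult_ac)
    also have "\<dots> \<le> sqnorm u y + u y * X + u y * X + (u y * u y) * \<theta>4\<^sup>2"
      using dq by (intro add_left_mono mult_left_mono) auto
    finally show ?thesis by (simp add: power2_eq_square algebra_simps)
  qed
  show False
    by (rule touching_real[OF \<xi> nn c \<tau> \<phi> \<phi>' uB Q qb Gb R[folded R'_def] SS X time' space])
qed

end

section \<open>Charts of a Riemannian manifold\<close>

lemma inner_g_eq_inner: "inner_g g c p v v' = v \<bullet> (g c p *v v')"
  by (simp add: inner_g_def inner_vec_def matrix_vector_mult_def sum_distrib_left mult_ac)

lemma inner_g_axis: "inner_g g c p (axis i 1) (axis j 1) = g c p $ i $ j"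
  unfolding inner_g_eq_inner by (simp add: inner_axis' matrix_vector_mult_basis column_def)

lemma matrix_inv_mult:
  fixes M :: "real ^ 'n::finite ^ 'n"
  assumes "invertible M"
  shows "matrix_inv M ** M = mat 1" "M ** matrix_inv M = mat 1"
proof -
  have "M ** matrix_inv M = mat 1 \<and> matrix_inv M ** M = mat 1"
    using assms unfolding invertible_def matrix_inv_def by (rule someI_ex)
  then show "matrix_inv M ** M = mat 1" "M ** matrix_inv M = mat 1" by auto
qed

text \<open>Cramer's rule. It exhibits the entries of the inverse as determinants divided by a
  determinant, from which the smoothness of the inverse metric is read off.\<close>

lemma matrix_inv_component:
  fixes M :: "real ^ 'n::finite ^ 'n"
  assumes "invertible M"
  shows "matrix_inv M $ i $ j = det (\<chi> k l. if l = i then axis j 1 $ k else M $ k $ l) * inverse (det M)"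
proof -
  have "M *v (matrix_inv M *v axis j 1) = axis j 1"
    using matrix_inv_mult(2)[OF assms] by (simp add: matrix_vector_mul_assoc)
  then have "matrix_inv M *v axis j 1 = (\<chi> k. det (\<chi> i l. if l = k then axis j 1 $ i else M $ i $ l) / det M)"
    using assms by (subst (asm) cramer) (auto simp: invertible_det_nz)
  then have "(matrix_inv M *v axis j 1) $ i = det (\<chi> k l. if l = i then axis j 1 $ k else M $ k $ l) / det M"
    by simp
  then show ?thesis
    by (simp add: matrix_vector_mult_basis column_def divide_inverse)
qed

lemma Cinf_on_det:
  fixes M :: "'a::euclidean_space \<Rightarrow> real ^ 'n::finite ^ 'n"
  assumes "open S" "\<And>i j. Cinf_on S (\<lambda>x. M x $ i $ j)"
  shows "Cinf_on S (\<lambda>x. det (M x))"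
  unfolding det_def using assms
  by (intro Cinf_on_sum Cinf_on_mult Cinf_on_const Cinf_on_prod)

text \<open>Fixes one chart of the atlas. Through the sublocale below, the coordinate calculus
  becomes available on its image.\<close>

locale riemannian_chart = riemannian_manifold X A g
  for X :: "'a topology" and A :: "('a, 'n::finite) chart set" and g +
  fixes c :: "('a, 'n) chart"
  assumes chart_mem: "c \<in> A"
begin

abbreviation "V \<equiv> coord c ` dom_c c"
abbreviation "gmc \<equiv> \<lambda>i j y. g c (param c y) $ i $ j"
abbreviation "gic \<equiv> \<lambda>i j y. g_inv g c i j (param c y)"

lemma openin_dom: "openin X (dom_c c)" and open_V: "open V"
  and homeo: "homeomorphic_map (subtopology X (dom_c c)) (top_of_set V) (coord c)"
  using charts[OF chart_mem] by (auto simp: is_chart_def)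

lemma dom_subset: "dom_c c \<subseteq> topspace X"
  using openin_dom by (rule openin_subset)

lemma inj_coord: "inj_on (coord c) (dom_c c)"
  using homeomorphic_imp_injective_map[OF homeo] dom_subset by (simp add: Int_absorb1)

lemma param_coord: "p \<in> dom_c c \<Longrightarrow> param c (coord c p) = p"
  unfolding param_def using inj_coord by (rule inv_into_f_f)

lemma coord_param: "y \<in> V \<Longrightarrow> coord c (param c y) = y"
  unfolding param_def by (rule f_inv_into_f)

lemma param_mem: "y \<in> V \<Longrightarrow> param c y \<in> dom_c c"
  unfolding param_def by (rule inv_into_into)

lemma invertible_g:
  assumes "p \<in> dom_c c" shows "invertible (g c p)"
proof -
  have "v = 0" if "g c p *v v = 0" for v
    using metric_pos[OF chart_mem assms, of v] that by (auto simp: inner_g_eq_inner)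
  then show ?thesis
    unfolding invertible_left_inverse matrix_left_invertible_ker by blast
qed

lemma g_sym: "p \<in> dom_c c \<Longrightarrow> g c p $ i $ j = g c p $ j $ i"
  using metric_sym[OF chart_mem, of p "axis i 1" "axis j 1"] by (simp add: inner_g_axis)

lemma g_inv_sym:
  assumes "p \<in> dom_c c" shows "g_inv g c i j p = g_inv g c j i p"
proof -
  let ?M = "g c p"
  have t: "transpose ?M = ?M" using g_sym[OF assms] by (simp add: transpose_def vec_eq_iff)
  note inv = matrix_inv_mult[OF invertible_g[OF assms]]
  have "transpose (matrix_inv ?M) ** ?M = mat 1"
    using inv(2) t by (metis matrix_transpose_mul transpose_mat)
  then have "transpose (matrix_inv ?M) = matrix_inv ?M"
    using inv(2) by (metis matrix_mul_assoc matrix_mul_lid matrix_mul_rid)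
  then have "transpose (matrix_inv ?M) $ i $ j = matrix_inv ?M $ i $ j" by simp
  then show ?thesis by (simp add: g_inv_def transpose_def)
qed

lemma gmc_smooth: "Cinf_on V (gmc i j)"
proof -
  have "Cinf_on V (\<lambda>y. g c (param c y))"
    using metric_smooth[OF chart_mem] open_V by (rule smooth_on_open_imp_Cinf_on)
  then have "Cinf_on V (\<lambda>y. g c (param c y) $ i)"
    by (rule Cinf_on_bounded_linear[OF open_V bounded_linear_vec_nth])
  then show ?thesis
    by (rule Cinf_on_bounded_linear[OF open_V bounded_linear_vec_nth])
qed

lemma gic_smooth: "Cinf_on V (gic i j)"
proof -
  have "Cinf_on V (\<lambda>y. det (\<chi> k l. if l = i then axis j 1 $ k else g c (param c y) $ k $ l) * inverse (det (g c (param c y))))"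
  proof (intro Cinf_on_mult Cinf_on_inverse Cinf_on_det open_V gmc_smooth)
    show "Cinf_on V (\<lambda>x. (\<chi> k l. if l = i then axis j 1 $ k else g c (param c x) $ k $ l) $ r $ s)" for r s
      by (cases "s = i") (simp_all add: Cinf_on_const gmc_smooth)
    show "det (g c (param c y)) \<noteq> 0" if "y \<in> V" for y
      using invertible_g[OF param_mem[OF that]] by (simp add: invertible_det_nz)
  qed
  moreover have "gic i j y = det (\<chi> k l. if l = i then axis j 1 $ k else g c (param c y) $ k $ l) * inverse (det (g c (param c y)))"
    if "y \<in> V" for y
    using matrix_inv_component[OF invertible_g[OF param_mem[OF that]]] by (simp add: g_inv_def)
  ultimately show ?thesis
    using Cinf_on_cong[OF open_V, of "gic i j"] by simp
qed

sublocale local_metric V gmc gic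
proof
  show "Cinf_on V (gmc i j)" "Cinf_on V (gic i j)" "open V" for i j
    by (rule gmc_smooth gic_smooth open_V)+
next
  fix y assume y: "y \<in> V"
  note p = param_mem[OF y]
  note inv = matrix_inv_mult[OF invertible_g[OF p]]
  show "gmc i j y = gmc j i y" "gic i j y = gic j i y" for i j
    by (rule g_sym[OF p] g_inv_sym[OF p])+
  show "(\<Sum>k\<in>UNIV. gic i k y * gmc k j y) = (if i = j then 1 else 0)" for i j
  proof -
    have "(matrix_inv (g c (param c y)) ** g c (param c y)) $ i $ j = (if i = j then 1 else 0)"
      unfolding inv(1) by (simp add: mat_def)
    then show ?thesis by (simp add: matrix_matrix_mult_def g_inv_def)
  qed
  show "(\<Sum>i\<in>UNIV. \<Sum>j\<in>UNIV. gic i j y * x i * x j) > 0" if "\<exists>i. x i \<noteq> 0" for x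
  proof -
    define v where "v = (\<chi> i. x i)"
    \<comment> \<open>The inverse form at \<open>v\<close> is the metric at \<open>z\<close>, the
      vector with lowered index \<open>v\<close>.\<close>
    define z where "z = matrix_inv (g c (param c y)) *v v"
    have v: "v = g c (param c y) *v z"
      by (simp add: z_def matrix_vector_mul_assoc inv(2))
    have "v \<noteq> 0" using that by (auto simp: v_def vec_eq_iff)
    then have "z \<noteq> 0" using v by auto
    then have "0 < z \<bullet> (g c (param c y) *v z)"
      using metric_pos[OF chart_mem p] by (simp add: inner_g_eq_inner)
    also have "\<dots> = v \<bullet> z" by (simp add: v inner_commute)
    also have "\<dots> = (\<Sum>i\<in>UNIV. \<Sum>j\<in>UNIV. gic i j y * x i * x j)"
      by (simp add: z_def inner_vec_def matrix_vector_mult_def g_inv_def v_def sum_distrib_left mult_ac)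
    finally show ?thesis .
  qed
qed

section \<open>The operators of the manifold in a fixed chart\<close>

lemma pd_param: "y \<in> V \<Longrightarrow> pd c i u (param c y) = pdv i (\<lambda>z. u (param c z)) y"
  by (simp add: pd_def coord_param comp_def)

lemma pd_pd_param: "y \<in> V \<Longrightarrow> pd c i (pd c j u) (param c y) = pdv i (pdv j (\<lambda>z. u (param c z))) y"
proof -
  assume y: "y \<in> V"
  have "pdv i (\<lambda>z. pd c j u (param c z)) y = pdv i (pdv j (\<lambda>z. u (param c z))) y"
    by (rule pdv_cong[OF y]) (rule pd_param)
  then show ?thesis by (simp add: pd_param[OF y])
qed

lemma christoffel_param: "y \<in> V \<Longrightarrow> christoffel g c k i j (param c y) = chr k i j y"
  by (simp add: christoffel_def chr_def pd_param)

lemma gradient_param: "y \<in> V \<Longrightarrow> gradient g c u (param c y) $ i = grad (\<lambda>z. u (param c z)) i y"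
  by (simp add: gradient_def grad_def pd_param)

lemma hess_param: "y \<in> V \<Longrightarrow> hess g c u i j (param c y) = hs (\<lambda>z. u (param c z)) i j y"
  unfolding hess_def hs_def by (simp only: pd_pd_param) (simp add: pd_param christoffel_param)

lemma ricci_param: "y \<in> V \<Longrightarrow> ricci g c j k (param c y) = ric j k y"
proof -
  assume y: "y \<in> V"
  have "pd c i (christoffel g c l j k) (param c y) = pdv i (chr l j k) y" for i l j k
    unfolding pd_param[OF y] by (rule pdv_cong[OF y]) (rule christoffel_param)
  then show ?thesis
    by (simp add: ricci_def riemann_def ric_def christoffel_param[OF y])
qed

lemma inner_gradient:
  assumes y: "y \<in> V"
  shows "inner_g g c (param c y) v (gradient g c u (param c y)) = (\<Sum>i\<in>UNIV. v $ i * pdv i (\<lambda>z. u (param c z)) y)"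
proof -
  have "inner_g g c (param c y) v (gradient g c u (param c y))
      = (\<Sum>i\<in>UNIV. v $ i * (\<Sum>j\<in>UNIV. gmc i j y * grad (\<lambda>z. u (param c z)) j y))"
    by (simp add: inner_g_def gradient_param[OF y] sum_distrib_left mult_ac)
  then show ?thesis by (simp add: lower_grad[OF y])
qed

lemma inner_gradient_self:
  assumes y: "y \<in> V"
  shows "inner_g g c (param c y) (gradient g c u (param c y)) (gradient g c u (param c y)) = sqnorm (\<lambda>z. u (param c z)) y"
  by (simp add: inner_gradient[OF y] gradient_param[OF y] sqnorm_def)

lemma weighted_laplacian_param:
  assumes y: "y \<in> V"
  shows "weighted_laplacian g c f u (param c y) = wlap (\<lambda>z. f (param c z)) (\<lambda>z. u (param c z)) y"
proof -
  have "inner_g g c (param c y) (gradient g c f (param c y)) (gradient g c u (param c y))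
     = inner_g g c (param c y) (gradient g c u (param c y)) (gradient g c f (param c y))"
    by (rule metric_sym[OF chart_mem param_mem[OF y]])
  then show ?thesis
    by (simp add: weighted_laplacian_def wlap_def laplacian_def lap_def hess_param[OF y]
        inner_gradient[OF y] gradient_param[OF y] mult.commute)
qed

lemma ricci_f_param:
  assumes y: "y \<in> V"
  shows "ricci_f g c f (param c y) (gradient g c u (param c y)) (gradient g c u (param c y))
    = (\<Sum>i\<in>UNIV. \<Sum>j\<in>UNIV. (ric i j y + hs (\<lambda>z. f (param c z)) i j y)
        * grad (\<lambda>z. u (param c z)) i y * grad (\<lambda>z. u (param c z)) j y)"
  by (simp add: ricci_f_def ricci_param[OF y] hess_param[OF y] gradient_param[OF y])

lemma norm_gradient_sq:
  assumes p: "p \<in> dom_c c"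
  shows "(norm_g g c p (gradient g c u p))\<^sup>2 = sqnorm (\<lambda>z. u (param c z)) (coord c p)"
proof -
  have y: "coord c p \<in> V" using p by blast
  have "inner_g g c p v v \<ge> 0" for v
    using metric_pos[OF chart_mem p, of v] by (cases "v = 0") (auto simp: inner_g_def)
  then have "(norm_g g c p (gradient g c u p))\<^sup>2 = inner_g g c p (gradient g c u p) (gradient g c u p)"
    by (simp add: norm_g_def)
  then show ?thesis
    using inner_gradient_self[OF y, of u] by (simp add: param_coord[OF p])
qed

end

context riemannian_manifold
begin

text \<open>The gradient is the vector that represents the differential. The derivative
  \<open>J\<close> of the transition map is an isometry, hence injective and therefore surjective;
  the \<open>J\<close>-preimage of one gradient represents the differential in the other chart, and
  definiteness identifies it with the gradient there.\<close>

lemma norm_gradient_chart_indep: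
  assumes c: "c \<in> A" and c': "c' \<in> A" and p: "p \<in> dom_c c" "p \<in> dom_c c'"
    and u: "(\<lambda>z. u (param c' z)) differentiable (at (coord c' p))"
  shows "norm_g g c p (gradient g c u p) = norm_g g c' p (gradient g c' u p)"
proof -
  interpret C: riemannian_chart X A g c by unfold_locales (rule c)
  interpret C': riemannian_chart X A g c' by unfold_locales (rule c')
  define y where "y = coord c p"
  define y' where "y' = coord c' p"
  define t where "t = transition c c'"
  define N where "N = coord c ` (dom_c c \<inter> dom_c c')"
  define J where "J = frechet_derivative t (at y)"
  have yV: "y \<in> C.V" "y' \<in> C'.V" "y \<in> N" using p by (auto simp: y_def y'_def N_def)
  have N: "open N"
  proof -
    have "openin (subtopology X (dom_c c)) (dom_c c \<inter> dom_c c')"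
      using C'.openin_dom by (metis Int_commute openin_subtopology_Int)
    then have "openin (top_of_set C.V) N"
      using homeomorphic_imp_open_map[OF C.homeo] unfolding N_def open_map_def by blast
    then show ?thesis using C.open_V openin_open_eq by blast
  qed
  have ty: "t y = y'"
    by (simp add: t_def transition_def y_def y'_def C.param_coord[OF p(1)])
  have "Cinf_on N t"
    using smooth_transition[OF c c'] N unfolding N_def t_def by (rule smooth_on_open_imp_Cinf_on)
  then have J: "(t has_derivative J) (at y)"
    unfolding J_def by (rule Cinf_on_has_derivative[OF _ N yV(3)])
  define F where "F = (\<lambda>v. dird v (\<lambda>z. u (param c z)) y)"
  define F' where "F' = (\<lambda>v. dird v (\<lambda>z. u (param c' z)) y')"
  have comp: "u (param c z) = u (param c' (t z))" if "z \<in> N" for z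
  proof -
    obtain r where r: "r \<in> dom_c c" "r \<in> dom_c c'" "z = coord c r" using \<open>z \<in> N\<close> unfolding N_def by blast
    then show ?thesis
      by (simp add: t_def transition_def C.param_coord C'.param_coord)
  qed
  have u': "((\<lambda>z. u (param c' z)) has_derivative F') (at (t y))"
    using u unfolding F'_def ty y'_def by (simp add: frechet_derivative_works)
  from has_derivative_compose[OF J u']
  have "((\<lambda>z. u (param c' (t z))) has_derivative (\<lambda>v. F' (J v))) (at y)" .
  then have D: "((\<lambda>z. u (param c z)) has_derivative (\<lambda>v. F' (J v))) (at y)"
    by (rule has_derivative_transform_within_open[OF _ N yV(3)]) (simp add: comp)
  have FJ: "F v = F' (J v)" for v
    unfolding F_def using frechet_derivative_at[OF D] by metis
  have in1: "inner_g g c p v (gradient g c u p) = F v" for v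
  proof -
    have "(\<lambda>z. u (param c z)) differentiable (at y)" using D by (rule differentiableI)
    then have "F v = (\<Sum>i\<in>UNIV. v $ i * pdv i (\<lambda>z. u (param c z)) y)"
      unfolding F_def by (rule dird_eq_sum_axis)
    then show ?thesis
      using C.inner_gradient[OF yV(1), of v u] by (simp add: y_def C.param_coord[OF p(1)])
  qed
  have in2: "inner_g g c' p v (gradient g c' u p) = F' v" for v
  proof -
    have "F' v = (\<Sum>i\<in>UNIV. v $ i * pdv i (\<lambda>z. u (param c' z)) y')"
      unfolding F'_def using u by (intro dird_eq_sum_axis) (simp add: y'_def)
    then show ?thesis
      using C'.inner_gradient[OF yV(2), of v u] by (simp add: y'_def C'.param_coord[OF p(2)])
  qed
  have tr: "inner_g g c p v v' = inner_g g c' p (J v) (J v')" for v v'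
    using metric_transform[OF c c'] p unfolding J_def t_def y_def by blast
  have linJ: "linear J" using J by (rule has_derivative_linear)
  have "inj J"
  proof (rule linear_injective_0[THEN iffD2, OF linJ], intro allI impI)
    fix v assume "J v = 0"
    then have "inner_g g c p v v = 0" using tr[of v v] by (simp add: inner_g_def)
    then show "v = 0" using metric_pos[OF c p(1), of v] by force
  qed
  then have "surj J" using linJ by (simp add: linear_injective_imp_surjective)
  then obtain W where W: "gradient g c' u p = J W" by (metis surjD)
  define Z where "Z = gradient g c u p - W"
  have "inner_g g c p v W = F v" for v
    using tr[of v W] in2[of "J v"] by (simp add: W FJ)
  then have "inner_g g c p Z Z = 0"
    using in1[of Z] by (simp add: Z_def inner_g_eq_inner matrix_vector_mult_diff_distrib inner_diff_right)
  then have "Z = 0" using metric_pos[OF c p(1), of Z] by force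
  then have "gradient g c u p = W" by (simp add: Z_def)
  then show ?thesis
    unfolding norm_g_def W using tr[of W W] by simp
qed

end

section \<open>Functions of space and time\<close>

text \<open>Near any point of \<open>S \<times> I\<close> the map extends smoothly to an open set,
  and the spatial derivatives of map and extension agree. This reduces regularity up to the final
  time to maps on open sets.\<close>

lemma smooth_on_times_extension:
  fixes h :: "'a::euclidean_space \<times> real \<Rightarrow> real"
  assumes "smooth_on (S \<times> I) h" "open S" "y \<in> S" "t \<in> I"
  obtains V h' where "open V" "(y, t) \<in> V" "Cinf_on V h'"
    and "\<And>z s. (z, s) \<in> V \<Longrightarrow> z \<in> S \<Longrightarrow> s \<in> I \<Longrightarrow> h' (z, s) = h (z, s)"
    and "\<And>z s v. (z, s) \<in> V \<Longrightarrow> z \<in> S \<Longrightarrow> s \<in> I \<Longrightarrow> dird v (\<lambda>x. h (x, s)) z = dird (v, 0) h' (z, s)"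
proof -
  have yt: "(y, t) \<in> S \<times> I" using assms(3,4) by simp
  obtain V h' where V: "open V" "(y, t) \<in> V" "Cinf_on V h'" and eq: "\<forall>x\<in>V \<inter> S \<times> I. h' x = h x"
    using bspec[OF assms(1)[unfolded smooth_on_def] yt] unfolding Cinf_on_def by blast
  have "dird v (\<lambda>x. h (x, s)) z = dird (v, 0) h' (z, s)" if zs: "(z, s) \<in> V" "z \<in> S" "s \<in> I" for z s v
  proof -
    define N where "N = S \<inter> (\<lambda>x. (x, s)) -` V"
    have N: "open N" unfolding N_def
      by (intro open_Int open_vimage assms(2) V(1) continuous_intros)
    have "dird v (\<lambda>x. h (x, s)) z = dird v (\<lambda>x. h' (x, s)) z"
      using zs eq by (intro dird_cong[OF N]) (auto simp: N_def)
    also have "\<dots> = dird (v, 0) h' (z, s)"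
      by (rule dird_slice[OF Cinf_on_differentiable[OF V(3,1) zs(1)]])
    finally show ?thesis .
  qed
  with V eq show thesis by (intro that[of V h']) auto
qed

lemma continuous_on_dird_slice:
  fixes h :: "'a::euclidean_space \<times> real \<Rightarrow> real"
  assumes "smooth_on (S \<times> I) h" "open S"
  shows "continuous_on (S \<times> I) (\<lambda>z. dird v (\<lambda>x. h (x, snd z)) (fst z))" "continuous_on (S \<times> I) h"
  unfolding continuous_on_eq_continuous_within
proof (safe)
  fix y t assume yt: "y \<in> S" "t \<in> I"
  obtain V h' where V: "open V" "(y, t) \<in> V" "Cinf_on V h'"
    and eq: "\<And>z s. (z, s) \<in> V \<Longrightarrow> z \<in> S \<Longrightarrow> s \<in> I \<Longrightarrow> h' (z, s) = h (z, s)"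
    and d: "\<And>z s v. (z, s) \<in> V \<Longrightarrow> z \<in> S \<Longrightarrow> s \<in> I \<Longrightarrow> dird v (\<lambda>x. h (x, s)) z = dird (v, 0) h' (z, s)"
    by (rule smooth_on_times_extension[OF assms yt]) (rule that)
  have op: "openin (top_of_set (S \<times> I)) (S \<times> I \<inter> V)"
    using V(1) by (rule openin_open_Int)
  have *: "continuous (at (y, t) within S \<times> I) k" if "Cinf_on V k" for k :: "'a \<times> real \<Rightarrow> real"
    using Cinf_on_continuous[OF that] V(1,2) continuous_on_eq_continuous_at continuous_at_imp_continuous_within by blast
  show "continuous (at (y, t) within S \<times> I) (\<lambda>z. dird v (\<lambda>x. h (x, snd z)) (fst z))"
    by (rule continuous_transform_within_openin[OF *[OF Cinf_on_dird[OF V(3), of "(v, 0)"]] op])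
      (use yt V(2) d in auto)
  show "continuous (at (y, t) within S \<times> I) h"
    by (rule continuous_transform_within_openin[OF *[OF V(3)] op]) (use yt V(2) eq in auto)
qed

text \<open>Space and time derivatives commute for the smooth extension, and both facts restrict to
  \<open>I\<close>. The condition \<open>nb\<close> makes the derivative within \<open>I\<close>
  unique, which matters as it is one-sided at an endpoint.\<close>

lemma smooth_on_times_time_derivative:
  fixes h :: "'a::euclidean_space \<times> real \<Rightarrow> real"
  assumes "smooth_on (S \<times> I) h" "open S" "y \<in> S" "t \<in> I" and nb: "at t within I \<noteq> bot"
  defines "ht \<equiv> \<lambda>z. vector_derivative (\<lambda>s. h (z, s)) (at t within I)"
  shows "((\<lambda>s. h (y, s)) has_real_derivative ht y) (at t within I)"
    and "((\<lambda>s. dird v (\<lambda>x. h (x, s)) y) has_real_derivative dird v ht y) (at t within I)"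
proof -
  obtain V h' where V: "open V" "(y, t) \<in> V" "Cinf_on V h'"
    and eq: "\<And>z s. (z, s) \<in> V \<Longrightarrow> z \<in> S \<Longrightarrow> s \<in> I \<Longrightarrow> h' (z, s) = h (z, s)"
    and d: "\<And>z s v. (z, s) \<in> V \<Longrightarrow> z \<in> S \<Longrightarrow> s \<in> I \<Longrightarrow> dird v (\<lambda>x. h (x, s)) z = dird (v, 0) h' (z, s)"
    by (rule smooth_on_times_extension[OF assms(1-4)]) (rule that)
  \<comment> \<open>Stated for general \<open>k\<close> since it serves both the map itself and its
    spatial derivative.\<close>
  have transfer: "(k has_real_derivative dird (0, 1) k' (z, t)) (at t within I)"
    if k': "Cinf_on V k'" and z: "(z, t) \<in> V" and k: "\<And>s. (z, s) \<in> V \<Longrightarrow> s \<in> I \<Longrightarrow> k' (z, s) = k s"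
    for k :: "real \<Rightarrow> real" and k' z
  proof -
    have "k' differentiable (at ((z, 0) + t *\<^sub>R (0, 1)))"
      using Cinf_on_differentiable[OF k' V(1) z] by simp
    from DERIV_along_line[OF this]
    have D: "((\<lambda>s. k' (z, s)) has_real_derivative dird (0, 1) k' (z, t)) (at t within I)"
      by (simp add: has_field_derivative_at_within)
    have "open ((\<lambda>s. (z, s)) -` V)"
      by (intro open_vimage V(1) continuous_intros)
    moreover have "t \<in> (\<lambda>s. (z, s)) -` V" using z by simp
    ultimately obtain e where e: "e > 0" "ball t e \<subseteq> (\<lambda>s. (z, s)) -` V"
      by (rule openE)
    show ?thesis
    proof (rule has_field_derivative_transform_within[OF D e(1) assms(4)])
      fix s assume "s \<in> I" "dist s t < e"
      then show "k' (z, s) = k s" using e(2) k by (auto simp: dist_commute subset_iff)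
    qed
  qed
  have ht: "((\<lambda>s. h (z, s)) has_real_derivative dird (0, 1) h' (z, t)) (at t within I)"
    if "(z, t) \<in> V" "z \<in> S" for z
    using transfer[OF V(3) that(1), of "\<lambda>s. h (z, s)"] eq that by simp
  have ht_eq: "ht z = dird (0, 1) h' (z, t)" if "(z, t) \<in> V" "z \<in> S" for z
    unfolding ht_def using ht[OF that] nb
    by (intro vector_derivative_within) (simp_all add: has_real_derivative_iff_has_vector_derivative)
  show "((\<lambda>s. h (y, s)) has_real_derivative ht y) (at t within I)"
    using ht[OF V(2) assms(3)] ht_eq[OF V(2) assms(3)] by simp
  define N where "N = S \<inter> (\<lambda>x. (x, t)) -` V"
  have N: "open N" unfolding N_def
    by (intro open_Int open_vimage assms(2) V(1) continuous_intros)
  have yN: "y \<in> N" using assms(3) V(2) by (simp add: N_def)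
  have "dird v ht y = dird v (\<lambda>z. dird (0, 1) h' (z, t)) y"
    using ht_eq by (intro dird_cong[OF N yN]) (simp add: N_def)
  also have "\<dots> = dird (v, 0) (dird (0, 1) h') (y, t)"
    by (rule dird_slice[OF Cinf_on_differentiable[OF Cinf_on_dird[OF V(3)] V(1,2)]])
  also have "\<dots> = dird (0, 1) (dird (v, 0) h') (y, t)"
    by (rule dird_commute[OF V(1,3,2)])
  finally have eqd: "dird v ht y = dird (0, 1) (dird (v, 0) h') (y, t)" .
  show "((\<lambda>s. dird v (\<lambda>x. h (x, s)) y) has_real_derivative dird v ht y) (at t within I)"
    unfolding eqd
    by (rule transfer[OF Cinf_on_dird[OF V(3)] V(2)]) (simp add: d assms(3))
qed

context riemannian_chart
begin

lemma smooth_spacetimeD: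
  "smooth_spacetime A I u \<Longrightarrow> smooth_on (V \<times> I) (\<lambda>z. u (param c (fst z)) (snd z))"
  using chart_mem unfolding smooth_spacetime_def by (auto simp: case_prod_unfold)

lemma Cinf_spacetime_slice:
  assumes "smooth_spacetime A I u" "t \<in> I" shows "Cinf_on V (\<lambda>z. u (param c z) t)"
  using smooth_on_slice[OF smooth_spacetimeD[OF assms(1)] open_V assms(2)] by simp

text \<open>The metric does not depend on time, so only the two differentials in the squared norm
  are differentiated; symmetry of the inverse metric makes their contributions equal.\<close>

lemma time_derivative:
  assumes u: "smooth_spacetime A I u" and y: "y \<in> V" and t: "t \<in> I" and nb: "at t within I \<noteq> bot"
  defines "ut \<equiv> \<lambda>z. vector_derivative (u (param c z)) (at t within I)"
  shows "(u (param c y) has_real_derivative ut y) (at t within I)"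
    and "((\<lambda>s. sqnorm (\<lambda>z. u (param c z) s) y) has_real_derivative
       2 * (\<Sum>i\<in>UNIV. grad (\<lambda>z. u (param c z) t) i y * pdv i ut y)) (at t within I)"
proof -
  note D = smooth_on_times_time_derivative[OF smooth_spacetimeD[OF u] open_V y t nb, simplified, folded ut_def]
  show "(u (param c y) has_real_derivative ut y) (at t within I)"
    using D(1) by (simp add: ut_def)
  define w where "w = (\<lambda>i. pdv i (\<lambda>z. u (param c z) t) y)"
  have "((\<lambda>s. sqnorm (\<lambda>z. u (param c z) s) y) has_real_derivative
      (\<Sum>i\<in>UNIV. \<Sum>j\<in>UNIV. gic i j y * (w i * pdv j ut y + pdv i ut y * w j))) (at t within I)"
    unfolding sqnorm_eq w_def
    by (auto intro!: derivative_eq_intros D(2) sum.cong simp: algebra_simps)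
  also have "(\<Sum>i\<in>UNIV. \<Sum>j\<in>UNIV. gic i j y * (w i * pdv j ut y + pdv i ut y * w j))
      = (\<Sum>i\<in>UNIV. \<Sum>j\<in>UNIV. gic i j y * w i * pdv j ut y) + (\<Sum>i\<in>UNIV. \<Sum>j\<in>UNIV. gic i j y * pdv i ut y * w j)"
    by (simp add: distrib_left sum.distrib mult_ac)
  also have "(\<Sum>i\<in>UNIV. \<Sum>j\<in>UNIV. gic i j y * w i * pdv j ut y) = (\<Sum>j\<in>UNIV. \<Sum>i\<in>UNIV. gic j i y * w i * pdv j ut y)"
    by (subst sum.swap) (simp add: gi_sym[OF y])
  also have "(\<Sum>j\<in>UNIV. \<Sum>i\<in>UNIV. gic j i y * w i * pdv j ut y) + (\<Sum>i\<in>UNIV. \<Sum>j\<in>UNIV. gic i j y * pdv i ut y * w j)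
      = 2 * (\<Sum>i\<in>UNIV. grad (\<lambda>z. u (param c z) t) i y * pdv i ut y)"
    by (simp add: grad_def w_def sum_distrib_left sum_distrib_right mult_ac)
  finally show "((\<lambda>s. sqnorm (\<lambda>z. u (param c z) s) y) has_real_derivative
       2 * (\<Sum>i\<in>UNIV. grad (\<lambda>z. u (param c z) t) i y * pdv i ut y)) (at t within I)" .
qed

lemma continuous_on_spacetime:
  assumes u: "smooth_spacetime A I u"
  shows "continuous_on (V \<times> I) (\<lambda>z. u (param c (fst z)) (snd z))"
    and "continuous_on (V \<times> I) (\<lambda>z. sqnorm (\<lambda>x. u (param c x) (snd z)) (fst z))"
proof -
  note C = continuous_on_dird_slice[OF smooth_spacetimeD[OF u] open_V, simplified]
  show "continuous_on (V \<times> I) (\<lambda>z. u (param c (fst z)) (snd z))"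
    by (rule C(2))
  have "continuous_on (V \<times> I) (\<lambda>z. gic i j (fst z))" for i j
    by (rule continuous_on_compose2[OF Cinf_on_continuous[OF gi_smooth]]) (auto intro!: continuous_intros)
  then show "continuous_on (V \<times> I) (\<lambda>z. sqnorm (\<lambda>x. u (param c x) (snd z)) (fst z))"
    unfolding sqnorm_eq by (intro continuous_on_sum continuous_on_mult C(1))
qed

end

context riemannian_manifold
begin

text \<open>The choice of chart is irrelevant for differentiable functions, by
  \<open>norm_gradient_chart_indep\<close>.\<close>

definition grad_sq :: "('a \<Rightarrow> real) \<Rightarrow> 'a \<Rightarrow> real" where
  "grad_sq u p = (let c = SOME c. c \<in> A \<and> p \<in> dom_c c in (norm_g g c p (gradient g c u p))\<^sup>2)"

lemma grad_sq_eq: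
  assumes "smooth_spacetime A I u" "t \<in> I" "c \<in> A" "p \<in> dom_c c"
  shows "grad_sq (\<lambda>x. u x t) p = (norm_g g c p (gradient g c (\<lambda>x. u x t) p))\<^sup>2"
proof -
  define c' where "c' = (SOME c. c \<in> A \<and> p \<in> dom_c c)"
  have c': "c' \<in> A" "p \<in> dom_c c'"
    using someI[of "\<lambda>c. c \<in> A \<and> p \<in> dom_c c" c] assms(3,4) by (auto simp: c'_def)
  interpret C: riemannian_chart X A g c by unfold_locales (rule assms(3))
  have "(\<lambda>z. u (param c z) t) differentiable (at (coord c p))"
    using C.Cinf_diffble[OF C.Cinf_spacetime_slice[OF assms(1,2)]] assms(4) by blast
  from norm_gradient_chart_indep[OF c'(1) assms(3) c'(2) assms(4), of "\<lambda>x. u x t"] this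
  show ?thesis by (simp add: grad_sq_def Let_def c'_def)
qed

text \<open>The sets \<open>dom_c c \<times> I\<close> form an open cover of space-time, so
  continuity may be checked in coordinates, chart by chart.\<close>

lemma continuous_map_chartwise:
  fixes k :: "'a \<times> real \<Rightarrow> real"
  assumes k: "\<And>c. c \<in> A \<Longrightarrow> \<exists>k'. continuous_on (coord c ` dom_c c \<times> I) k'
      \<and> (\<forall>p\<in>dom_c c. \<forall>t\<in>I. k (p, t) = k' (coord c p, t))"
  shows "continuous_map (prod_topology X (top_of_set I)) euclideanreal k"
proof (rule pasting_lemma[where I = A and T = "\<lambda>c. dom_c c \<times> I" and f = "\<lambda>_. k"])
  fix c assume c: "c \<in> A"
  interpret C: riemannian_chart X A g c by unfold_locales (rule c)
  show "openin (prod_topology X (top_of_set I)) (dom_c c \<times> I)"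
    using C.openin_dom by (simp add: openin_prod_Times_iff)
  obtain k' where k': "continuous_on (C.V \<times> I) k'" "\<And>p t. p \<in> dom_c c \<Longrightarrow> t \<in> I \<Longrightarrow> k (p, t) = k' (coord c p, t)"
    using k[OF c] by blast
  have top: "subtopology (prod_topology X (top_of_set I)) (dom_c c \<times> I)
      = prod_topology (subtopology X (dom_c c)) (top_of_set I)"
    by (simp add: subtopology_Times subtopology_subtopology)
  have "continuous_map (prod_topology (subtopology X (dom_c c)) (top_of_set I))
      (prod_topology (top_of_set C.V) (top_of_set I)) (\<lambda>(p, t). (coord c p, t))"
    using homeomorphic_imp_continuous_map[OF C.homeo] by (simp add: continuous_map_prod_top del: prod_topology_subtopology_eu)
  moreover have "continuous_map (prod_topology (top_of_set C.V) (top_of_set I)) euclideanreal k'"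
    using k'(1) by simp
  ultimately have "continuous_map (prod_topology (subtopology X (dom_c c)) (top_of_set I)) euclideanreal
      (k' \<circ> (\<lambda>(p, t). (coord c p, t)))"
    by (rule continuous_map_compose)
  then show "continuous_map (subtopology (prod_topology X (top_of_set I)) (dom_c c \<times> I)) euclideanreal k"
    unfolding top by (rule continuous_map_eq) (auto simp: k'(2))
next
  fix x assume "x \<in> topspace (prod_topology X (top_of_set I))"
  then have x: "fst x \<in> topspace X" "snd x \<in> I" by auto
  then obtain c where "c \<in> A" "fst x \<in> dom_c c" using cover by blast
  then show "\<exists>c. c \<in> A \<and> x \<in> dom_c c \<times> I \<and> k x = k x"
    using x(2) by (intro exI[of _ c]) (simp add: mem_Times_iff)
qed simp

lemma continuous_map_spacetime:
  assumes u: "smooth_spacetime A I u"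
  shows "continuous_map (prod_topology X (top_of_set I)) euclideanreal (\<lambda>z. u (fst z) (snd z))"
    and "continuous_map (prod_topology X (top_of_set I)) euclideanreal (\<lambda>z. grad_sq (\<lambda>x. u x (snd z)) (fst z))"
proof -
  have "\<exists>k'. continuous_on (coord c ` dom_c c \<times> I) k' \<and> (\<forall>p\<in>dom_c c. \<forall>t\<in>I. u p t = k' (coord c p, t))"
    if c: "c \<in> A" for c
  proof -
    interpret C: riemannian_chart X A g c by unfold_locales (rule c)
    show ?thesis
      by (rule exI[of _ "\<lambda>z. u (param c (fst z)) (snd z)"])
        (use C.continuous_on_spacetime(1)[OF u] C.param_coord in simp)
  qed
  then show "continuous_map (prod_topology X (top_of_set I)) euclideanreal (\<lambda>z. u (fst z) (snd z))"
    by (intro continuous_map_chartwise) simp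
  have "\<exists>k'. continuous_on (coord c ` dom_c c \<times> I) k'
      \<and> (\<forall>p\<in>dom_c c. \<forall>t\<in>I. grad_sq (\<lambda>x. u x t) p = k' (coord c p, t))" if c: "c \<in> A" for c
  proof -
    interpret C: riemannian_chart X A g c by unfold_locales (rule c)
    show ?thesis
      by (rule exI[of _ "\<lambda>z. C.sqnorm (\<lambda>x. u (param c x) (snd z)) (fst z)"])
        (use C.continuous_on_spacetime(2)[OF u] in \<open>simp add: grad_sq_eq[OF u _ c] C.norm_gradient_sq\<close>)
  qed
  then show "continuous_map (prod_topology X (top_of_set I)) euclideanreal (\<lambda>z. grad_sq (\<lambda>x. u x (snd z)) (fst z))"
    by (intro continuous_map_chartwise) simp
qed

text \<open>The set where \<open>P\<close> is nonnegative is closed in a compact space-time, so its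
  projection to time has a least element \<open>t0\<close>. All values before \<open>t0\<close> are
  negative, and continuity in time makes those at \<open>t0\<close> nonpositive.\<close>

lemma first_zero:
  fixes P :: "'a \<Rightarrow> real \<Rightarrow> real"
  assumes "compact_space X"
    and P: "continuous_map (prod_topology X (top_of_set {d..T})) euclideanreal (\<lambda>z. P (fst z) (snd z))"
    and init: "\<And>p. p \<in> topspace X \<Longrightarrow> P p d < 0"
    and viol: "p1 \<in> topspace X" "t1 \<in> {d..T}" "P p1 t1 \<ge> 0"
  obtains p0 t0 where "p0 \<in> topspace X" "d < t0" "t0 \<le> T" "P p0 t0 = 0"
    and "\<And>p. p \<in> topspace X \<Longrightarrow> P p t0 \<le> 0"
    and "\<And>p t. p \<in> topspace X \<Longrightarrow> d \<le> t \<Longrightarrow> t < t0 \<Longrightarrow> P p t < 0"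
proof -
  define XT where "XT = prod_topology X (top_of_set {d..T})"
  define Z where "Z = {z \<in> topspace XT. P (fst z) (snd z) \<in> {0..}}"
  have Zmem: "(p, t) \<in> Z \<longleftrightarrow> p \<in> topspace X \<and> t \<in> {d..T} \<and> P p t \<ge> 0" for p t
    by (auto simp: Z_def XT_def)
  have "compact_space XT"
    using assms(1) by (simp add: XT_def compact_space_prod_topology compact_space_subtopology)
  moreover have "closedin XT Z"
    unfolding Z_def by (rule closedin_continuous_map_preimage[OF P[folded XT_def]]) simp
  ultimately have "compactin XT Z" by (rule closedin_compact_space)
  then have "compactin (top_of_set {d..T}) (snd ` Z)"
    by (rule image_compactin) (simp add: XT_def continuous_map_snd)
  then have "compact (snd ` Z)" by (simp add: compactin_subtopology)
  moreover have "snd ` Z \<noteq> {}" using viol Zmem by blast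
  ultimately have "\<exists>t0\<in>snd ` Z. \<forall>t\<in>snd ` Z. t0 \<le> t"
    by (rule compact_attains_inf)
  then obtain t0 where t0Z: "t0 \<in> snd ` Z" and t0min: "\<forall>t\<in>snd ` Z. t0 \<le> t"
    by (rule bexE)
  note t0 = t0Z bspec[OF t0min]
  then obtain p0 where "(p0, t0) \<in> Z" by force
  then have p0: "p0 \<in> topspace X" "t0 \<in> {d..T}" "P p0 t0 \<ge> 0" by (simp_all add: Zmem)
  have "t0 \<noteq> d" using init[OF p0(1)] p0(3) by auto
  then have dt: "d < t0" using p0(2) by simp
  have before: "P p t < 0" if "p \<in> topspace X" "d \<le> t" "t < t0" for p t
  proof (rule ccontr)
    assume "\<not> P p t < 0"
    then have "(p, t) \<in> Z" using that p0(2) by (simp add: Zmem)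
    then have "t \<in> snd ` Z" by force
    then have "t0 \<le> t" by (rule t0(2))
    then show False using that(3) by simp
  qed
  have le: "P p t0 \<le> 0" if p: "p \<in> topspace X" for p
  proof -
    have "continuous_map (top_of_set {d..T}) (prod_topology X (top_of_set {d..T})) (\<lambda>t. (p, t))"
      using p by (intro continuous_map_pairedI) auto
    from continuous_map_compose[OF this P]
    have "continuous_on {d..T} (P p)" by (simp add: comp_def)
    then have "continuous_on {d..t0} (P p)"
      by (rule continuous_on_subset) (use p0(2) in auto)
    then have "continuous_on (closure {d..<t0}) (P p)" using dt by simp
    then show ?thesis
      by (rule continuous_le_on_closure) (use dt before[OF p] in \<open>auto intro: less_imp_le\<close>)
  qed
  show thesis
    by (rule that[of p0 t0]) (use p0 dt le before in \<open>auto intro: antisym\<close>)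
qed

end

section \<open>The maximum principle\<close>

lemma smooth_on_subset:
  assumes "smooth_on S h" "T \<subseteq> S" shows "smooth_on T h"
  unfolding smooth_on_def
proof
  fix x assume "x \<in> T"
  then have "x \<in> S" using assms(2) by auto
  from bspec[OF assms(1)[unfolded smooth_on_def] this]
  obtain V h' where V: "open V" "x \<in> V" "\<forall>k. Ck_on k V h'" and eq: "\<forall>y\<in>V \<inter> S. h' y = h y"
    by (elim exE conjE)
  have "\<forall>y\<in>V \<inter> T. h' y = h y" using eq assms(2) by auto
  with V show "\<exists>V h'. open V \<and> x \<in> V \<and> (\<forall>k. Ck_on k V h') \<and> (\<forall>y\<in>V \<inter> T. h' y = h y)"
    by (intro exI conjI)
qed

lemma smooth_spacetime_subset:
  assumes "smooth_spacetime A I u" "J \<subseteq> I" shows "smooth_spacetime A J u"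
  unfolding smooth_spacetime_def
proof
  fix c assume "c \<in> A"
  with assms(1) have "smooth_on (coord c ` dom_c c \<times> I) (\<lambda>(y, t). u (param c y) t)"
    unfolding smooth_spacetime_def by (rule bspec)
  then show "smooth_on (coord c ` dom_c c \<times> J) (\<lambda>(y, t). u (param c y) t)"
    by (rule smooth_on_subset) (use assms(2) in auto)
qed

lemma at_within_Ioc_neq_bot:
  fixes t :: real
  assumes "t \<in> {0<..T}" shows "at t within {0<..T} \<noteq> bot"
proof -
  have "t islimpt {0<..<t}" using assms by (intro islimpt_greaterThanLessThan2) auto
  then have "t islimpt {0<..T}" by (rule islimpt_subset) (use assms in auto)
  then show ?thesis by (simp add: trivial_limit_within)
qed

text \<open>A negative derivative would force positive values just before \<open>t\<close>. Only
  times before \<open>t\<close> are used, so the final time is covered.\<close>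

lemma DERIV_nonneg_at_first_zero:
  fixes P :: "real \<Rightarrow> real"
  assumes D: "(P has_real_derivative D) (at t within {0<..T})"
    and "0 < d" "d < t" "t \<le> T" "P t = 0" and neg: "\<And>s. d \<le> s \<Longrightarrow> s < t \<Longrightarrow> P s < 0"
  shows "D \<ge> 0"
proof (rule ccontr)
  assume "\<not> D \<ge> 0"
  then obtain e where e: "e > 0" "\<And>h. h > 0 \<Longrightarrow> t - h \<in> {0<..T} \<Longrightarrow> h < e \<Longrightarrow> P t < P (t - h)"
    using has_real_derivative_neg_dec_left[OF D] by auto
  define h where "h = min e (t - d) / 2"
  have h: "h > 0" "h < e" "h < t - d" using e(1) assms(3) by (auto simp: h_def)
  have "t - h \<in> {0<..T}" using h assms(2,3,4) by auto
  then have "P t < P (t - h)" using e(2) h by blast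
  moreover have "P (t - h) < 0" using h by (intro neg) auto
  ultimately show False using assms(5) by simp
qed

text \<open>The global step: compactness provides a first touching point, and one chart around it
  suffices, since \<open>no_touching\<close> compares values only within a chart. Here
  \<open>B\<close> is a strict upper bound of the solution.\<close>

lemma (in riemannian_manifold) gradient_barrier:
  fixes f q w :: "'a \<Rightarrow> real \<Rightarrow> real" and G :: "real \<Rightarrow> real"
  assumes cpt: "compact_space X"
    and f: "smooth_spacetime A {0<..T} f" and q: "smooth_spacetime A {0<..T} q"
    and w: "smooth_spacetime A {0<..T} w"
    and G: "\<And>x. x > 0 \<Longrightarrow> (G has_real_derivative deriv G x) (at x)"
    and nn: "K \<ge> 0" "\<theta>1 \<ge> 0" "\<theta>2 \<ge> 0" "\<theta>3 \<ge> 0"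
    and Ric: "\<And>c p t v. c \<in> A \<Longrightarrow> p \<in> dom_c c \<Longrightarrow> t \<in> {0<..T} \<Longrightarrow>
           ricci_f g c (\<lambda>x. f x t) p v v \<ge> - K * inner_g g c p v v"
    and eq: "\<And>c p t. c \<in> A \<Longrightarrow> p \<in> dom_c c \<Longrightarrow> t \<in> {0<..T} \<Longrightarrow>
           weighted_laplacian g c (\<lambda>x. f x t) (\<lambda>x. w x t) p - q p t * w p t
             - vector_derivative (w p) (at t within {0<..T}) = G (w p t)"
    and wB: "\<And>p t. p \<in> topspace X \<Longrightarrow> t \<in> {0<..T} \<Longrightarrow> 0 < w p t \<and> w p t < B"
    and qb: "\<And>p t. p \<in> topspace X \<Longrightarrow> t \<in> {0<..T} \<Longrightarrow> \<bar>q p t\<bar> \<le> \<theta>1"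
    and Gb: "\<And>p t. p \<in> topspace X \<Longrightarrow> t \<in> {0<..T} \<Longrightarrow> \<bar>G (w p t)\<bar> \<le> \<theta>2 * \<bar>w p t\<bar>"
    and G'b: "\<And>p t. p \<in> topspace X \<Longrightarrow> t \<in> {0<..T} \<Longrightarrow> \<bar>deriv G (w p t)\<bar> \<le> \<theta>3"
    and dq: "\<And>c p t. c \<in> A \<Longrightarrow> p \<in> dom_c c \<Longrightarrow> t \<in> {0<..T} \<Longrightarrow>
           norm_g g c p (gradient g c (\<lambda>x. q x t) p) \<le> \<theta>4"
    and \<xi>: "\<xi> = 2 * K + \<theta>1 + \<theta>2 + \<theta>3 + 1" and k: "k = 2 + \<theta>4\<^sup>2 / \<xi>"
    and d: "0 < d" and p1: "p1 \<in> topspace X" and t1: "t1 \<in> {d..T}"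
  shows "(t1 - d) / (1 + \<xi> * (t1 - d)) * grad_sq (\<lambda>x. w x t1) p1 < k * (w p1 t1 * (B - w p1 t1))"
proof (rule ccontr)
  define \<phi> where "\<phi> = (\<lambda>t. (t - d) / (1 + \<xi> * (t - d)))"
  define P where "P = (\<lambda>p t. \<phi> t * grad_sq (\<lambda>x. w x t) p - k * (B * w p t - w p t * w p t))"
  assume "\<not> ?thesis"
  then have viol: "P p1 t1 \<ge> 0" by (simp add: P_def \<phi>_def algebra_simps)
  have \<xi>1: "\<xi> \<ge> 1" using \<xi> nn by simp
  have k2: "k \<ge> 2" using \<xi>1 by (simp add: k)
  have den: "1 + \<xi> * (t - d) > 0" if "d \<le> t" for t
    using \<xi>1 that by (intro add_pos_nonneg mult_nonneg_nonneg) auto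
  have sub: "{d..T} \<subseteq> {0<..T}" using d by auto
  have cont: "continuous_map (prod_topology X (top_of_set {d..T})) euclideanreal (\<lambda>z. P (fst z) (snd z))"
  proof -
    have "continuous_on {d..T} \<phi>"
      unfolding \<phi>_def using den by (intro continuous_intros) force
    then have "continuous_map (top_of_set {d..T}) euclideanreal \<phi>" by simp
    from continuous_map_compose[OF continuous_map_snd this]
    have "continuous_map (prod_topology X (top_of_set {d..T})) euclideanreal (\<lambda>z. \<phi> (snd z))"
      by (simp add: comp_def)
    then show ?thesis
      unfolding P_def
      by (intro continuous_map_diff continuous_map_real_mult continuous_map_canonical_const
          continuous_map_spacetime[OF smooth_spacetime_subset[OF w sub]])
  qed
  \<comment> \<open>The weight vanishes at time \<open>d\<close>, so only the negative barrier term
    is left.\<close>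
  have init: "P p d < 0" if "p \<in> topspace X" for p
  proof -
    have "d \<in> {0<..T}" using d t1 by auto
    then have "0 < k * (w p d * (B - w p d))"
      using wB[OF that] k2 by simp
    then show ?thesis by (simp add: P_def \<phi>_def algebra_simps)
  qed
  obtain p0 t0 where p0: "p0 \<in> topspace X" and t0: "d < t0" "t0 \<le> T" and zero: "P p0 t0 = 0"
    and le: "\<And>p. p \<in> topspace X \<Longrightarrow> P p t0 \<le> 0"
    and before: "\<And>p t. p \<in> topspace X \<Longrightarrow> d \<le> t \<Longrightarrow> t < t0 \<Longrightarrow> P p t < 0"
    by (rule first_zero[OF cpt cont init p1 t1 viol]) (assumption | rule that)+
  have t0I: "t0 \<in> {0<..T}" using d t0 by simp
  obtain c where c: "c \<in> A" "p0 \<in> dom_c c" using p0 cover by blast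
  interpret C: riemannian_chart X A g c by unfold_locales (rule c(1))
  define y where "y = coord c p0"
  have y: "y \<in> C.V" using c(2) by (simp add: y_def)
  have py: "param c y = p0" using C.param_coord[OF c(2)] by (simp add: y_def)
  define u where "u = (\<lambda>z. w (param c z) t0)"
  define ut where "ut = (\<lambda>z. vector_derivative (w (param c z)) (at t0 within {0<..T}))"
  have grad_sq_sqnorm: "grad_sq (\<lambda>x. w x t) (param c z) = C.sqnorm (\<lambda>z. w (param c z) t) z"
    if "z \<in> C.V" "t \<in> {0<..T}" for z t
    using grad_sq_eq[OF w that(2) c(1) C.param_mem[OF that(1)]] C.norm_gradient_sq[OF C.param_mem[OF that(1)]]
    by (simp add: C.coord_param[OF that(1)])
  \<comment> \<open>The same chart is used at all times, which allows differentiation in time at a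
    fixed point as well as in space.\<close>
  have P_local: "P (param c z) t = \<phi> t * C.sqnorm (\<lambda>z. w (param c z) t) z - k * (B * w (param c z) t - w (param c z) t * w (param c z) t)"
    if "z \<in> C.V" "t \<in> {0<..T}" for z t
    by (simp add: P_def grad_sq_sqnorm[OF that])
  have inX: "param c z \<in> topspace X" if "z \<in> C.V" for z
    using C.param_mem[OF that] C.dom_subset by blast
  note TD = C.time_derivative[OF w y t0I at_within_Ioc_neq_bot[OF t0I], folded ut_def u_def]
  have time: "1 / (1 + \<xi> * (t0 - d))\<^sup>2 * C.sqnorm u y + \<phi> t0 * (2 * (\<Sum>i\<in>UNIV. C.grad u i y * pdv i ut y))
      - k * (B - 2 * u y) * ut y \<ge> 0"
  proof (rule DERIV_nonneg_at_first_zero[of "P p0" _ t0 T d])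
    have D\<phi>: "(\<phi> has_real_derivative 1 / (1 + \<xi> * (t0 - d))\<^sup>2) (at t0 within {0<..T})"
      unfolding \<phi>_def using den[of t0] t0
      by (auto intro!: derivative_eq_intros simp: power2_eq_square field_simps)
    have Du: "(w (param c y) has_real_derivative ut y) (at t0 within {0<..T})"
      using TD(1) by (simp add: ut_def)
    have "((\<lambda>t. \<phi> t * C.sqnorm (\<lambda>z. w (param c z) t) y - k * (B * w (param c y) t - w (param c y) t * w (param c y) t))
       has_real_derivative (1 / (1 + \<xi> * (t0 - d))\<^sup>2 * C.sqnorm u y + \<phi> t0 * (2 * (\<Sum>i\<in>UNIV. C.grad u i y * pdv i ut y))
      - k * (B - 2 * u y) * ut y)) (at t0 within {0<..T})"
      by (auto intro!: derivative_eq_intros D\<phi> Du TD(2)[folded u_def ut_def] simp: u_def algebra_simps)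
    then show "(P p0 has_real_derivative (1 / (1 + \<xi> * (t0 - d))\<^sup>2 * C.sqnorm u y + \<phi> t0 * (2 * (\<Sum>i\<in>UNIV. C.grad u i y * pdv i ut y))
      - k * (B - 2 * u y) * ut y)) (at t0 within {0<..T})"
      by (rule has_field_derivative_transform_within[OF _ zero_less_one t0I])
        (simp add: P_local[OF y, unfolded py] py)
  qed (use d t0 zero before[OF p0] in auto)
  show False
  proof (rule C.no_touching[OF \<xi> nn k _ \<phi>_def[THEN fun_cong, of t0] refl
        C.Cinf_spacetime_slice[OF f t0I] C.Cinf_spacetime_slice[OF w t0I, folded u_def]
        C.Cinf_spacetime_slice[OF q t0I] y, where G = G and ut = ut and G' = "deriv G (u y)" and B = B])
    show "t0 - d > 0" using t0 by simp
    show "ut z = C.wlap (\<lambda>z. f (param c z) t0) u z - q (param c z) t0 * u z - G (u z)" if z: "z \<in> C.V" for z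
      using eq[OF c(1) C.param_mem[OF z] t0I] C.weighted_laplacian_param[OF z, of "\<lambda>x. f x t0" "\<lambda>x. w x t0"]
      by (simp add: u_def ut_def)
    have up: "0 < u y" "u y < B" using wB[OF p0 t0I] by (simp_all add: u_def py)
    then show "0 < u y" "u y < B" "(G has_real_derivative deriv G (u y)) (at (u y))" by (simp_all add: G)
    show "\<bar>q (param c y) t0\<bar> \<le> \<theta>1" using qb[OF p0 t0I] by (simp add: py)
    show "\<bar>G (u y)\<bar> \<le> \<theta>2 * u y" using Gb[OF p0 t0I] up by (simp add: u_def py)
    show "\<bar>deriv G (u y)\<bar> \<le> \<theta>3" using G'b[OF p0 t0I] by (simp add: u_def py)
    have "norm_g g c p0 (gradient g c (\<lambda>x. q x t0) p0) \<ge> 0"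
    proof -
      have "inner_g g c p0 v v \<ge> 0" for v
        using metric_pos[OF c, of v] by (cases "v = 0") (auto simp: inner_g_def)
      then show ?thesis by (simp add: norm_g_def)
    qed
    then have "(norm_g g c p0 (gradient g c (\<lambda>x. q x t0) p0))\<^sup>2 \<le> \<theta>4\<^sup>2"
      using dq[OF c t0I] by (intro power_mono) auto
    then show "C.sqnorm (\<lambda>z. q (param c z) t0) y \<le> \<theta>4\<^sup>2"
      by (simp add: C.norm_gradient_sq[OF c(2)] y_def)
    show "- K * C.sqnorm u y \<le> (\<Sum>i\<in>UNIV. \<Sum>j\<in>UNIV. (C.ric i j y + C.hs (\<lambda>z. f (param c z) t0) i j y) * C.grad u i y * C.grad u j y)"
      using Ric[OF c t0I, of "gradient g c (\<lambda>x. w x t0) p0"]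
        C.ricci_f_param[OF y, of "\<lambda>x. f x t0" "\<lambda>x. w x t0"] C.inner_gradient_self[OF y, of "\<lambda>x. w x t0"]
      by (simp add: py u_def)
    show "\<phi> t0 * C.sqnorm u y - k * (B * u y - u y * u y) = 0"
      using zero P_local[OF y t0I] by (simp add: py u_def)
    show "\<phi> t0 * C.sqnorm u z - k * (B * u z - u z * u z) \<le> 0" if "z \<in> C.V" for z
      using le[OF inX[OF that]] P_local[OF that t0I] by (simp add: u_def)
    show "0 \<le> 1 / (1 + \<xi> * (t0 - d))\<^sup>2 * C.sqnorm u y + \<phi> t0 * (2 * (\<Sum>i\<in>UNIV. C.grad u i y * pdv i ut y))
      - k * (B - 2 * u y) * ut y" by (rule time)
  qed
qed

lemma logarithmic_bound:
  fixes a w \<theta> \<kappa> :: real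
  assumes "a > 0" "0 < w" "w \<le> a / exp 1" "\<theta> \<ge> 0" "\<kappa> \<ge> 0"
  shows "(2 + \<kappa>) * (a / exp 1 - w) \<le> a / exp 1 * ((ln (a / w) - 1) * \<theta> + ln (a / w) + \<kappa>)"
proof -
  define B where "B = a / exp 1"
  have B: "B > 0" using assms(1) by (simp add: B_def)
  have "ln (a / w) = 1 - ln (w / B)"
    using assms(1,2) by (simp add: B_def ln_div ln_mult)
  moreover have "ln (w / B) \<le> w / B - 1"
    using assms(2) B by (intro ln_le_minus_one) simp
  ultimately have L: "ln (a / w) \<ge> 2 - w / B" by simp
  have "w / B \<le> 1" using assms(3) B by (simp add: B_def[symmetric])
  then have "0 \<le> (ln (a / w) - 1) * \<theta>" using L assms(4) by (intro mult_nonneg_nonneg) auto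
  then have "2 - w / B + \<kappa> \<le> (ln (a / w) - 1) * \<theta> + ln (a / w) + \<kappa>" using L by simp
  then have "B * (2 - w / B + \<kappa>) \<le> B * ((ln (a / w) - 1) * \<theta> + ln (a / w) + \<kappa>)"
    using B by (intro mult_left_mono) auto
  moreover have "(2 + \<kappa>) * (B - w) \<le> B * (2 - w / B + \<kappa>)"
    using B assms(2,5) by (simp add: field_simps)
  ultimately show ?thesis by (simp add: B_def)
qed

theorem theorem3p9:
  fixes X :: "'a topology" and A :: "('a, 'n::finite) chart set" and g :: "('a, 'n) metric"
    and f q w :: "'a \<Rightarrow> real \<Rightarrow> real" and G :: "real \<Rightarrow> real"
    and T K a \<theta>1 \<theta>2 \<theta>3 \<theta>4 \<xi> :: real
  assumes "riemannian_manifold X A g"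
    and "compact_space X"
    and "T > 0"
    and "smooth_spacetime A {0<..T} f"
    and "smooth_spacetime A {0<..T} q"
    and "smooth_spacetime A {0<..T} w"
    and "G C1_differentiable_on {0<..}"
    and "K \<ge> 0"
    and "\<And>c p t v. c \<in> A \<Longrightarrow> p \<in> dom_c c \<Longrightarrow> t \<in> {0<..T} \<Longrightarrow>
           ricci_f g c (\<lambda>x. f x t) p v v \<ge> - K * inner_g g c p v v"
    and "\<And>c p t. c \<in> A \<Longrightarrow> p \<in> dom_c c \<Longrightarrow> t \<in> {0<..T} \<Longrightarrow>
           weighted_laplacian g c (\<lambda>x. f x t) (\<lambda>x. w x t) p - q p t * w p t
             - vector_derivative (w p) (at t within {0<..T}) = G (w p t)"
    and "a > 0"
    and "\<And>p t. p \<in> topspace X \<Longrightarrow> t \<in> {0<..T} \<Longrightarrow> 0 < w p t \<and> w p t \<le> a / exp 1"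
    and "\<theta>1 \<ge> 0" and "\<theta>2 \<ge> 0" and "\<theta>3 \<ge> 0" and "\<theta>4 \<ge> 0"
    and "\<And>p t. p \<in> topspace X \<Longrightarrow> t \<in> {0<..T} \<Longrightarrow> \<bar>q p t\<bar> \<le> \<theta>1"
    and "\<And>p t. p \<in> topspace X \<Longrightarrow> t \<in> {0<..T} \<Longrightarrow> \<bar>G (w p t)\<bar> \<le> \<theta>2 * \<bar>w p t\<bar>"
    and "\<And>p t. p \<in> topspace X \<Longrightarrow> t \<in> {0<..T} \<Longrightarrow> \<bar>deriv G (w p t)\<bar> \<le> \<theta>3"
    and "\<And>c p t. c \<in> A \<Longrightarrow> p \<in> dom_c c \<Longrightarrow> t \<in> {0<..T} \<Longrightarrow>
           norm_g g c p (gradient g c (\<lambda>x. q x t) p) \<le> \<theta>4"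
    and "\<xi> = 2 * K + \<theta>1 + \<theta>2 + \<theta>3 + 1"
  shows "\<forall>c\<in>A. \<forall>p\<in>dom_c c. \<forall>t\<in>{0<..T}.
           (norm_g g c p (gradient g c (\<lambda>x. w x t) p))\<^sup>2 / w p t
             \<le> a / exp 1 * ((ln (a / w p t) - 1) * (\<theta>1 + \<theta>2) + ln (a / w p t) + \<theta>4\<^sup>2 / \<xi>)
                 * (1 / t + \<xi>)"
proof (intro ballI)
  fix c p t assume c: "c \<in> A" and p: "p \<in> dom_c c" and t: "t \<in> {0<..T}"
  interpret riemannian_manifold X A g by fact
  interpret C: riemannian_chart X A g c by unfold_locales (rule c)
  have pX: "p \<in> topspace X" using p C.dom_subset by blast
  define B where "B = a / exp 1"
  define k where "k = 2 + \<theta>4\<^sup>2 / \<xi>"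
  define Q where "Q = grad_sq (\<lambda>x. w x t) p"
  have Q: "Q = (norm_g g c p (gradient g c (\<lambda>x. w x t) p))\<^sup>2"
    unfolding Q_def by (rule grad_sq_eq[OF assms(6) t c p])
  have \<xi>1: "\<xi> \<ge> 1" using assms by simp
  have w: "0 < w p t" "w p t \<le> B" using assms(12)[OF pX t] by (simp_all add: B_def)
  have G: "(G has_real_derivative deriv G x) (at x)" if "x > 0" for x
  proof -
    obtain D where D: "\<forall>x\<in>{0<..}. (G has_vector_derivative D x) (at x)"
      using assms(7) unfolding C1_differentiable_on_def by blast
    have Dx: "(G has_real_derivative D x) (at x)"
      using bspec[OF D, of x] that by (simp add: has_real_derivative_iff_has_vector_derivative)
    then show ?thesis using DERIV_imp_deriv[OF Dx] by simp
  qed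
  \<comment> \<open>The barrier estimate with both auxiliary parameters; \<open>d\<close> tends to 0
    with \<open>B'\<close> fixed, then \<open>B'\<close> tends to \<open>B\<close>. The strict
    inequality becomes weak in the limit.\<close>
  have bound: "(t - d) / (1 + \<xi> * (t - d)) * Q < k * (w p t * (B' - w p t))" if d: "0 < d" "d < t" and B': "B < B'" for d B'
    unfolding Q_def
  proof (rule gradient_barrier[OF assms(2) assms(4-6) G assms(8) assms(13-15) assms(9,10) _ assms(17-21) k_def d(1) pX])
    show "0 < w p s \<and> w p s < B'" if "p \<in> topspace X" "s \<in> {0<..T}" for p s
      using assms(12)[OF that] B' by (auto simp: B_def)
    show "t \<in> {d..T}" using t d by simp
  qed
  have "t / (1 + \<xi> * t) * Q \<le> k * (w p t * (B' - w p t))" if B': "B < B'" for B'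
  proof (rule tendsto_upperbound)
    have "((\<lambda>d. (t - d) / (1 + \<xi> * (t - d)) * Q) \<longlongrightarrow> (t - 0) / (1 + \<xi> * (t - 0)) * Q) (at_right 0)"
      using t \<xi>1 by (intro tendsto_intros) (auto simp: add_pos_pos less_imp_neq[symmetric])
    then show "((\<lambda>d. (t - d) / (1 + \<xi> * (t - d)) * Q) \<longlongrightarrow> t / (1 + \<xi> * t) * Q) (at_right 0)" by simp
    show "\<forall>\<^sub>F d in at_right 0. (t - d) / (1 + \<xi> * (t - d)) * Q \<le> k * (w p t * (B' - w p t))"
      using t bound[OF _ _ B'] by (intro eventually_at_rightI[of 0 t]) (auto intro: less_imp_le)
  qed simp
  then have "t / (1 + \<xi> * t) * Q \<le> k * (w p t * (B - w p t))"
  proof -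
    have "((\<lambda>B'. k * (w p t * (B' - w p t))) \<longlongrightarrow> k * (w p t * (B - w p t))) (at_right B)"
      by (intro tendsto_intros)
    moreover have "\<forall>\<^sub>F B' in at_right B. t / (1 + \<xi> * t) * Q \<le> k * (w p t * (B' - w p t))"
      using \<open>\<And>B'. B < B' \<Longrightarrow> t / (1 + \<xi> * t) * Q \<le> k * (w p t * (B' - w p t))\<close>
      by (intro eventually_at_rightI[of B "B + 1"]) auto
    ultimately show ?thesis by (rule tendsto_lowerbound) simp
  qed
  \<comment> \<open>The reciprocal of the limiting weight is the factor in the claim.\<close>
  moreover have "t / (1 + \<xi> * t) = 1 / (1 / t + \<xi>)"
    using t \<xi>1 by (simp add: field_simps)
  moreover have pos: "1 / t + \<xi> > 0" using t \<xi>1 by (intro add_pos_pos) auto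
  ultimately have "Q / w p t \<le> k * (B - w p t) * (1 / t + \<xi>)"
    using w(1) by (simp add: field_simps)
  also have "\<dots> \<le> B * ((ln (a / w p t) - 1) * (\<theta>1 + \<theta>2) + ln (a / w p t) + \<theta>4\<^sup>2 / \<xi>) * (1 / t + \<xi>)"
    using logarithmic_bound[OF assms(11) w(1), of "\<theta>1 + \<theta>2" "\<theta>4\<^sup>2 / \<xi>"] w(2) assms(13,14) \<xi>1 pos
    unfolding B_def k_def by (intro mult_right_mono) auto
  finally show "(norm_g g c p (gradient g c (\<lambda>x. w x t) p))\<^sup>2 / w p t
      \<le> a / exp 1 * ((ln (a / w p t) - 1) * (\<theta>1 + \<theta>2) + ln (a / w p t) + \<theta>4\<^sup>2 / \<xi>) * (1 / t + \<xi>)"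
    by (simp add: Q B_def)
qed

end
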